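(* Let $(M,g)$ be a conformally flat, not Ricci-parallel, four-dimensional Lie group with a left-invariant pseudo-Riemannian metric whose Ricci operator has Segre type $[(1,12)]$, $[(22)]$ or $[(11,2)]$. Then $(M,g)$ may be a Walker manifold. An explicit example for each Segre type is the following, where $\{e_1,e_2,e_3,e_4\}$ is a pseudo-orthonormal basis of the Lie algebra $\mathfrak g$ and brackets of basis elements not listed (and not determined by skew-symmetry) vanish: 1. (Segre type $[(1,12)]$, neutral signature.) The solvable Lie group $G=\mathbb R\ltimes\mathbb R^3$, whose Lie algebra $\mathfrak g$ is described by $$[e_1,e_2]=-[e_1,e_3]=-\tfrac{1}{2c_1}e_1-c_2e_2-c_2e_3,\qquad [e_2,e_3]=\tfrac{2c_1^2+1}{2c_1}e_2+\tfrac{2c_1^2+1}{2c_1}e_3,$$ $$[e_2,e_4]=-[e_3,e_4]=c_3e_2+c_3e_3+c_1e_4,$$ for any real constants $c_1\neq0$, $c_2$, $c_3$. In this case a left-invariant parallel degenerate line field is given by $\mathcal D=\mathrm{span}(e_2+e_3)$, and $\bar{\mathcal D}=\mathrm{span}(e_2+e_3,\;e_1-e_4)$ is a left-invariant parallel degenerate plane field. 2. (Segre type $[(22)]$, neutral signature.) The solvable Lie group $G=\mathbb R\ltimes E(1,1)$, whose Lie algebra $\mathfrak g$ is described by $$[e_1,e_2]=\tfrac12 e_4,\quad [e_1,e_3]=\tfrac32(e_1+e_3),\quad [e_1,e_4]=\tfrac54e_2+e_4,\quad [e_2,e_3]=e_2+\tfrac54e_4,\quad [e_3,e_4]=-\tfrac12e_2,$$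 for any real constant $c_1\neq0$ (a constant which does not occur in these brackets). In this case $\bar{\mathcal D}=\mathrm{span}(e_1+e_3,\;e_2+e_4)$ is a left-invariant parallel degenerate plane field. 3. (Segre type $[(11,2)]$, Lorentzian signature.) The solvable Lie group $G=\mathbb R\ltimes H$, where $H$ is the Heisenberg group, whose Lie algebra $\mathfrak g$ is described by $$[e_1,e_2]=c_1e_3+c_1e_4,\qquad [e_1,e_3]=-[e_1,e_4]=-\tfrac{1}{2c_2}e_1-c_1e_2-c_3e_3-c_3e_4,$$ $$[e_3,e_4]=\tfrac{2c_2^2+1}{2c_2}(e_3+e_4),\qquad [e_2,e_3]=-[e_2,e_4]=-c_2e_2+c_4e_3+c_4e_4,$$ for any real constants $c_1,c_3,c_4$ and $c_2\neq0$. In this case a left-invariant parallel degenerate line field is generated by $\mathcal D=\mathrm{span}(e_3+e_4)$.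
   Context: Conventions. In neutral signature $(2,2)$ the basis vectors $e_1,e_2$ are spacelike and $e_3,e_4$ timelike; in the Lorentzian case $e_1,e_2,e_3$ are spacelike and $e_4$ is timelike. $\nabla$ is the Levi-Civita connection, $R(X,Y)=[\nabla_X,\nabla_Y]-\nabla_{[X,Y]}$, the Ricci tensor is $\varrho(X,Y)=\sum_i\varepsilon_i\,g(R(e_i,X)Y,e_i)$ for a pseudo-orthonormal basis $\{e_i\}$ with $\varepsilon_i=g(e_i,e_i)=\pm1$, and the Ricci operator $Q$ is defined by $g(QX,Y)=\varrho(X,Y)$. Not Ricci-parallel means $\nabla\varrho\neq0$. $E(1,1)$ denotes the group of rigid motions of the Minkowski plane. Segre types: the digits list the sizes of the Jordan blocks of $Q$, blocks enclosed in the same round brackets sharing the same eigenvalue. Thus $[(1,12)]$ (neutral signature): a single real eigenvalue with two Jordan blocks of size $1$ (one with spacelike and one with timelike eigenvector) and one of size $2$; $[(22)]$ (neutral signature): a single real eigenvalue with two Jordan blocks of size $2$; $[(11,2)]$ (Lorentzian signature): a single real eigenvalue with two Jordan blocks of size $1$ (spacelike eigenvectors) and one of size $2$. Walker structure: a pseudo-Riemannian manifold admitting a parallel degenerate distribution is called a Walker manifold. Here the distributions considered have rank $1$ (line field) or $2$ (plane field), are spanned by left-invariant vector fields, are degenerate in the sense that $g$ vanishes identically on them (null), and are parallel: $\nabla_XY$ lies in the distribution for every vector field $X$ and every section $Y$ of it.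
   Formalization: In item 2 the brackets [e1,e2]=1/2 e4, [e3,e4]=-1/2 e2, which violate the Jacobi identity, are corrected to 1/4 e4 and -1/4 e2, and the group R⋉E(1,1) to R⋉H (H Heisenberg); in item 3, for c1=0, the group is R⋉R^3 instead of R⋉H. *)

theory Defs
  imports "HOL-Analysis.Analysis" "HOL-Algebra.Solvable_Groups"
begin

section \<open>Smooth maps and vector fields on a Euclidean space\<close>

text \<open>
  All manifolds below are Lie groups whose underlying manifold is a Euclidean space
  \<^typ>\<open>'a::euclidean_space\<close> with its standard global chart; this covers every simply
  connected solvable Lie group. Every tangent space is identified with \<^typ>\<open>'a\<close>.
\<close>

primrec Ck :: "nat \<Rightarrow> ('a::euclidean_space \<Rightarrow> 'b::real_normed_vector) \<Rightarrow> bool" where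
  "Ck 0 f \<longleftrightarrow> continuous_on UNIV f"
| "Ck (Suc k) f \<longleftrightarrow>
     (\<forall>p. f differentiable (at p)) \<and> (\<forall>v. Ck k (\<lambda>p. frechet_derivative f (at p) v))"

definition smooth :: "('a::euclidean_space \<Rightarrow> 'b::real_normed_vector) \<Rightarrow> bool" where
  "smooth f \<longleftrightarrow> (\<forall>k. Ck k f)"

type_synonym 'a vfield = "'a \<Rightarrow> 'a"

definition deriv_along :: "'a::euclidean_space vfield \<Rightarrow> ('a \<Rightarrow> real) \<Rightarrow> 'a \<Rightarrow> real" where
  "deriv_along X f = (\<lambda>p. frechet_derivative f (at p) (X p))"

definition lie_bracket :: "'a::euclidean_space vfield \<Rightarrow> 'a vfield \<Rightarrow> 'a vfield" where
  "lie_bracket X Y =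
     (\<lambda>p. frechet_derivative Y (at p) (X p) - frechet_derivative X (at p) (Y p))"

section \<open>Pseudo-Riemannian geometry\<close>

type_synonym 'a metric = "'a \<Rightarrow> 'a \<Rightarrow> 'a \<Rightarrow> real"

definition pseudo_riemannian :: "'a::euclidean_space metric \<Rightarrow> bool" where
  "pseudo_riemannian g \<longleftrightarrow>
     (\<forall>p. bilinear (g p)) \<and> (\<forall>p v w. g p v w = g p w v) \<and>
     (\<forall>p v. (\<forall>w. g p v w = 0) \<longrightarrow> v = 0) \<and>
     (\<forall>v w. smooth (\<lambda>p. g p v w))"

definition is_levi_civita ::
  "'a::euclidean_space metric \<Rightarrow> ('a vfield \<Rightarrow> 'a vfield \<Rightarrow> 'a vfield) \<Rightarrow> bool" where
  "is_levi_civita g D \<longleftrightarrow>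
     (\<forall>X Y. smooth X \<longrightarrow> smooth Y \<longrightarrow> smooth (D X Y)) \<and>
     (\<forall>X X' Y. smooth X \<longrightarrow> smooth X' \<longrightarrow> smooth Y \<longrightarrow>
        D (\<lambda>p. X p + X' p) Y = (\<lambda>p. D X Y p + D X' Y p)) \<and>
     (\<forall>X Y Y'. smooth X \<longrightarrow> smooth Y \<longrightarrow> smooth Y' \<longrightarrow>
        D X (\<lambda>p. Y p + Y' p) = (\<lambda>p. D X Y p + D X Y' p)) \<and>
     (\<forall>f X Y. smooth f \<longrightarrow> smooth X \<longrightarrow> smooth Y \<longrightarrow>
        D (\<lambda>p. f p *\<^sub>R X p) Y = (\<lambda>p. f p *\<^sub>R D X Y p)) \<and>
     (\<forall>f X Y. smooth f \<longrightarrow> smooth X \<longrightarrow> smooth Y \<longrightarrow>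
        D X (\<lambda>p. f p *\<^sub>R Y p) = (\<lambda>p. f p *\<^sub>R D X Y p + deriv_along X f p *\<^sub>R Y p)) \<and>
     (\<forall>X Y. smooth X \<longrightarrow> smooth Y \<longrightarrow>
        (\<lambda>p. D X Y p - D Y X p) = lie_bracket X Y) \<and>
     (\<forall>X Y Z. smooth X \<longrightarrow> smooth Y \<longrightarrow> smooth Z \<longrightarrow>
        deriv_along X (\<lambda>p. g p (Y p) (Z p)) =
          (\<lambda>p. g p (D X Y p) (Z p) + g p (Y p) (D X Z p)))"

text \<open>
  The Levi-Civita connection is uniquely determined on smooth fields only, hence the choice
  operator; its values at non-smooth arguments are never used.
\<close>

definition levi_civita ::
  "'a::euclidean_space metric \<Rightarrow> 'a vfield \<Rightarrow> 'a vfield \<Rightarrow> 'a vfield" where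
  "levi_civita g = (SOME D. is_levi_civita g D)"

definition curvature ::
  "'a::euclidean_space metric \<Rightarrow> 'a vfield \<Rightarrow> 'a vfield \<Rightarrow> 'a vfield \<Rightarrow> 'a vfield" where
  "curvature g X Y Z =
     (let D = levi_civita g
      in (\<lambda>p. D X (D Y Z) p - D Y (D X Z) p - D (lie_bracket X Y) Z p))"

text \<open>
  Locally, \<open>g\<close> is conformal to a flat metric. The conformal factor is only relevant near
  \<open>p\<close>; as a smooth function defined near \<open>p\<close> agrees near \<open>p\<close> with a globally defined one,
  there is no loss in taking \<open>\<phi>\<close> smooth on the whole space.
\<close>

definition conformally_flat :: "'a::euclidean_space metric \<Rightarrow> bool" where
  "conformally_flat g \<longleftrightarrow>
     (\<forall>p. \<exists>U \<phi>. open U \<and> p \<in> U \<and> smooth \<phi> \<and>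
        (\<forall>X Y Z. smooth X \<longrightarrow> smooth Y \<longrightarrow> smooth Z \<longrightarrow>
           (\<forall>q\<in>U. curvature (\<lambda>q v w. exp (2 * \<phi> q) * g q v w) X Y Z q = 0)))"

definition pseudo_orthonormal ::
  "'a::euclidean_space metric \<Rightarrow> real^4 \<Rightarrow> (4 \<Rightarrow> 'a vfield) \<Rightarrow> bool" where
  "pseudo_orthonormal g \<epsilon> e \<longleftrightarrow>
     (\<forall>p i j. g p (e i p) (e j p) = (if i = j then \<epsilon> $ i else 0))"

definition neutral_signature :: "real^4" where
  "neutral_signature = vector [1, 1, -1, -1]"

definition lorentzian_signature :: "real^4" where
  "lorentzian_signature = vector [1, 1, 1, -1]"

text \<open>The next four notions refer to a pseudo-orthonormal frame \<open>e\<close>; their values do not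
  depend on it.\<close>

definition ricci ::
  "'a::euclidean_space metric \<Rightarrow> (4 \<Rightarrow> 'a vfield) \<Rightarrow> 'a vfield \<Rightarrow> 'a vfield \<Rightarrow> 'a \<Rightarrow> real" where
  "ricci g e X Y =
     (\<lambda>p. \<Sum>i\<in>UNIV. g p (e i p) (e i p) * g p (curvature g (e i) X Y p) (e i p))"

definition ricci_parallel :: "'a::euclidean_space metric \<Rightarrow> (4 \<Rightarrow> 'a vfield) \<Rightarrow> bool" where
  "ricci_parallel g e \<longleftrightarrow>
     (\<forall>X Y Z. smooth X \<longrightarrow> smooth Y \<longrightarrow> smooth Z \<longrightarrow>
        (\<forall>p. deriv_along X (ricci g e Y Z) p
             - ricci g e (levi_civita g X Y) Z p - ricci g e Y (levi_civita g X Z) p = 0))"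

definition ricci_operator ::
  "'a::euclidean_space metric \<Rightarrow> (4 \<Rightarrow> 'a vfield) \<Rightarrow> 'a vfield \<Rightarrow> 'a vfield" where
  "ricci_operator g e X =
     (\<lambda>p. THE v. \<forall>Y. smooth Y \<longrightarrow> g p v (Y p) = ricci g e X Y p)"

text \<open>The Ricci operator as an endomorphism of the tangent space at \<open>p\<close>: a tangent vector is
  extended to the vector field that is constant in the chart.\<close>

definition ricci_operator_at ::
  "'a::euclidean_space metric \<Rightarrow> (4 \<Rightarrow> 'a vfield) \<Rightarrow> 'a \<Rightarrow> 'a \<Rightarrow> 'a" where
  "ricci_operator_at g e p v = ricci_operator g e (\<lambda>_. v) p"

section \<open>Segre types\<close>

text \<open>A Jordan basis of \<open>T\<close> with single eigenvalue \<open>l\<close>, one list of vectors per Jordan block,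
  each list starting with the eigenvector of the block.\<close>

definition jordan_basis ::
  "('a::euclidean_space \<Rightarrow> 'a) \<Rightarrow> real \<Rightarrow> 'a list list \<Rightarrow> bool" where
  "jordan_basis T l cs \<longleftrightarrow>
     linear T \<and> distinct (concat cs) \<and> independent (set (concat cs)) \<and>
     span (set (concat cs)) = UNIV \<and>
     (\<forall>c\<in>set cs. c \<noteq> [] \<and> T (hd c) = l *\<^sub>R hd c \<and>
        (\<forall>i. Suc i < length c \<longrightarrow> T (c ! Suc i) = l *\<^sub>R (c ! Suc i) + c ! i))"

text \<open>Here \<open>b\<close> is the scalar product on the space on which \<open>T\<close> acts.\<close>

definition segre_1_12 ::
  "('a::euclidean_space \<Rightarrow> 'a \<Rightarrow> real) \<Rightarrow> ('a \<Rightarrow> 'a) \<Rightarrow> bool" where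
  "segre_1_12 b T \<longleftrightarrow>
     (\<exists>l u v x y. jordan_basis T l [[u], [v], [x, y]] \<and> b u u > 0 \<and> b v v < 0)"

definition segre_22 :: "('a::euclidean_space \<Rightarrow> 'a) \<Rightarrow> bool" where
  "segre_22 T \<longleftrightarrow> (\<exists>l u v x y. jordan_basis T l [[u, v], [x, y]])"

definition segre_11_2 ::
  "('a::euclidean_space \<Rightarrow> 'a \<Rightarrow> real) \<Rightarrow> ('a \<Rightarrow> 'a) \<Rightarrow> bool" where
  "segre_11_2 b T \<longleftrightarrow>
     (\<exists>l u v x y. jordan_basis T l [[u], [v], [x, y]] \<and> b u u > 0 \<and> b v v > 0)"

section \<open>Distributions and Walker manifolds\<close>

type_synonym 'a distrib = "'a \<Rightarrow> 'a set"

definition is_distribution :: "nat \<Rightarrow> 'a::euclidean_space distrib \<Rightarrow> bool" where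
  "is_distribution r D \<longleftrightarrow>
     (\<forall>p. subspace (D p) \<and> dim (D p) = r) \<and>
     (\<forall>p. \<forall>v\<in>D p. \<exists>X. smooth X \<and> (\<forall>q. X q \<in> D q) \<and> X p = v)"

definition parallel_null_distribution ::
  "'a::euclidean_space metric \<Rightarrow> nat \<Rightarrow> 'a distrib \<Rightarrow> bool" where
  "parallel_null_distribution g r D \<longleftrightarrow>
     is_distribution r D \<and>
     (\<forall>p. \<forall>v\<in>D p. \<forall>w\<in>D p. g p v w = 0) \<and>
     (\<forall>X Y. smooth X \<longrightarrow> smooth Y \<longrightarrow> (\<forall>p. Y p \<in> D p) \<longrightarrow> (\<forall>p. levi_civita g X Y p \<in> D p))"

definition walker_manifold :: "'a::euclidean_space metric \<Rightarrow> bool" where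
  "walker_manifold g \<longleftrightarrow> (\<exists>r D. 0 < r \<and> parallel_null_distribution g r D)"

section \<open>Lie groups with left-invariant metrics\<close>

definition lie_group :: "'a::euclidean_space monoid \<Rightarrow> bool" where
  "lie_group G \<longleftrightarrow>
     group G \<and> carrier G = UNIV \<and>
     smooth (\<lambda>(x, y). x \<otimes>\<^bsub>G\<^esub> y) \<and> smooth (\<lambda>x. inv\<^bsub>G\<^esub> x)"

definition left_translation_deriv ::
  "'a::euclidean_space monoid \<Rightarrow> 'a \<Rightarrow> 'a \<Rightarrow> 'a \<Rightarrow> 'a" where
  "left_translation_deriv G a p = frechet_derivative (\<lambda>x. a \<otimes>\<^bsub>G\<^esub> x) (at p)"

definition left_invariant_field :: "'a::euclidean_space monoid \<Rightarrow> 'a vfield \<Rightarrow> bool" where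
  "left_invariant_field G X \<longleftrightarrow>
     smooth X \<and> (\<forall>a p. X (a \<otimes>\<^bsub>G\<^esub> p) = left_translation_deriv G a p (X p))"

definition left_invariant_metric :: "'a::euclidean_space monoid \<Rightarrow> 'a metric \<Rightarrow> bool" where
  "left_invariant_metric G g \<longleftrightarrow>
     (\<forall>a p v w. g (a \<otimes>\<^bsub>G\<^esub> p) (left_translation_deriv G a p v) (left_translation_deriv G a p w)
        = g p v w)"

definition spanned_by :: "'a::euclidean_space vfield list \<Rightarrow> 'a distrib" where
  "spanned_by Xs = (\<lambda>p. span ((\<lambda>X. X p) ` set Xs))"

definition left_invariant_distribution ::
  "'a::euclidean_space monoid \<Rightarrow> 'a distrib \<Rightarrow> bool" where
  "left_invariant_distribution G D \<longleftrightarrow>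
     (\<exists>Xs. (\<forall>X\<in>set Xs. left_invariant_field G X) \<and> D = spanned_by Xs)"

definition lin_comb :: "(4 \<Rightarrow> 'a::euclidean_space vfield) \<Rightarrow> real^4 \<Rightarrow> 'a vfield" where
  "lin_comb e a = (\<lambda>p. \<Sum>i\<in>UNIV. (a $ i) *\<^sub>R e i p)"

text \<open>On a four-dimensional group, \<open>e\<close> is a pseudo-orthonormal basis of the Lie algebra of
  left-invariant vector
  fields of \<open>G\<close>, linear independence being a consequence of pseudo-orthonormality.\<close>

definition metric_lie_group ::
  "'a::euclidean_space monoid \<Rightarrow> 'a metric \<Rightarrow> real^4 \<Rightarrow> (4 \<Rightarrow> 'a vfield) \<Rightarrow> bool" where
  "metric_lie_group G g \<epsilon> e \<longleftrightarrow>
     lie_group G \<and> pseudo_riemannian g \<and> left_invariant_metric G g \<and>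
     (\<forall>i. left_invariant_field G (e i)) \<and> pseudo_orthonormal g \<epsilon> e"

definition has_brackets ::
  "(4 \<Rightarrow> 'a::euclidean_space vfield) \<Rightarrow>
    real^4 \<Rightarrow> real^4 \<Rightarrow> real^4 \<Rightarrow> real^4 \<Rightarrow> real^4 \<Rightarrow> real^4 \<Rightarrow> bool" where
  "has_brackets e b12 b13 b14 b23 b24 b34 \<longleftrightarrow>
     lie_bracket (e 1) (e 2) = lin_comb e b12 \<and>
     lie_bracket (e 1) (e 3) = lin_comb e b13 \<and>
     lie_bracket (e 1) (e 4) = lin_comb e b14 \<and>
     lie_bracket (e 2) (e 3) = lin_comb e b23 \<and>
     lie_bracket (e 2) (e 4) = lin_comb e b24 \<and>
     lie_bracket (e 3) (e 4) = lin_comb e b34"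

section \<open>Semidirect products of the real line with a group\<close>

definition translation_group :: "(real^3) monoid" where
  "translation_group = \<lparr>carrier = UNIV, mult = (+), one = 0\<rparr>"

text \<open>The Heisenberg group in exponential coordinates.\<close>

definition heisenberg_group :: "(real^3) monoid" where
  "heisenberg_group =
     \<lparr>carrier = UNIV,
      mult = (\<lambda>x y. x + y + vector [0, 0, (x $ 1 * y $ 2 - x $ 2 * y $ 1) / 2]),
      one = 0\<rparr>"

definition smooth_action ::
  "'n::euclidean_space monoid \<Rightarrow> (real \<Rightarrow> 'n \<Rightarrow> 'n) \<Rightarrow> bool" where
  "smooth_action N \<phi> \<longleftrightarrow>
     (\<forall>s. \<phi> s \<in> hom N N) \<and> \<phi> 0 = id \<and> (\<forall>s t. \<phi> (s + t) = \<phi> s \<circ> \<phi> t) \<and>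
     smooth (\<lambda>(s, n). \<phi> s n)"

definition semidirect_R ::
  "'n::euclidean_space monoid \<Rightarrow> (real \<Rightarrow> 'n \<Rightarrow> 'n) \<Rightarrow> (real \<times> 'n) monoid" where
  "semidirect_R N \<phi> =
     \<lparr>carrier = UNIV,
      mult = (\<lambda>(s, m) (t, n). (s + t, m \<otimes>\<^bsub>N\<^esub> \<phi> s n)),
      one = (0, \<one>\<^bsub>N\<^esub>)\<rparr>"

definition is_semidirect_R ::
  "'n::euclidean_space monoid \<Rightarrow> (real \<times> 'n) monoid \<Rightarrow> bool" where
  "is_semidirect_R N G \<longleftrightarrow> (\<exists>\<phi>. smooth_action N \<phi> \<and> G = semidirect_R N \<phi>)"

section \<open>The three families\<close>

type_synonym r4 = "real \<times> (real^3)"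

definition example_1_12 ::
  "real \<Rightarrow> real \<Rightarrow> real \<Rightarrow> r4 monoid \<Rightarrow> r4 metric \<Rightarrow>
    (4 \<Rightarrow> r4 vfield) \<Rightarrow> bool" where
  "example_1_12 c1 c2 c3 G g e \<longleftrightarrow>
     is_semidirect_R translation_group G \<and>
     metric_lie_group G g neutral_signature e \<and>
     has_brackets e
       (vector [- 1 / (2 * c1), - c2, - c2, 0])
       (vector [1 / (2 * c1), c2, c2, 0])
       0
       (vector [0, (2 * c1\<^sup>2 + 1) / (2 * c1), (2 * c1\<^sup>2 + 1) / (2 * c1), 0])
       (vector [0, c3, c3, c1])
       (vector [0, - c3, - c3, - c1])"

text \<open>
  This family is in the literature displayed with \<open>[e1,e2] = 1/2 e4\<close> and \<open>[e3,e4] = - 1/2 e2\<close> (and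
  otherwise as below), and with \<open>\<real> \<ltimes> E(1,1)\<close> as the group. Those brackets violate the Jacobi
  identity, see the lemma below. The coefficients \<open>1/4\<close> and \<open>- 1/4\<close> restore it and give the
  Ricci operator \<open>e1, -e3 \<mapsto> e1 + e3\<close> and \<open>e2, -e4 \<mapsto> e2 + e4\<close>. The derived algebra of the resulting
  Lie algebra is \<open>span {e1 + e3, e2, e4}\<close>; it is a Heisenberg algebra and is the only
  three-dimensional ideal, so that the group is an extension \<open>\<real> \<ltimes> H\<close> with the Heisenberg group.
\<close>

definition example_22 ::
  "r4 monoid \<Rightarrow> r4 metric \<Rightarrow>
    (4 \<Rightarrow> r4 vfield) \<Rightarrow> bool" where
  "example_22 G g e \<longleftrightarrow>
     is_semidirect_R heisenberg_group G \<and>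
     metric_lie_group G g neutral_signature e \<and>
     has_brackets e
       (vector [0, 0, 0, 1/4])
       (vector [3/2, 0, 3/2, 0])
       (vector [0, 5/4, 0, 1])
       (vector [0, 1, 0, 5/4])
       0
       (vector [0, - (1/4), 0, 0])"

lemma one_half_brackets_violate_jacobi:
  fixes B :: "'v::real_vector \<Rightarrow> 'v \<Rightarrow> 'v"
  assumes bil: "bilinear B" and alt: "\<And>x. B x x = 0"
    and jacobi: "\<And>x y z. B x (B y z) + B y (B z x) + B z (B x y) = 0"
    and indep: "independent {e1, e2, e3, e4}" "distinct [e1, e2, e3, e4]"
    and brackets: "B e1 e2 = (1/2) *\<^sub>R e4" "B e1 e3 = (3/2) *\<^sub>R (e1 + e3)"
      "B e1 e4 = (5/4) *\<^sub>R e2 + e4" "B e2 e3 = e2 + (5/4) *\<^sub>R e4"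
      "B e2 e4 = 0" "B e3 e4 = - (1/2) *\<^sub>R e2"
  shows False
proof -
  note B_simps = bilinear_ladd[OF bil] bilinear_radd[OF bil]
    bilinear_lmul[OF bil] bilinear_rmul[OF bil] bilinear_rneg[OF bil] bilinear_rsub[OF bil]
  have skew: "B y x = - B x y" for x y
  proof -
    have "B x y + B y x = B (x + y) (x + y)"
      by (subst bilinear_ladd[OF bil]) (simp add: bilinear_radd[OF bil] alt)
    then show ?thesis
      by (metis alt add.commute eq_neg_iff_add_eq_0)
  qed
  have 1: "B e1 (B e2 e3) = (25/16) *\<^sub>R e2 + (7/4) *\<^sub>R e4"
  proof -
    have "B e1 (B e2 e3) = (1/2) *\<^sub>R e4 + (25/16) *\<^sub>R e2 + (5/4) *\<^sub>R e4"
      by (simp add: brackets B_simps scaleR_add_right)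
    also have "\<dots> = (25/16) *\<^sub>R e2 + (1/2 + 5/4) *\<^sub>R e4"
      by (simp only: scaleR_add_left ac_simps)
    finally show ?thesis by simp
  qed
  have 2: "B e2 (B e3 e1) = (- 3/2) *\<^sub>R e2 + (- 9/8) *\<^sub>R e4"
  proof -
    have "B e2 (B e3 e1) = (3/4) *\<^sub>R e4 + (- 3/2) *\<^sub>R e2 + (- 15/8) *\<^sub>R e4"
      by (simp add: skew[of e3 e1] skew[of e2 e1] brackets B_simps algebra_simps)
    also have "\<dots> = (- 3/2) *\<^sub>R e2 + (3/4 + - 15/8) *\<^sub>R e4"
      by (simp only: scaleR_add_left ac_simps)
    finally show ?thesis by simp
  qed
  have 3: "B e3 (B e1 e2) = (- 1/4) *\<^sub>R e2"
    by (simp add: brackets B_simps)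
  have "(25/16 + - 3/2 + - 1/4) *\<^sub>R e2 + (7/4 + - 9/8) *\<^sub>R e4
      = B e1 (B e2 e3) + B e2 (B e3 e1) + B e3 (B e1 e2)"
    unfolding 1 2 3 by (simp only: scaleR_add_left ac_simps)
  then have "(- 3/16) *\<^sub>R e2 + (5/8) *\<^sub>R e4 = 0"
    using jacobi by simp
  then have "(3/16) *\<^sub>R e2 = (5/8) *\<^sub>R e4"
    by simp
  then have "(16/3) *\<^sub>R (3/16) *\<^sub>R e2 = (16/3) *\<^sub>R (5/8) *\<^sub>R e4"
    by (rule arg_cong)
  then have "e2 = (10/3) *\<^sub>R e4"
    by simp
  moreover have "(10/3) *\<^sub>R e4 \<in> span ({e1, e2, e3, e4} - {e2})"
    using indep(2) by (intro span_scale span_base) auto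
  ultimately have "e2 \<in> span ({e1, e2, e3, e4} - {e2})"
    by metis
  then show False
    using indep(1) unfolding dependent_def by blast
qed

text \<open>The ideal \<open>span {e1, e2, e3 + e4}\<close> is a Heisenberg algebra iff \<open>c1 \<noteq> 0\<close>. For
  \<open>c1 = 0\<close> it is abelian and still the only three-dimensional ideal, so that \<open>H\<close> has to be
  read as its degenerate form \<open>\<real>\<^sup>3\<close>.\<close>

definition example_11_2 ::
  "real \<Rightarrow> real \<Rightarrow> real \<Rightarrow> real \<Rightarrow> r4 monoid \<Rightarrow> r4 metric \<Rightarrow>
    (4 \<Rightarrow> r4 vfield) \<Rightarrow> bool" where
  "example_11_2 c1 c2 c3 c4 G g e \<longleftrightarrow>
     is_semidirect_R (if c1 = 0 then translation_group else heisenberg_group) G \<and>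
     metric_lie_group G g lorentzian_signature e \<and>
     has_brackets e
       (vector [0, 0, c1, c1])
       (vector [- 1 / (2 * c2), - c1, - c3, - c3])
       (vector [1 / (2 * c2), c1, c3, c3])
       (vector [0, - c2, c4, c4])
       (vector [0, c2, - c4, - c4])
       (vector [0, 0, (2 * c2\<^sup>2 + 1) / (2 * c2), (2 * c2\<^sup>2 + 1) / (2 * c2)])"

end

theory Submission
  imports Defs
begin

text \<open>
  Everything is reduced to algebra on \<open>\<real>\<^sup>4\<close>. A left-invariant frame \<open>e\<close> identifies all tangent
  spaces with \<open>\<real>\<^sup>4\<close>, and a vector field becomes a function \<open>y\<close> with values in \<open>\<real>\<^sup>4\<close>. In these terms
  the Levi-Civita connection is \<open>y \<mapsto> dy + \<Gamma> y\<close> with a constant bilinear map \<open>\<Gamma>\<close>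
  (\<open>connection_is_levi_civita\<close>), because torsion and metric compatibility need only be checked on the
  frame. Second derivatives commute, so the curvature of such a connection is the algebraic
  expression \<open>\<Gamma> a (\<Gamma> b c) - \<Gamma> b (\<Gamma> a c) - \<Gamma> [a, b] c\<close> (\<open>connection_commutator\<close>). The Ricci operator,
  its Jordan form, the covariant derivative of the Ricci tensor and the parallelism of left-invariant
  distributions are then read off from \<open>\<Gamma>\<close> (\<open>metric_parallelization\<close>).

  Conformal flatness looks like a differential equation for the conformal factor, but it has a
  solution whose gradient is a left-invariant null field \<open>n\<close>, and then the rescaled metric again has a
  constant Christoffel map, namely \<open>\<Gamma> a b + B n a b + B n b a - B a b n\<close>. Flatness of that map is a
  polynomial identity. In the families with a nilpotent Ricci operator of rank one, \<open>n\<close> is a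
  multiple of the parallel null field \<open>e\<^sub>2 + e\<^sub>3\<close> or \<open>e\<^sub>3 + e\<^sub>4\<close>; in the remaining family it is half of
  \<open>e\<^sub>1 + e\<^sub>3\<close>. In all three cases \<open>n\<close> spans the orthogonal complement of the derived algebra, which has
  dimension three. Every homomorphism to \<open>\<real>\<close> has a differential that is left-invariant and vanishes
  on the derived algebra, so the projection of \<open>\<real> \<ltimes> N\<close> to \<open>\<real>\<close> is, up to a factor, a function with
  gradient \<open>n\<close> (\<open>primitive_of_annihilator\<close>). No integration is needed.

  For the existence of the groups, all three Lie algebras are semidirect sums of \<open>\<real>\<close> with \<open>\<real>\<^sup>3\<close> or
  the Heisenberg algebra on which the generator acts by a matrix of the same lower triangular shape.
  One group with parameters therefore serves all of them (\<open>extension_of_nilpotent\<close>), and the given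
  frames differ from its standard frame by a change of basis.
\<close>

section \<open>Calculus of smooth maps\<close>

lemma smooth_iff:
  fixes f :: "'a::euclidean_space \<Rightarrow> 'b::real_normed_vector"
  shows "smooth f \<longleftrightarrow>
    (\<forall>p. f differentiable (at p)) \<and> (\<forall>v. smooth (\<lambda>p. frechet_derivative f (at p) v))"
proof
  assume "smooth f"
  then have "Ck (Suc k) f" for k
    unfolding smooth_def by blast
  then show "(\<forall>p. f differentiable (at p)) \<and> (\<forall>v. smooth (\<lambda>p. frechet_derivative f (at p) v))"
    by (simp add: smooth_def)
next
  assume *: "(\<forall>p. f differentiable (at p)) \<and> (\<forall>v. smooth (\<lambda>p. frechet_derivative f (at p) v))"
  have "Ck k f" for k
  proof (cases k)
    case 0
    then show ?thesis
      using * by (simp add: differentiable_imp_continuous_within continuous_at_imp_continuous_on)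
  next
    case (Suc k')
    then show ?thesis
      using * by (simp add: smooth_def)
  qed
  then show "smooth f"
    by (simp add: smooth_def)
qed

lemma Ck_Suc_imp_Ck: "Ck (Suc k) f \<Longrightarrow> Ck k f"
proof (induction k arbitrary: f)
  case 0
  then show ?case
    by (simp add: differentiable_imp_continuous_within continuous_at_imp_continuous_on)
next
  case (Suc k)
  have "f differentiable at p" for p
    using Suc.prems by simp
  moreover have "Ck k (\<lambda>p. frechet_derivative f (at p) v)" for v
    using Suc.prems by (intro Suc.IH) simp
  ultimately show ?case
    by simp
qed

lemma smooth_differentiable: "smooth f \<Longrightarrow> f differentiable (at p)"
  using smooth_iff[of f] by blast

lemma smooth_has_derivative: "smooth f \<Longrightarrow> (f has_derivative frechet_derivative f (at p)) (at p)"
  using smooth_differentiable frechet_derivative_works by blast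

lemma smooth_frechet_derivative: "smooth f \<Longrightarrow> smooth (\<lambda>p. frechet_derivative f (at p) v)"
  using smooth_iff[of f] by blast

lemma smooth_continuous_on: "smooth f \<Longrightarrow> continuous_on UNIV f"
  by (metis Ck.simps(1) smooth_def)

lemma linear_frechet_derivative_smooth: "smooth f \<Longrightarrow> linear (frechet_derivative f (at p))"
  by (simp add: linear_frechet_derivative smooth_differentiable)

lemma frechet_derivative_eqI: "(f has_derivative f') (at p) \<Longrightarrow> frechet_derivative f (at p) = f'"
  by (rule frechet_derivative_at[symmetric])

lemma Ck_SucI:
  fixes f :: "'a::euclidean_space \<Rightarrow> 'b::real_normed_vector"
  assumes "\<And>p. (f has_derivative f' p) (at p)" and "\<And>v. Ck k (\<lambda>p. f' p v)"
  shows "Ck (Suc k) f"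
proof -
  have "frechet_derivative f (at p) = f' p" for p
    using assms(1) by (rule frechet_derivative_eqI)
  then show ?thesis
    using assms by (auto simp: differentiable_def)
qed

lemma Ck_const: "Ck k (\<lambda>p. c)"
  by (induction k arbitrary: c) auto

lemma Ck_add: "Ck k f \<Longrightarrow> Ck k g \<Longrightarrow> Ck k (\<lambda>p. f p + g p)"
proof (induction k arbitrary: f g)
  case 0
  then show ?case
    by (simp add: continuous_on_add)
next
  case (Suc k)
  show ?case
  proof (rule Ck_SucI)
    show "((\<lambda>p. f p + g p) has_derivative
        (\<lambda>v. frechet_derivative f (at p) v + frechet_derivative g (at p) v)) (at p)" for p
      using Suc.prems by (auto intro!: has_derivative_add simp: frechet_derivative_works[symmetric])
    show "Ck k (\<lambda>p. frechet_derivative f (at p) v + frechet_derivative g (at p) v)" for v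
      using Suc.prems by (intro Suc.IH) auto
  qed
qed

lemma Ck_bounded_bilinear:
  fixes prod :: "'b::real_normed_vector \<Rightarrow> 'c::real_normed_vector \<Rightarrow> 'd::real_normed_vector"
  assumes B: "bounded_bilinear prod"
  shows "Ck k f \<Longrightarrow> Ck k g \<Longrightarrow> Ck k (\<lambda>p. prod (f p) (g p))"
proof (induction k arbitrary: f g)
  case 0
  then show ?case
    by (simp add: bounded_bilinear.continuous_on[OF B])
next
  case (Suc k)
  have fg: "Ck k f" "Ck k g"
    using Suc.prems by (auto intro: Ck_Suc_imp_Ck)
  show ?case
  proof (rule Ck_SucI)
    show "((\<lambda>p. prod (f p) (g p)) has_derivative
        (\<lambda>v. prod (f p) (frechet_derivative g (at p) v) + prod (frechet_derivative f (at p) v) (g p)))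
        (at p)" for p
      using Suc.prems
      by (intro bounded_bilinear.FDERIV[OF B]) (auto simp: frechet_derivative_works[symmetric])
    show "Ck k (\<lambda>p. prod (f p) (frechet_derivative g (at p) v)
        + prod (frechet_derivative f (at p) v) (g p))" for v
      using Suc.prems fg by (intro Ck_add Suc.IH) auto
  qed
qed

lemma Ck_linear_compose: "linear L \<Longrightarrow> Ck k f \<Longrightarrow> Ck k (\<lambda>p. L (f p))"
  for L :: "'b::euclidean_space \<Rightarrow> 'c::real_normed_vector"
proof (induction k arbitrary: f)
  case 0
  then show ?case
    by (auto intro: linear_continuous_on_compose)
next
  case (Suc k)
  show ?case
  proof (rule Ck_SucI)
    show "((\<lambda>p. L (f p)) has_derivative (\<lambda>v. L (frechet_derivative f (at p) v))) (at p)" for p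
      using Suc.prems
      by (intro bounded_linear.has_derivative[of L])
        (simp_all add: linear_conv_bounded_linear[symmetric] frechet_derivative_works[symmetric])
    show "Ck k (\<lambda>p. L (frechet_derivative f (at p) v))" for v
      using Suc.prems by (intro Suc.IH) auto
  qed
qed

lemma Ck_exp:
  fixes f :: "'a::euclidean_space \<Rightarrow> real"
  shows "Ck k f \<Longrightarrow> Ck k (\<lambda>p. exp (f p))"
proof (induction k)
  case 0
  then show ?case
    by (simp add: continuous_on_exp)
next
  case (Suc k)
  show ?case
  proof (rule Ck_SucI)
    fix p
    have "(f has_derivative frechet_derivative f (at p)) (at p)"
      using Suc.prems by (simp add: frechet_derivative_works[symmetric])
    from has_derivative_exp[OF this]
    show "((\<lambda>p. exp (f p)) has_derivative (\<lambda>v. exp (f p) * frechet_derivative f (at p) v)) (at p)"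
      by (simp add: mult.commute)
  next
    show "Ck k (\<lambda>p. exp (f p) * frechet_derivative f (at p) v)" for v
      using Suc Ck_Suc_imp_Ck[OF Suc.prems]
      by (intro Ck_bounded_bilinear[OF bounded_bilinear_mult]) auto
  qed
qed

named_theorems smooth_intros

lemma smooth_const [smooth_intros]: "smooth (\<lambda>p. c)"
  by (simp add: smooth_def Ck_const)

lemma smooth_add [smooth_intros]: "smooth f \<Longrightarrow> smooth g \<Longrightarrow> smooth (\<lambda>p. f p + g p)"
  by (simp add: smooth_def Ck_add)

lemma smooth_bounded_bilinear:
  "bounded_bilinear B \<Longrightarrow> smooth f \<Longrightarrow> smooth g \<Longrightarrow> smooth (\<lambda>p. B (f p) (g p))"
  by (simp add: smooth_def Ck_bounded_bilinear)

lemmas smooth_scaleR [smooth_intros] = smooth_bounded_bilinear[OF bounded_bilinear_scaleR]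

lemmas smooth_inner [smooth_intros] = smooth_bounded_bilinear[OF bounded_bilinear_inner]

lemma smooth_mult [smooth_intros]:
  "smooth f \<Longrightarrow> smooth g \<Longrightarrow> smooth (\<lambda>p. f p * g p)"
  for f g :: "'a::euclidean_space \<Rightarrow> real"
  by (rule smooth_bounded_bilinear[OF bounded_bilinear_mult])

lemma smooth_linear:
  fixes L :: "'b::euclidean_space \<Rightarrow> 'c::real_normed_vector"
  shows "linear L \<Longrightarrow> smooth f \<Longrightarrow> smooth (\<lambda>p. L (f p))"
  by (simp add: smooth_def Ck_linear_compose)

lemma smooth_exp [smooth_intros]:
  fixes f :: "'a::euclidean_space \<Rightarrow> real"
  shows "smooth f \<Longrightarrow> smooth (\<lambda>p. exp (f p))"
  by (simp add: smooth_def Ck_exp)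

lemma smooth_id [smooth_intros]: "smooth (\<lambda>p. p)"
proof -
  have "Ck k (\<lambda>p::'a. p)" for k
    by (induction k) (auto intro: Ck_const)
  then show ?thesis
    by (simp add: smooth_def)
qed

lemma smooth_minus [smooth_intros]: "smooth f \<Longrightarrow> smooth (\<lambda>p. - f p)"
  using smooth_scaleR[OF smooth_const[of "-1"], of f] by simp

lemma smooth_diff [smooth_intros]: "smooth f \<Longrightarrow> smooth g \<Longrightarrow> smooth (\<lambda>p. f p - g p)"
  using smooth_add[of f "\<lambda>p. - g p"] smooth_minus[of g] by simp

lemma smooth_divide_const [smooth_intros]:
  fixes f :: "'a::euclidean_space \<Rightarrow> real"
  shows "smooth f \<Longrightarrow> smooth (\<lambda>p. f p / c)"
  using smooth_mult[OF _ smooth_const, of f "1 / c"] by simp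

lemma smooth_sum [smooth_intros]:
  "(\<And>i. i \<in> A \<Longrightarrow> smooth (f i)) \<Longrightarrow> smooth (\<lambda>p. \<Sum>i\<in>A. f i p)"
  by (induction A rule: infinite_finite_induct) (auto intro: smooth_intros)

lemma smooth_fst [smooth_intros]: "smooth f \<Longrightarrow> smooth (\<lambda>p. fst (f p))"
  for f :: "'a::euclidean_space \<Rightarrow> 'b::euclidean_space \<times> 'c::euclidean_space"
  by (rule smooth_linear[OF linear_fst])

lemma smooth_snd [smooth_intros]: "smooth f \<Longrightarrow> smooth (\<lambda>p. snd (f p))"
  for f :: "'a::euclidean_space \<Rightarrow> 'b::euclidean_space \<times> 'c::euclidean_space"
  by (rule smooth_linear[OF linear_snd])

lemma smooth_nth [smooth_intros]: "smooth f \<Longrightarrow> smooth (\<lambda>p. f p $ i)"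
  for f :: "'a::euclidean_space \<Rightarrow> real^'n"
  by (rule smooth_linear[OF bounded_linear.linear[OF bounded_linear_vec_nth]])

lemma smooth_Pair [smooth_intros]: "smooth f \<Longrightarrow> smooth g \<Longrightarrow> smooth (\<lambda>p. (f p, g p))"
  for f :: "'a::euclidean_space \<Rightarrow> 'b::euclidean_space"
    and g :: "'a::euclidean_space \<Rightarrow> 'c::euclidean_space"
proof -
  assume "smooth f" "smooth g"
  moreover have "linear (\<lambda>x::'b. (x, 0::'c))" "linear (\<lambda>y::'c. (0::'b, y))"
    by (auto intro!: linearI)
  ultimately have "smooth (\<lambda>p. (f p, 0::'c) + (0::'b, g p))"
    by (intro smooth_add) (rule smooth_linear, assumption+)+
  then show ?thesis
    by simp
qed

lemma smooth_vec_iff: "smooth f \<longleftrightarrow> (\<forall>i. smooth (\<lambda>p. f p $ i))"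
  for f :: "'a::euclidean_space \<Rightarrow> real^'n"
proof
  assume "\<forall>i. smooth (\<lambda>p. f p $ i)"
  then have "smooth (\<lambda>p. \<Sum>i\<in>UNIV. (f p $ i) *\<^sub>R axis i (1::real))"
    by (intro smooth_sum smooth_scaleR smooth_const) auto
  moreover have "(\<Sum>i\<in>UNIV. (f p $ i) *\<^sub>R axis i (1::real)) = f p" for p
    using basis_expansion[of "f p"] by (simp only: scalar_mult_eq_scaleR)
  ultimately show "smooth f"
    by simp
qed (auto intro: smooth_intros)

lemma smooth_bilinear:
  fixes B :: "'b::euclidean_space \<Rightarrow> 'c::euclidean_space \<Rightarrow> 'd::real_normed_vector"
  assumes "bilinear B" "smooth f" "smooth g"
  shows "smooth (\<lambda>p. B (f p) (g p))"
  using assms by (simp add: smooth_bounded_bilinear bilinear_conv_bounded_bilinear)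

lemma frechet_derivative_bilinear:
  fixes B :: "'b::euclidean_space \<Rightarrow> 'c::euclidean_space \<Rightarrow> 'd::real_normed_vector"
  assumes "bilinear B" "smooth f" "smooth g"
  shows "frechet_derivative (\<lambda>p. B (f p) (g p)) (at p) v
    = B (f p) (frechet_derivative g (at p) v) + B (frechet_derivative f (at p) v) (g p)"
  by (rule fun_cong[OF frechet_derivative_eqI[OF
        bounded_bilinear.FDERIV[OF assms(1)[unfolded bilinear_conv_bounded_bilinear]
          smooth_has_derivative[OF assms(2)] smooth_has_derivative[OF assms(3)]]]])

lemma frechet_derivative_add_smooth:
  assumes "smooth f" "smooth g"
  shows "frechet_derivative (\<lambda>p. f p + g p) (at p) v
    = frechet_derivative f (at p) v + frechet_derivative g (at p) v"
  by (rule fun_cong[OF frechet_derivative_eqI[OF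
        has_derivative_add[OF smooth_has_derivative[OF assms(1)] smooth_has_derivative[OF assms(2)]]]])

lemma frechet_derivative_scaleR_smooth:
  fixes f :: "'a::euclidean_space \<Rightarrow> real"
  assumes "smooth f" "smooth g"
  shows "frechet_derivative (\<lambda>p. f p *\<^sub>R g p) (at p) v
    = f p *\<^sub>R frechet_derivative g (at p) v + frechet_derivative f (at p) v *\<^sub>R g p"
  by (rule fun_cong[OF frechet_derivative_eqI[OF
        has_derivative_scaleR[OF smooth_has_derivative[OF assms(1)] smooth_has_derivative[OF assms(2)]]]])

text \<open>A vector is a combination of fixed basis vectors, so the smoothness of the values on fixed
  vectors is enough.\<close>

lemma smooth_linear_family:
  fixes X :: "'a::euclidean_space \<Rightarrow> 'b::euclidean_space"
  assumes lin: "\<And>p. linear (A p)" and A: "\<And>v. smooth (\<lambda>p. A p v)" and X: "smooth X"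
  shows "smooth (\<lambda>p. A p (X p))"
proof -
  have "A p (X p) = (\<Sum>b\<in>Basis. (X p \<bullet> b) *\<^sub>R A p b)" for p
    by (subst euclidean_representation[of "X p", symmetric])
      (simp add: linear_sum[OF lin] linear_cmul[OF lin])
  then show ?thesis
    using A X by (simp add: smooth_intros)
qed

lemma smooth_directional_derivative [smooth_intros]:
  "smooth f \<Longrightarrow> smooth X \<Longrightarrow> smooth (\<lambda>p. frechet_derivative f (at p) (X p))"
  by (rule smooth_linear_family)
    (auto intro: linear_frechet_derivative_smooth smooth_frechet_derivative)

lemma smooth_lie_bracket [smooth_intros]: "smooth X \<Longrightarrow> smooth Y \<Longrightarrow> smooth (lie_bracket X Y)"
  unfolding lie_bracket_def by (intro smooth_intros)

text \<open>The product rule for a matrix times a vector; the matrix-valued function \<open>A\<close> is accessible only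
  through its values on fixed vectors.\<close>

lemma has_derivative_linear_family:
  fixes X :: "'a::euclidean_space \<Rightarrow> 'b::euclidean_space"
  assumes lin: "\<And>p. linear (A p)" and A: "\<And>v. smooth (\<lambda>p. A p v)" and X: "smooth X"
  shows "((\<lambda>p. A p (X p)) has_derivative
    (\<lambda>v. frechet_derivative (\<lambda>q. A q (X p)) (at p) v + A p (frechet_derivative X (at p) v))) (at p)"
proof -
  have rep: "A q x = (\<Sum>b\<in>Basis. (x \<bullet> b) *\<^sub>R A q b)" for q x
    by (subst euclidean_representation[of x, symmetric])
      (simp add: linear_sum[OF lin] linear_cmul[OF lin])
  have X': "((\<lambda>q. X q \<bullet> b) has_derivative (\<lambda>v. frechet_derivative X (at p) v \<bullet> b)) (at p)" for b
    by (rule bounded_linear.has_derivative[OF bounded_linear_inner_left smooth_has_derivative[OF X]])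
  have A': "((\<lambda>q. A q b) has_derivative frechet_derivative (\<lambda>q. A q b) (at p)) (at p)" for b
    by (rule smooth_has_derivative[OF A])
  have "((\<lambda>q. \<Sum>b\<in>Basis. (X p \<bullet> b) *\<^sub>R A q b) has_derivative
      (\<lambda>v. \<Sum>b\<in>Basis. (X p \<bullet> b) *\<^sub>R frechet_derivative (\<lambda>q. A q b) (at p) v)) (at p)"
    by (intro has_derivative_sum has_derivative_scaleR_right A')
  then have 1: "frechet_derivative (\<lambda>q. A q (X p)) (at p) v
      = (\<Sum>b\<in>Basis. (X p \<bullet> b) *\<^sub>R frechet_derivative (\<lambda>q. A q b) (at p) v)" for v
    by (simp add: rep[of _ "X p"] frechet_derivative_eqI)
  have "((\<lambda>q. \<Sum>b\<in>Basis. (X q \<bullet> b) *\<^sub>R A q b) has_derivative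
      (\<lambda>v. \<Sum>b\<in>Basis. (X p \<bullet> b) *\<^sub>R frechet_derivative (\<lambda>q. A q b) (at p) v
          + (frechet_derivative X (at p) v \<bullet> b) *\<^sub>R A p b)) (at p)"
    by (intro has_derivative_sum has_derivative_scaleR X' A')
  then show ?thesis
    unfolding 1 by (simp add: rep[of _ "X _"] rep[of _ "frechet_derivative X (at p) _"] sum.distrib)
qed

text \<open>Two applications of the mean value theorem, one in each direction. The second difference on the
  left is symmetric in \<open>v\<close> and \<open>w\<close>, the iterated derivative on the right is not obviously so; for
  \<open>h \<rightarrow> 0\<close> this gives Schwarz's theorem.\<close>

lemma second_difference_mean_value:
  fixes f :: "'a::euclidean_space \<Rightarrow> real"
  assumes f: "smooth f" and h: "0 < h"
  obtains a b where "0 < a" "a < h" "0 < b" "b < h"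
    "f (p + h *\<^sub>R v + h *\<^sub>R w) - f (p + h *\<^sub>R v) - f (p + h *\<^sub>R w) + f p
     = h * h * frechet_derivative (\<lambda>q. frechet_derivative f (at q) v) (at (p + a *\<^sub>R v + b *\<^sub>R w)) w"
proof -
  define f' where "f' q = frechet_derivative f (at q) v" for q
  have f': "smooth f'"
    unfolding f'_def by (rule smooth_frechet_derivative[OF f])
  have d: "((\<lambda>s. F (c + s *\<^sub>R u)) has_real_derivative frechet_derivative F (at (c + s *\<^sub>R u)) u) (at s)"
    if F: "smooth F" for F :: "'a \<Rightarrow> real" and c u s
  proof -
    have lin: "linear (frechet_derivative F (at (c + s *\<^sub>R u)))"
      by (rule linear_frechet_derivative_smooth[OF F])
    have "((\<lambda>s. c + s *\<^sub>R u) has_derivative (\<lambda>t. t *\<^sub>R u)) (at s)"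
      by (auto intro!: derivative_eq_intros)
    note has_derivative_compose[OF this smooth_has_derivative[OF F]]
    moreover have "(\<lambda>t. frechet_derivative F (at (c + s *\<^sub>R u)) (t *\<^sub>R u))
        = (*) (frechet_derivative F (at (c + s *\<^sub>R u)) u)"
      by (rule ext) (simp add: linear_cmul[OF lin] mult.commute)
    ultimately show ?thesis
      by (simp add: has_field_derivative_def)
  qed
  define G where "G s = f ((p + h *\<^sub>R w) + s *\<^sub>R v) - f (p + s *\<^sub>R v)" for s
  have "(G has_real_derivative (f' ((p + h *\<^sub>R w) + s *\<^sub>R v) - f' (p + s *\<^sub>R v))) (at s)" for s
    unfolding G_def f'_def by (intro DERIV_diff d f)
  from MVT2[OF h this] obtain a where a: "0 < a" "a < h"
    "G h - G 0 = h * (f' ((p + h *\<^sub>R w) + a *\<^sub>R v) - f' (p + a *\<^sub>R v))"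
    by auto
  have "((\<lambda>t. f' ((p + a *\<^sub>R v) + t *\<^sub>R w)) has_real_derivative
      frechet_derivative f' (at ((p + a *\<^sub>R v) + t *\<^sub>R w)) w) (at t)" for t
    by (rule d[OF f'])
  from MVT2[OF h this] obtain b where b: "0 < b" "b < h"
    "f' ((p + a *\<^sub>R v) + h *\<^sub>R w) - f' ((p + a *\<^sub>R v) + 0 *\<^sub>R w)
      = h * frechet_derivative f' (at ((p + a *\<^sub>R v) + b *\<^sub>R w)) w"
    by auto
  show thesis
    using a b by (intro that[of a b]) (auto simp: G_def f'_def[abs_def] algebra_simps)
qed

lemma second_derivative_symmetric_real:
  fixes f :: "'a::euclidean_space \<Rightarrow> real"
  assumes f: "smooth f"
  shows "frechet_derivative (\<lambda>q. frechet_derivative f (at q) v) (at p) w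
       = frechet_derivative (\<lambda>q. frechet_derivative f (at q) w) (at p) v"
proof -
  define A where "A v w q = frechet_derivative (\<lambda>q. frechet_derivative f (at q) v) (at q) w" for v w q
  define h where "h n = inverse (real (Suc n))" for n
  have h0: "h n > 0" for n
    by (simp add: h_def)
  have lim0: "(\<lambda>n. c n) \<longlonglongrightarrow> 0" if "\<And>n. 0 < c n \<and> c n < h n" for c
  proof (rule tendsto_sandwich[OF _ _ tendsto_const])
    show "h \<longlonglongrightarrow> 0"
      unfolding h_def by (rule LIMSEQ_inverse_real_of_nat)
  qed (use that in \<open>auto intro!: always_eventually less_imp_le\<close>)
  have cont: "continuous_on UNIV (A v w)" for v w
    unfolding A_def by (intro smooth_continuous_on smooth_frechet_derivative f)
  have ex: "\<exists>a b. 0 < a \<and> a < h n \<and> 0 < b \<and> b < h n \<and>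
     f (p + h n *\<^sub>R v + h n *\<^sub>R w) - f (p + h n *\<^sub>R v) - f (p + h n *\<^sub>R w) + f p
     = h n * h n * A v w (p + a *\<^sub>R v + b *\<^sub>R w)" for n v w
    using second_difference_mean_value[OF f h0] unfolding A_def by metis
  have lim: "(\<lambda>n. (f (p + h n *\<^sub>R v + h n *\<^sub>R w) - f (p + h n *\<^sub>R v) - f (p + h n *\<^sub>R w) + f p)
      / (h n * h n)) \<longlonglongrightarrow> A v w p" for v w
  proof -
    obtain a b where ab: "\<And>n. 0 < a n \<and> a n < h n" "\<And>n. 0 < b n \<and> b n < h n"
      and eq: "\<And>n. f (p + h n *\<^sub>R v + h n *\<^sub>R w) - f (p + h n *\<^sub>R v) - f (p + h n *\<^sub>R w) + f p
        = h n * h n * A v w (p + a n *\<^sub>R v + b n *\<^sub>R w)"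
      using ex[of _ v w] by metis
    have "(\<lambda>n. p + a n *\<^sub>R v + b n *\<^sub>R w) \<longlonglongrightarrow> p + 0 *\<^sub>R v + 0 *\<^sub>R w"
      using ab by (intro tendsto_intros lim0) auto
    then have "(\<lambda>n. A v w (p + a n *\<^sub>R v + b n *\<^sub>R w)) \<longlonglongrightarrow> A v w p"
      using cont[of v w] by (auto intro: continuous_on_tendsto_compose)
    then show ?thesis
      using h0 by (simp add: eq less_imp_neq[symmetric])
  qed
  have "A v w p = A w v p"
    using lim[of v w] lim[of w v] by (intro LIMSEQ_unique) (simp_all add: algebra_simps)
  then show ?thesis
    by (simp add: A_def)
qed

lemma second_derivative_symmetric:
  fixes f :: "'a::euclidean_space \<Rightarrow> 'b::euclidean_space"
  assumes f: "smooth f"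
  shows "frechet_derivative (\<lambda>q. frechet_derivative f (at q) v) (at p) w
       = frechet_derivative (\<lambda>q. frechet_derivative f (at q) w) (at p) v"
proof (rule euclidean_eqI)
  fix b :: 'b
  have inner: "frechet_derivative (\<lambda>q. F q \<bullet> b) (at q) = (\<lambda>v. frechet_derivative F (at q) v \<bullet> b)"
    if "smooth F" for F :: "'a \<Rightarrow> 'b" and q
    using smooth_has_derivative[OF that, of q]
    by (intro frechet_derivative_eqI) (auto intro!: derivative_eq_intros)
  have 2: "frechet_derivative (\<lambda>q. frechet_derivative f (at q) v) (at p) w \<bullet> b
      = frechet_derivative (\<lambda>q. frechet_derivative (\<lambda>q. f q \<bullet> b) (at q) v) (at p) w" for v w
    by (simp only: inner[OF f] inner[OF smooth_frechet_derivative[OF f]])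
  show "frechet_derivative (\<lambda>q. frechet_derivative f (at q) v) (at p) w \<bullet> b
      = frechet_derivative (\<lambda>q. frechet_derivative f (at q) w) (at p) v \<bullet> b"
    unfolding 2 by (intro second_derivative_symmetric_real smooth_intros f)
qed

text \<open>Expanding the left-hand side by the product rule gives second derivatives of \<open>f\<close>, which cancel by
  symmetry, and first derivatives along the derivatives of the fields, which combine to the
  bracket.\<close>

lemma commutator_directional_derivatives:
  fixes f :: "'a::euclidean_space \<Rightarrow> 'b::euclidean_space"
  assumes f: "smooth f" and X: "smooth X" and Y: "smooth Y"
  shows "frechet_derivative (\<lambda>q. frechet_derivative f (at q) (Y q)) (at p) (X p)
       - frechet_derivative (\<lambda>q. frechet_derivative f (at q) (X q)) (at p) (Y p)
       = frechet_derivative f (at p) (lie_bracket X Y p)"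
proof -
  have "frechet_derivative (\<lambda>q. frechet_derivative f (at q) (Z q)) (at p) v
      = frechet_derivative (\<lambda>q. frechet_derivative f (at q) (Z p)) (at p) v
        + frechet_derivative f (at p) (frechet_derivative Z (at p) v)" if "smooth Z" for Z v
    by (rule fun_cong[OF frechet_derivative_eqI[OF has_derivative_linear_family[OF
        linear_frechet_derivative_smooth[OF f] smooth_frechet_derivative[OF f] that]]])
  then show ?thesis
    using second_derivative_symmetric[OF f, of "Y p" p "X p"]
    by (simp add: X Y lie_bracket_def linear_diff[OF linear_frechet_derivative_smooth[OF f]])
qed

section \<open>The Levi-Civita connection\<close>

lemma is_levi_civita_torsion_free:
  assumes "is_levi_civita g D" "smooth X" "smooth Y"
  shows "D X Y p - D Y X p = lie_bracket X Y p"
proof -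
  have "(\<lambda>p. D X Y p - D Y X p) = lie_bracket X Y"
    using assms unfolding is_levi_civita_def by blast
  then show ?thesis
    by (rule fun_cong)
qed

lemma is_levi_civita_metric:
  assumes "is_levi_civita g D" "smooth X" "smooth Y" "smooth Z"
  shows "deriv_along X (\<lambda>p. g p (Y p) (Z p)) p = g p (D X Y p) (Z p) + g p (Y p) (D X Z p)"
proof -
  have "deriv_along X (\<lambda>p. g p (Y p) (Z p)) = (\<lambda>p. g p (D X Y p) (Z p) + g p (Y p) (D X Z p))"
    using assms unfolding is_levi_civita_def by blast
  then show ?thesis
    by (rule fun_cong)
qed

text \<open>The difference of two such connections is symmetric in \<open>X\<close> and \<open>Y\<close>, because both are torsion-free,
  and its scalar product with \<open>Z\<close> is skew in \<open>Y\<close> and \<open>Z\<close>, because both are metric. A form in three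
  arguments with these two symmetries vanishes.\<close>

lemma levi_civita_unique:
  fixes g :: "'a::euclidean_space metric"
  assumes g: "pseudo_riemannian g" and D: "is_levi_civita g D" and D': "is_levi_civita g D'"
    and X: "smooth X" and Y: "smooth Y"
  shows "D X Y = D' X Y"
proof
  fix p
  have bil: "bilinear (g p)" and sym: "g p v w = g p w v"
    and nondeg: "(\<forall>w. g p v w = 0) \<Longrightarrow> v = 0" for v w
    using g unfolding pseudo_riemannian_def by auto
  define t where "t X Y Z = g p (D X Y p - D' X Y p) (Z p)" for X Y Z
  have 1: "t X Y Z = - t X Z Y" if "smooth X" "smooth Y" "smooth Z" for X Y Z
  proof -
    have "g p (D X Y p) (Z p) + g p (Y p) (D X Z p) = g p (D' X Y p) (Z p) + g p (Y p) (D' X Z p)"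
      using is_levi_civita_metric[OF D that, of p] is_levi_civita_metric[OF D' that, of p] by simp
    then show ?thesis
      by (simp add: t_def bilinear_lsub[OF bil] sym[of "Y p"])
  qed
  have 2: "t X Y Z = t Y X Z" if "smooth X" "smooth Y" for X Y Z
  proof -
    have "D X Y p - D Y X p = D' X Y p - D' Y X p"
      using is_levi_civita_torsion_free[OF D that, of p] is_levi_civita_torsion_free[OF D' that, of p]
      by simp
    then have "D X Y p - D' X Y p = D Y X p - D' Y X p"
      by (simp add: algebra_simps)
    then show ?thesis
      by (simp add: t_def)
  qed
  have "t X Y Z = 0" if "smooth Z" for Z
    \<comment> \<open>Alternating the two symmetries six times returns to the start with the opposite sign.\<close>
    using 1[of X Y Z] 2[of X Z Y] 1[of Z X Y] 2[of Z Y X] 1[of Y Z X] 2[of Y X Z] X Y that by simp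
  then have "g p (D X Y p - D' X Y p) w = 0" for w
    using smooth_const[of w] unfolding t_def by blast
  then show "D X Y p = D' X Y p"
    using nondeg by force
qed

lemma levi_civita_eq:
  assumes "pseudo_riemannian g" "is_levi_civita g D" "smooth X" "smooth Y"
  shows "levi_civita g X Y = D X Y"
  using levi_civita_unique[OF assms(1) _ assms(2-4)] someI[of "is_levi_civita g" D] assms(2)
  unfolding levi_civita_def by blast

section \<open>Parallelizations with constant structure\<close>

text \<open>A parallelization \<open>E\<close> of the tangent bundle by a vector space \<open>'v\<close> such that the fields
  \<open>\<lambda>p. E p a\<close> form a Lie algebra, with bracket \<open>C\<close>: on a Lie group, \<open>E p\<close> is the derivative of a
  left translation. A field \<open>X\<close> is studied through its coordinate function \<open>\<lambda>p. \<theta> p (X p)\<close> with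
  values in the fixed space \<open>'v\<close>.\<close>

locale parallelization =
  fixes E :: "'a::euclidean_space \<Rightarrow> 'v::euclidean_space \<Rightarrow> 'a"
    and \<theta> :: "'a \<Rightarrow> 'a \<Rightarrow> 'v"
    and C :: "'v \<Rightarrow> 'v \<Rightarrow> 'v"
  assumes linear_E: "linear (E p)" and linear_\<theta>: "linear (\<theta> p)"
    and E_\<theta> [simp]: "E p (\<theta> p v) = v" and \<theta>_E [simp]: "\<theta> p (E p a) = a"
    and smooth_E: "smooth (\<lambda>p. E p a)" and smooth_\<theta>: "smooth (\<lambda>p. \<theta> p v)"
    and bracket_E: "lie_bracket (\<lambda>p. E p a) (\<lambda>p. E p b) = (\<lambda>p. E p (C a b))"
begin

lemma smooth_coordinates [smooth_intros]: "smooth X \<Longrightarrow> smooth (\<lambda>p. \<theta> p (X p))"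
  by (rule smooth_linear_family[OF linear_\<theta> smooth_\<theta>])

lemma smooth_E_field [smooth_intros]: "smooth y \<Longrightarrow> smooth (\<lambda>p. E p (y p))"
  by (rule smooth_linear_family[OF linear_E smooth_E])

lemmas E_simps = linear_add[OF linear_E] linear_diff[OF linear_E] linear_cmul[OF linear_E]
  linear_0[OF linear_E]
lemmas \<theta>_simps = linear_add[OF linear_\<theta>] linear_diff[OF linear_\<theta>] linear_cmul[OF linear_\<theta>]
  linear_0[OF linear_\<theta>]

lemma inj_E: "inj (E p)"
  by (metis \<theta>_E injI)

lemma surj_E: "surj (E p)"
  by (metis E_\<theta> surjI)

text \<open>Differentiating \<open>Y = E y\<close> by the product rule gives \<open>E (dy)\<close> and the derivative of \<open>E\<close> with \<open>y\<close> kept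
  fixed. The latter terms form, at each point, the bracket of two fields with constant coordinates.\<close>

lemma coordinates_lie_bracket:
  assumes X: "smooth X" and Y: "smooth Y"
  shows "\<theta> p (lie_bracket X Y p) = frechet_derivative (\<lambda>q. \<theta> q (Y q)) (at p) (X p)
    - frechet_derivative (\<lambda>q. \<theta> q (X q)) (at p) (Y p) + C (\<theta> p (X p)) (\<theta> p (Y p))"
proof -
  have d: "frechet_derivative Z (at p) v = frechet_derivative (\<lambda>q. E q (\<theta> p (Z p))) (at p) v
      + E p (frechet_derivative (\<lambda>q. \<theta> q (Z q)) (at p) v)" if "smooth Z" for Z v
    using has_derivative_linear_family[OF linear_E smooth_E smooth_coordinates[OF that], of p]
    by (simp add: frechet_derivative_eqI)
  have "frechet_derivative (\<lambda>q. E q (\<theta> p (Y p))) (at p) (X p)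
      - frechet_derivative (\<lambda>q. E q (\<theta> p (X p))) (at p) (Y p) = E p (C (\<theta> p (X p)) (\<theta> p (Y p)))"
    using fun_cong[OF bracket_E[of "\<theta> p (X p)" "\<theta> p (Y p)"], of p] by (simp add: lie_bracket_def)
  then have "lie_bracket X Y p = E p (frechet_derivative (\<lambda>q. \<theta> q (Y q)) (at p) (X p)
    - frechet_derivative (\<lambda>q. \<theta> q (X q)) (at p) (Y p) + C (\<theta> p (X p)) (\<theta> p (Y p)))"
    unfolding lie_bracket_def d[OF X] d[OF Y] by (simp add: E_simps algebra_simps)
  then show ?thesis
    by simp
qed

text \<open>The affine connection with constant Christoffel symbols \<open>\<Gamma>\<close> in the frame \<open>E\<close>.\<close>

definition connection :: "('v \<Rightarrow> 'v \<Rightarrow> 'v) \<Rightarrow> 'a vfield \<Rightarrow> 'a vfield \<Rightarrow> 'a vfield" where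
  "connection \<Gamma> X Y =
    (\<lambda>p. E p (frechet_derivative (\<lambda>q. \<theta> q (Y q)) (at p) (X p) + \<Gamma> (\<theta> p (X p)) (\<theta> p (Y p))))"

lemma smooth_connection [smooth_intros]:
  "bilinear \<Gamma> \<Longrightarrow> smooth X \<Longrightarrow> smooth Y \<Longrightarrow> smooth (connection \<Gamma> X Y)"
  unfolding connection_def
  by (intro smooth_E_field smooth_add smooth_directional_derivative smooth_coordinates
      smooth_bilinear[of \<Gamma>])

definition conformal_metric :: "('v \<Rightarrow> 'v \<Rightarrow> real) \<Rightarrow> ('a \<Rightarrow> real) \<Rightarrow> 'a metric" where
  "conformal_metric B \<phi> = (\<lambda>p v w. exp (2 * \<phi> p) * B (\<theta> p v) (\<theta> p w))"

lemma pseudo_riemannian_conformal_metric: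
  assumes B: "bilinear B" "\<And>a b. B a b = B b a" "\<And>a. (\<And>b. B a b = 0) \<Longrightarrow> a = 0"
    and \<phi>: "smooth \<phi>"
  shows "pseudo_riemannian (conformal_metric B \<phi>)"
  unfolding pseudo_riemannian_def conformal_metric_def
proof (intro conjI allI impI)
  fix p
  have "linear (\<lambda>v. exp (2 * \<phi> p) * B (\<theta> p v) (\<theta> p w))"
    "linear (\<lambda>w. exp (2 * \<phi> p) * B (\<theta> p v) (\<theta> p w))" for v w
    by (rule linearI; simp add: \<theta>_simps bilinear_ladd[OF B(1)] bilinear_radd[OF B(1)]
        bilinear_lmul[OF B(1)] bilinear_rmul[OF B(1)] algebra_simps)+
  then show "bilinear (\<lambda>v w. exp (2 * \<phi> p) * B (\<theta> p v) (\<theta> p w))"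
    unfolding bilinear_def by blast
  show "exp (2 * \<phi> p) * B (\<theta> p v) (\<theta> p w) = exp (2 * \<phi> p) * B (\<theta> p w) (\<theta> p v)" for v w
    using B(2) by simp
  show "v = 0" if *: "\<forall>w. exp (2 * \<phi> p) * B (\<theta> p v) (\<theta> p w) = 0" for v
  proof -
    have "B (\<theta> p v) b = 0" for b
      using *[rule_format, of "E p b"] by simp
    then have "\<theta> p v = 0"
      by (rule B(3))
    then show ?thesis
      using E_\<theta>[of p v] by (simp add: E_simps)
  qed
  show "smooth (\<lambda>p. exp (2 * \<phi> p) * B (\<theta> p v) (\<theta> p w))" for v w
    by (intro smooth_intros \<phi> smooth_bilinear[OF B(1)])
qed

text \<open>For \<open>\<Gamma>\<close> to give the Levi-Civita connection of \<open>exp (2 \<phi>) B\<close>, where \<open>d\<phi>\<close> has constant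
  coordinates \<open>F\<close>, it suffices to check torsion and metric compatibility on the fields
  \<open>\<lambda>p. E p a\<close>, and this is a condition on the constants alone.\<close>

lemma connection_is_levi_civita:
  assumes \<Gamma>: "bilinear \<Gamma>" and torsion: "\<And>a b. \<Gamma> a b - \<Gamma> b a = C a b"
    and B: "bilinear B" and \<phi>: "smooth \<phi>"
    and d\<phi>: "\<And>p a. frechet_derivative \<phi> (at p) (E p a) = F a"
    and metric: "\<And>a b c. B (\<Gamma> a b) c + B b (\<Gamma> a c) = 2 * F a * B b c"
  shows "is_levi_civita (conformal_metric B \<phi>) (connection \<Gamma>)"
  unfolding is_levi_civita_def
proof (intro conjI allI impI)
  note \<Gamma>_simps = bilinear_ladd[OF \<Gamma>] bilinear_radd[OF \<Gamma>] bilinear_lmul[OF \<Gamma>] bilinear_rmul[OF \<Gamma>]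
  fix X Y :: "'a vfield"
  assume X: "smooth X" and Y: "smooth Y"
  note lin = linear_frechet_derivative_smooth[OF smooth_coordinates]
  show "smooth (connection \<Gamma> X Y)"
    by (intro smooth_intros X Y \<Gamma>)
  show "connection \<Gamma> (\<lambda>p. X p + X' p) Y = (\<lambda>p. connection \<Gamma> X Y p + connection \<Gamma> X' Y p)" for X'
    unfolding connection_def
    by (simp add: \<theta>_simps \<Gamma>_simps E_simps linear_add[OF lin[OF Y]] algebra_simps)
  show "connection \<Gamma> X (\<lambda>p. Y p + Y' p) = (\<lambda>p. connection \<Gamma> X Y p + connection \<Gamma> X Y' p)"
    if Y': "smooth Y'" for Y'
    unfolding connection_def linear_add[OF linear_\<theta>]
      frechet_derivative_add_smooth[OF smooth_coordinates[OF Y] smooth_coordinates[OF Y']]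
    by (simp add: \<Gamma>_simps E_simps algebra_simps)
  show "connection \<Gamma> (\<lambda>p. f p *\<^sub>R X p) Y = (\<lambda>p. f p *\<^sub>R connection \<Gamma> X Y p)" for f
    unfolding connection_def
    by (simp add: \<theta>_simps \<Gamma>_simps E_simps linear_cmul[OF lin[OF Y]] algebra_simps)
  show "connection \<Gamma> X (\<lambda>p. f p *\<^sub>R Y p)
      = (\<lambda>p. f p *\<^sub>R connection \<Gamma> X Y p + deriv_along X f p *\<^sub>R Y p)" if f: "smooth f" for f
    unfolding connection_def deriv_along_def
    by (simp add: \<theta>_simps \<Gamma>_simps E_simps algebra_simps
        frechet_derivative_scaleR_smooth[OF f smooth_coordinates[OF Y]])
  show "(\<lambda>p. connection \<Gamma> X Y p - connection \<Gamma> Y X p) = lie_bracket X Y"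
  proof
    fix p
    have "lie_bracket X Y p = E p (\<theta> p (lie_bracket X Y p))"
      by simp
    then show "connection \<Gamma> X Y p - connection \<Gamma> Y X p = lie_bracket X Y p"
      unfolding connection_def coordinates_lie_bracket[OF X Y] torsion[symmetric]
      by (simp add: E_simps algebra_simps)
  qed
  show "deriv_along X (\<lambda>p. conformal_metric B \<phi> p (Y p) (Z p)) =
      (\<lambda>p. conformal_metric B \<phi> p (connection \<Gamma> X Y p) (Z p)
        + conformal_metric B \<phi> p (Y p) (connection \<Gamma> X Z p))" if Z: "smooth Z" for Z
  proof
    fix p
    define x where "x = \<theta> p (X p)"
    define y where "y q = \<theta> q (Y q)" for q
    define z where "z q = \<theta> q (Z q)" for q
    have yz: "smooth y" "smooth z"
      unfolding y_def z_def by (intro smooth_intros Y Z)+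
    have "((\<lambda>q. exp (2 * \<phi> q)) has_derivative (\<lambda>v. exp (2 * \<phi> p) * (2 * frechet_derivative \<phi> (at p) v)))
        (at p)"
      using smooth_has_derivative[OF \<phi>, of p] by (auto intro!: derivative_eq_intros)
    from has_derivative_mult[OF this
        smooth_has_derivative[OF smooth_bilinear[OF B yz], of p]]
    have "frechet_derivative (\<lambda>q. exp (2 * \<phi> q) * B (y q) (z q)) (at p) (X p)
      = exp (2 * \<phi> p) * frechet_derivative (\<lambda>q. B (y q) (z q)) (at p) (X p)
        + exp (2 * \<phi> p) * (2 * frechet_derivative \<phi> (at p) (X p) * B (y p) (z p))"
      by (simp add: frechet_derivative_eqI)
    also have "frechet_derivative \<phi> (at p) (X p) = F x"
      using d\<phi>[of p x] by (simp add: x_def)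
    also have "exp (2 * \<phi> p) * frechet_derivative (\<lambda>q. B (y q) (z q)) (at p) (X p)
        + exp (2 * \<phi> p) * (2 * F x * B (y p) (z p))
      = exp (2 * \<phi> p) * (B (frechet_derivative y (at p) (X p) + \<Gamma> x (y p)) (z p)
        + B (y p) (frechet_derivative z (at p) (X p) + \<Gamma> x (z p)))"
      unfolding metric[symmetric]
      by (simp add: frechet_derivative_bilinear[OF B yz] bilinear_ladd[OF B] bilinear_radd[OF B]
          algebra_simps)
    finally show "deriv_along X (\<lambda>p. conformal_metric B \<phi> p (Y p) (Z p)) p =
        conformal_metric B \<phi> p (connection \<Gamma> X Y p) (Z p)
        + conformal_metric B \<phi> p (Y p) (connection \<Gamma> X Z p)"
      by (simp add: deriv_along_def conformal_metric_def connection_def x_def y_def[abs_def] z_def[abs_def]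
          distrib_left)
  qed
qed

text \<open>In coordinates the connection is \<open>z \<mapsto> dz + \<Gamma> z\<close>. The second derivatives of \<open>z\<close> form the derivative
  along the bracket, the terms with one derivative cancel against the coordinates of the bracket, and
  only constants remain. In particular the curvature is a tensor.\<close>

lemma connection_commutator:
  assumes \<Gamma>: "bilinear \<Gamma>" and X: "smooth X" and Y: "smooth Y" and Z: "smooth Z"
  shows "connection \<Gamma> X (connection \<Gamma> Y Z) p - connection \<Gamma> Y (connection \<Gamma> X Z) p
      - connection \<Gamma> (lie_bracket X Y) Z p
    = E p (\<Gamma> (\<theta> p (X p)) (\<Gamma> (\<theta> p (Y p)) (\<theta> p (Z p))) - \<Gamma> (\<theta> p (Y p)) (\<Gamma> (\<theta> p (X p)) (\<theta> p (Z p)))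
      - \<Gamma> (C (\<theta> p (X p)) (\<theta> p (Y p))) (\<theta> p (Z p)))"
proof -
  note \<Gamma>_simps = bilinear_ladd[OF \<Gamma>] bilinear_radd[OF \<Gamma>] bilinear_lsub[OF \<Gamma>] bilinear_rsub[OF \<Gamma>]
  define x y z where "x q = \<theta> q (X q)" and "y q = \<theta> q (Y q)" and "z q = \<theta> q (Z q)" for q
  have s: "smooth x" "smooth y" "smooth z"
    unfolding x_def y_def z_def by (intro smooth_intros X Y Z)+
  have second: "\<theta> p (connection \<Gamma> V (connection \<Gamma> W Z) p)
     = frechet_derivative (\<lambda>q. frechet_derivative z (at q) (W q)) (at p) (V p)
       + \<Gamma> (frechet_derivative (\<lambda>q. \<theta> q (W q)) (at p) (V p)) (z p)
       + \<Gamma> (\<theta> p (W p)) (frechet_derivative z (at p) (V p))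
       + \<Gamma> (\<theta> p (V p)) (frechet_derivative z (at p) (W p) + \<Gamma> (\<theta> p (W p)) (z p))"
    if V: "smooth V" and W: "smooth W" for V W
  proof -
    have "frechet_derivative (\<lambda>q. frechet_derivative z (at q) (W q) + \<Gamma> (\<theta> q (W q)) (z q)) (at p) (V p)
      = frechet_derivative (\<lambda>q. frechet_derivative z (at q) (W q)) (at p) (V p)
       + \<Gamma> (frechet_derivative (\<lambda>q. \<theta> q (W q)) (at p) (V p)) (z p)
       + \<Gamma> (\<theta> p (W p)) (frechet_derivative z (at p) (V p))"
      by (subst frechet_derivative_add_smooth[OF smooth_directional_derivative[OF s(3) W]
            smooth_bilinear[OF \<Gamma> smooth_coordinates[OF W] s(3)]])
        (simp add: frechet_derivative_bilinear[OF \<Gamma> smooth_coordinates[OF W] s(3)])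
    then show ?thesis
      by (simp add: connection_def z_def[abs_def])
  qed
  have bracket: "\<theta> p (connection \<Gamma> (lie_bracket X Y) Z p)
      = frechet_derivative z (at p) (lie_bracket X Y p)
      + \<Gamma> (frechet_derivative y (at p) (X p) - frechet_derivative x (at p) (Y p) + C (x p) (y p)) (z p)"
    by (simp add: connection_def coordinates_lie_bracket[OF X Y] x_def[abs_def] y_def[abs_def] z_def[abs_def])
  have "\<theta> p (connection \<Gamma> X (connection \<Gamma> Y Z) p - connection \<Gamma> Y (connection \<Gamma> X Z) p
      - connection \<Gamma> (lie_bracket X Y) Z p)
    = \<Gamma> (x p) (\<Gamma> (y p) (z p)) - \<Gamma> (y p) (\<Gamma> (x p) (z p)) - \<Gamma> (C (x p) (y p)) (z p)"
    unfolding linear_diff[OF linear_\<theta>] second[OF X Y] second[OF Y X] bracket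
      commutator_directional_derivatives[OF s(3) X Y, symmetric]
    by (simp add: \<Gamma>_simps x_def[abs_def] y_def[abs_def] algebra_simps)
  from arg_cong[OF this, of "E p"] show ?thesis
    by (simp only: E_\<theta> x_def y_def z_def)
qed

end

section \<open>Metrics with constant coefficients\<close>

definition curvature_map ::
  "('v \<Rightarrow> 'v \<Rightarrow> 'v) \<Rightarrow> ('v \<Rightarrow> 'v \<Rightarrow> 'v) \<Rightarrow> 'v \<Rightarrow> 'v \<Rightarrow> 'v \<Rightarrow> 'v::real_vector" where
  "curvature_map C \<Gamma> a b c = \<Gamma> a (\<Gamma> b c) - \<Gamma> b (\<Gamma> a c) - \<Gamma> (C a b) c"

definition ricci_form ::
  "('v \<Rightarrow> 'v \<Rightarrow> real) \<Rightarrow> ('v \<Rightarrow> 'v \<Rightarrow> 'v) \<Rightarrow> ('v \<Rightarrow> 'v \<Rightarrow> 'v) \<Rightarrow> (4 \<Rightarrow> 'v) \<Rightarrow>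
    'v \<Rightarrow> 'v::real_vector \<Rightarrow> real" where
  "ricci_form B C \<Gamma> u a b = (\<Sum>i\<in>UNIV. B (u i) (u i) * B (curvature_map C \<Gamma> (u i) a b) (u i))"

text \<open>The Christoffel map of \<open>exp (2 \<phi>) B\<close>, when \<open>n\<close> are the coordinates of the gradient of
  \<open>\<phi>\<close>. If these are constant, so is the Christoffel map.\<close>

definition conformal_change ::
  "('v \<Rightarrow> 'v \<Rightarrow> real) \<Rightarrow> ('v \<Rightarrow> 'v \<Rightarrow> 'v) \<Rightarrow> 'v \<Rightarrow> 'v \<Rightarrow> 'v \<Rightarrow> 'v::real_vector" where
  "conformal_change B \<Gamma> n a b = \<Gamma> a b + B n a *\<^sub>R b + B n b *\<^sub>R a - B a b *\<^sub>R n"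

definition coordinate_metric :: "('v \<Rightarrow> 'v \<Rightarrow> real) \<Rightarrow> ('a \<Rightarrow> 'a \<Rightarrow> 'v) \<Rightarrow> 'a metric" where
  "coordinate_metric B \<theta> = (\<lambda>p v w. B (\<theta> p v) (\<theta> p w))"

text \<open>A metric with constant coefficients \<open>B\<close>, together with a solution \<open>\<Gamma>\<close> of the equations that
  characterise its Levi-Civita connection. Koszul's formula would give \<open>\<Gamma>\<close> in terms of \<open>B\<close> and \<open>C\<close>; for
  a concrete Lie algebra it is easier to state the result and to verify the two equations.\<close>

locale metric_parallelization = parallelization E \<theta> C
  for E :: "'a::euclidean_space \<Rightarrow> 'v::euclidean_space \<Rightarrow> 'a" and \<theta> C +
  fixes B :: "'v \<Rightarrow> 'v \<Rightarrow> real" and \<Gamma> :: "'v \<Rightarrow> 'v \<Rightarrow> 'v"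
  assumes bilinear_B: "bilinear B" and B_commute: "B a b = B b a"
    and B_nondegenerate: "(\<And>b. B a b = 0) \<Longrightarrow> a = 0"
    and bilinear_\<Gamma>: "bilinear \<Gamma>" and torsion_free: "\<Gamma> a b - \<Gamma> b a = C a b"
    and skew: "B (\<Gamma> a b) c + B b (\<Gamma> a c) = 0"
begin

abbreviation metric :: "'a metric" where
  "metric \<equiv> coordinate_metric B \<theta>"

abbreviation conformal_\<Gamma> :: "'v \<Rightarrow> 'v \<Rightarrow> 'v \<Rightarrow> 'v" where
  "conformal_\<Gamma> \<equiv> conformal_change B \<Gamma>"

lemmas B_simps = bilinear_ladd[OF bilinear_B] bilinear_radd[OF bilinear_B]
  bilinear_lsub[OF bilinear_B] bilinear_rsub[OF bilinear_B]
  bilinear_lmul[OF bilinear_B] bilinear_rmul[OF bilinear_B]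
lemmas \<Gamma>_simps = bilinear_ladd[OF bilinear_\<Gamma>] bilinear_radd[OF bilinear_\<Gamma>]
  bilinear_lmul[OF bilinear_\<Gamma>] bilinear_rmul[OF bilinear_\<Gamma>]

lemma curvature_connection:
  assumes g: "pseudo_riemannian g" and G: "bilinear G" and lc: "is_levi_civita g (connection G)"
    and XYZ: "smooth X" "smooth Y" "smooth Z"
  shows "curvature g X Y Z p = E p (curvature_map C G (\<theta> p (X p)) (\<theta> p (Y p)) (\<theta> p (Z p)))"
proof -
  have "levi_civita g V W = connection G V W" if "smooth V" "smooth W" for V W
    by (rule levi_civita_eq[OF g lc that])
  then show ?thesis
    unfolding curvature_def Let_def curvature_map_def
    by (simp add: XYZ G smooth_connection smooth_lie_bracket connection_commutator)
qed

lemma metric_conformal: "metric = conformal_metric B (\<lambda>_. 0)"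
  by (simp add: coordinate_metric_def conformal_metric_def)

lemma pseudo_riemannian_metric: "pseudo_riemannian metric"
  unfolding metric_conformal
  by (rule pseudo_riemannian_conformal_metric[OF bilinear_B B_commute B_nondegenerate smooth_const])

lemma is_levi_civita_metric_connection: "is_levi_civita metric (connection \<Gamma>)"
  unfolding metric_conformal
  by (rule connection_is_levi_civita[OF bilinear_\<Gamma> torsion_free bilinear_B smooth_const, where F = "\<lambda>_. 0"])
    (simp_all add: skew)

lemma levi_civita_metric: "smooth X \<Longrightarrow> smooth Y \<Longrightarrow> levi_civita metric X Y = connection \<Gamma> X Y"
  by (rule levi_civita_eq[OF pseudo_riemannian_metric is_levi_civita_metric_connection])

lemma curvature_metric:
  "smooth X \<Longrightarrow> smooth Y \<Longrightarrow> smooth Z \<Longrightarrow>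
    curvature metric X Y Z p = E p (curvature_map C \<Gamma> (\<theta> p (X p)) (\<theta> p (Y p)) (\<theta> p (Z p)))"
  by (rule curvature_connection[OF pseudo_riemannian_metric bilinear_\<Gamma> is_levi_civita_metric_connection])

lemma bilinear_conformal_\<Gamma>: "bilinear (conformal_\<Gamma> n)"
  unfolding bilinear_def conformal_change_def
  by (intro conjI allI linearI) (simp_all add: \<Gamma>_simps B_simps algebra_simps)

text \<open>The gradient of \<open>\<phi>\<close> has constant coordinates \<open>n\<close>, so \<open>conformal_change\<close> describes the Levi-Civita
  connection of the rescaled metric on the whole group, and its curvature is again algebraic.\<close>

lemma conformally_flat_metric:
  assumes \<phi>: "smooth \<phi>" and d\<phi>: "\<And>p a. frechet_derivative \<phi> (at p) (E p a) = B n a"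
    and flat: "\<And>a b c. curvature_map C (conformal_\<Gamma> n) a b c = 0"
  shows "conformally_flat metric"
proof -
  have "conformal_\<Gamma> n a b - conformal_\<Gamma> n b a = C a b" for a b
    using torsion_free[of a b] B_commute[of a b] by (simp add: conformal_change_def algebra_simps)
  moreover have "B (conformal_\<Gamma> n a b) c + B b (conformal_\<Gamma> n a c) = 2 * B n a * B b c" for a b c
    using skew[of a b c] B_commute[of b n] B_commute[of b a]
    by (simp add: conformal_change_def B_simps algebra_simps)
  ultimately have "is_levi_civita (conformal_metric B \<phi>) (connection (conformal_\<Gamma> n))"
    by (rule connection_is_levi_civita[OF bilinear_conformal_\<Gamma> _ bilinear_B \<phi> d\<phi>])
  from curvature_connection[OF
      pseudo_riemannian_conformal_metric[OF bilinear_B B_commute B_nondegenerate \<phi>]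
      bilinear_conformal_\<Gamma> this]
  have "curvature (conformal_metric B \<phi>) X Y Z p = 0" if "smooth X" "smooth Y" "smooth Z" for X Y Z p
    using that by (simp add: flat E_simps)
  then have "\<forall>X Y Z. smooth X \<longrightarrow> smooth Y \<longrightarrow> smooth Z \<longrightarrow>
      (\<forall>q\<in>UNIV. curvature (\<lambda>q v w. exp (2 * \<phi> q) * metric q v w) X Y Z q = 0)"
    by (simp add: conformal_metric_def coordinate_metric_def)
  then show ?thesis
    unfolding conformally_flat_def using \<phi> by (intro allI exI[of _ UNIV] exI[of _ \<phi>]) simp
qed

lemma ricci_metric:
  assumes "smooth X" "smooth Y"
  shows "ricci metric (\<lambda>i p. E p (u i)) X Y p = ricci_form B C \<Gamma> u (\<theta> p (X p)) (\<theta> p (Y p))"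
  unfolding ricci_def ricci_form_def
  by (simp add: curvature_metric[OF smooth_E assms]) (simp add: coordinate_metric_def)

lemma ricci_operator_at_metric:
  assumes Q: "\<And>a b. ricci_form B C \<Gamma> u a b = B (Q a) b"
  shows "ricci_operator_at metric (\<lambda>i p. E p (u i)) p v = E p (Q (\<theta> p v))"
  unfolding ricci_operator_at_def ricci_operator_def
proof (rule the_equality)
  show "\<forall>Y. smooth Y \<longrightarrow> metric p (E p (Q (\<theta> p v))) (Y p) = ricci metric (\<lambda>i p. E p (u i)) (\<lambda>_. v) Y p"
    by (simp add: ricci_metric smooth_const Q) (simp add: coordinate_metric_def)
next
  fix w
  assume w: "\<forall>Y. smooth Y \<longrightarrow> metric p w (Y p) = ricci metric (\<lambda>i p. E p (u i)) (\<lambda>_. v) Y p"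
  have "B (\<theta> p w - Q (\<theta> p v)) b = 0" for b
    using w[rule_format, OF smooth_E[of b]]
    by (simp add: ricci_metric smooth_const smooth_E Q B_simps) (simp add: coordinate_metric_def)
  then have "\<theta> p w = Q (\<theta> p v)"
    using B_nondegenerate by force
  then show "w = E p (Q (\<theta> p v))"
    using E_\<theta>[of p w] by simp
qed

text \<open>Conjugation by the isomorphism \<open>E p\<close> carries the Ricci operator on \<open>'v\<close> to the one on the tangent
  space at \<open>p\<close>.\<close>

lemma jordan_basis_transport:
  assumes "jordan_basis Q l cs"
  shows "jordan_basis (\<lambda>v. E p (Q (\<theta> p v))) l (map (map (E p)) cs)"
proof -
  have set: "set (concat (map (map (E p)) cs)) = E p ` set (concat cs)"
    and concat: "concat (map (map (E p)) cs) = map (E p) (concat cs)"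
    by (simp_all add: map_concat image_UN)
  have inj: "inj_on (E p) S" for S
    using inj_E inj_on_subset by blast
  show ?thesis
    unfolding jordan_basis_def
  proof (intro conjI)
    have "linear Q"
      using assms by (simp add: jordan_basis_def)
    then show "linear (\<lambda>v. E p (Q (\<theta> p v)))"
      using linear_compose[OF linear_compose[OF linear_\<theta>] linear_E, of Q] by (simp add: o_def)
    show "distinct (concat (map (map (E p)) cs))"
      using assms inj by (simp only: concat distinct_map jordan_basis_def)
    show "independent (set (concat (map (map (E p)) cs)))"
      unfolding set using assms inj
      by (intro linear_independent_injective_image linear_E) (simp_all add: jordan_basis_def)
    show "span (set (concat (map (map (E p)) cs))) = UNIV"
      unfolding set linear_span_image[OF linear_E] using assms surj_E by (simp add: jordan_basis_def)
    show "\<forall>c\<in>set (map (map (E p)) cs). c \<noteq> [] \<and> E p (Q (\<theta> p (hd c))) = l *\<^sub>R hd c \<and>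
        (\<forall>i. Suc i < length c \<longrightarrow> E p (Q (\<theta> p (c ! Suc i))) = l *\<^sub>R c ! Suc i + c ! i)"
      using assms by (auto simp: jordan_basis_def hd_map E_simps)
  qed
qed

text \<open>The Ricci tensor is constant on fields with constant coordinates; of its covariant derivative only
  the two terms with \<open>\<Gamma>\<close> remain.\<close>

lemma not_ricci_parallel_metric:
  assumes "ricci_form B C \<Gamma> u (\<Gamma> a b) c + ricci_form B C \<Gamma> u b (\<Gamma> a c) \<noteq> 0"
  shows "\<not> ricci_parallel metric (\<lambda>i p. E p (u i))"
proof
  let ?e = "\<lambda>i p. E p (u i)"
  assume "ricci_parallel metric ?e"
  then have "deriv_along (\<lambda>q. E q a) (ricci metric ?e (\<lambda>q. E q b) (\<lambda>q. E q c)) 0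
     - ricci metric ?e (levi_civita metric (\<lambda>q. E q a) (\<lambda>q. E q b)) (\<lambda>q. E q c) 0
     - ricci metric ?e (\<lambda>q. E q b) (levi_civita metric (\<lambda>q. E q a) (\<lambda>q. E q c)) 0 = 0"
    unfolding ricci_parallel_def using smooth_E by blast
  moreover have "ricci metric ?e (\<lambda>q. E q b) (\<lambda>q. E q c) = (\<lambda>p. ricci_form B C \<Gamma> u b c)"
    by (rule ext) (simp add: ricci_metric smooth_E)
  moreover have "levi_civita metric (\<lambda>q. E q a) (\<lambda>q. E q b') = (\<lambda>q. E q (\<Gamma> a b'))" for b'
    by (simp add: levi_civita_metric smooth_E) (simp add: connection_def)
  ultimately have "ricci_form B C \<Gamma> u (\<Gamma> a b) c + ricci_form B C \<Gamma> u b (\<Gamma> a c) = 0"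
    by (simp add: ricci_metric smooth_E deriv_along_def)
  then show False
    using assms by simp
qed

text \<open>A subspace \<open>W\<close> of \<open>'v\<close> spans a distribution. Differentiating coordinates does not lead out
  of \<open>W\<close>, so only the Christoffel map decides whether the distribution is parallel.\<close>

lemma parallel_null_distribution_metric:
  assumes W: "subspace W" "dim W = r" and null: "\<And>a b. a \<in> W \<Longrightarrow> b \<in> W \<Longrightarrow> B a b = 0"
    and par: "\<And>a b. b \<in> W \<Longrightarrow> \<Gamma> a b \<in> W"
  shows "parallel_null_distribution metric r (\<lambda>p. E p ` W)"
  unfolding parallel_null_distribution_def is_distribution_def
proof (intro conjI allI ballI impI)
  fix p
  show "subspace (E p ` W)"
    by (rule linear_subspace_image[OF linear_E W(1)])
  show "dim (E p ` W) = r"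
    using dim_image_eq[OF linear_E, of p W] inj_E[of p] W(2) by (simp add: inj_on_subset)
  show "\<exists>X. smooth X \<and> (\<forall>q. X q \<in> E q ` W) \<and> X p = v" if v: "v \<in> E p ` W" for v
  proof -
    obtain a where "a \<in> W" "v = E p a"
      using v by blast
    then show ?thesis
      using smooth_E[of a] by (intro exI[of _ "\<lambda>q. E q a"]) simp
  qed
  show "metric p v w = 0" if "v \<in> E p ` W" "w \<in> E p ` W" for v w
    using that null by (auto simp: coordinate_metric_def)
  fix X Y :: "'a vfield"
  assume X: "smooth X" and Y: "smooth Y" and YW: "\<forall>p. Y p \<in> E p ` W"
  \<comment> \<open>A linear projection onto \<open>W\<close> fixes the coordinates of \<open>Y\<close>, hence also their derivative.\<close>
  obtain P :: "'v \<Rightarrow> 'v" where P: "range P \<subseteq> W" "linear P" "\<And>a. a \<in> W \<Longrightarrow> P a = a"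
    using linear_exists_left_inverse_on[OF linear_id W(1)] by (auto simp: inj_on_def)
  have y: "\<theta> q (Y q) \<in> W" for q
    using YW[rule_format, of q] by auto
  have "((\<lambda>q. P (\<theta> q (Y q))) has_derivative (\<lambda>v. P (frechet_derivative (\<lambda>q. \<theta> q (Y q)) (at p) v))) (at p)"
    using P(2) smooth_has_derivative[OF smooth_coordinates[OF Y]]
    by (intro bounded_linear.has_derivative[of P]) (simp_all add: linear_conv_bounded_linear[symmetric])
  moreover have "(\<lambda>q. P (\<theta> q (Y q))) = (\<lambda>q. \<theta> q (Y q))"
    using P(3)[OF y] by simp
  ultimately have "((\<lambda>q. \<theta> q (Y q)) has_derivative
      (\<lambda>v. P (frechet_derivative (\<lambda>q. \<theta> q (Y q)) (at p) v))) (at p)"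
    by simp
  from fun_cong[OF frechet_derivative_eqI[OF this]]
  have "frechet_derivative (\<lambda>q. \<theta> q (Y q)) (at p) v \<in> W" for v
    using P(1) by (metis rangeI subsetD)
  then show "levi_civita metric X Y p \<in> E p ` W"
    unfolding levi_civita_metric[OF X Y] connection_def
    using subspace_add[OF W(1)] par[OF y] by blast
qed

end

section \<open>Left-invariant frames on a Lie group\<close>

definition diagonal_form :: "real^4 \<Rightarrow> real^4 \<Rightarrow> real^4 \<Rightarrow> real" where
  "diagonal_form \<epsilon> a b = (\<Sum>i\<in>UNIV. \<epsilon> $ i * (a $ i * b $ i))"

definition structure_map ::
  "real^4 \<Rightarrow> real^4 \<Rightarrow> real^4 \<Rightarrow> real^4 \<Rightarrow> real^4 \<Rightarrow> real^4 \<Rightarrow> real^4 \<Rightarrow> real^4 \<Rightarrow> real^4" where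
  "structure_map b12 b13 b14 b23 b24 b34 a b =
    (a $ 1 * b $ 2 - a $ 2 * b $ 1) *\<^sub>R b12 + (a $ 1 * b $ 3 - a $ 3 * b $ 1) *\<^sub>R b13
    + (a $ 1 * b $ 4 - a $ 4 * b $ 1) *\<^sub>R b14 + (a $ 2 * b $ 3 - a $ 3 * b $ 2) *\<^sub>R b23
    + (a $ 2 * b $ 4 - a $ 4 * b $ 2) *\<^sub>R b24 + (a $ 3 * b $ 4 - a $ 4 * b $ 3) *\<^sub>R b34"

lemma bilinear_diagonal_form: "bilinear (diagonal_form \<epsilon>)"
  unfolding bilinear_def diagonal_form_def
  by (intro conjI allI linearI) (simp_all add: sum_4 algebra_simps)

lemma diagonal_form_commute: "diagonal_form \<epsilon> a b = diagonal_form \<epsilon> b a"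
  by (simp add: diagonal_form_def mult.commute)

lemma diagonal_form_axis: "diagonal_form \<epsilon> a (axis i 1) = \<epsilon> $ i * a $ i"
  by (simp add: diagonal_form_def axis_def if_distrib cong: if_cong)

lemma diagonal_form_nondegenerate:
  assumes "\<And>i. \<epsilon> $ i \<noteq> 0" and "\<And>b. diagonal_form \<epsilon> a b = 0"
  shows "a = 0"
  unfolding vec_eq_iff
proof
  fix i
  have "\<epsilon> $ i * a $ i = 0"
    using assms(2)[of "axis i 1"] by (simp add: diagonal_form_axis)
  then show "a $ i = 0 $ i"
    using assms(1) by simp
qed

lemma smooth_lin_comb: "(\<And>i. smooth (e i)) \<Longrightarrow> smooth (lin_comb e a)"
  unfolding lin_comb_def by (intro smooth_sum smooth_scaleR smooth_const)

lemma linear_lin_comb: "linear (\<lambda>a. lin_comb e a p)"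
  by (rule linearI) (simp_all add: lin_comb_def sum.distrib scaleR_sum_right algebra_simps)

lemma lin_comb_axis: "lin_comb e (axis i 1) = e i"
proof
  fix p
  have "lin_comb e (axis i 1) p = (\<Sum>j\<in>UNIV. (if j = i then e j p else 0))"
    unfolding lin_comb_def by (intro sum.cong) (auto simp: axis_def)
  then show "lin_comb e (axis i 1) p = e i p"
    by simp
qed

lemma lie_bracket_lin_comb:
  assumes e: "\<And>i. smooth (e i)" and brackets: "has_brackets e b12 b13 b14 b23 b24 b34"
  shows "lie_bracket (lin_comb e a) (lin_comb e b)
    = lin_comb e (structure_map b12 b13 b14 b23 b24 b34 a b)"
proof
  fix p
  have d: "frechet_derivative (lin_comb e a) (at p) v
      = (\<Sum>i\<in>UNIV. (a $ i) *\<^sub>R frechet_derivative (e i) (at p) v)" for a v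
    unfolding lin_comb_def
    by (rule fun_cong[OF frechet_derivative_eqI])
      (intro has_derivative_sum has_derivative_scaleR_right smooth_has_derivative e)
  note lin = linear_frechet_derivative_smooth[OF e]
  have "lie_bracket (lin_comb e a) (lin_comb e b) p
    = (a $ 1 * b $ 2 - a $ 2 * b $ 1) *\<^sub>R lie_bracket (e 1) (e 2) p
    + (a $ 1 * b $ 3 - a $ 3 * b $ 1) *\<^sub>R lie_bracket (e 1) (e 3) p
    + (a $ 1 * b $ 4 - a $ 4 * b $ 1) *\<^sub>R lie_bracket (e 1) (e 4) p
    + (a $ 2 * b $ 3 - a $ 3 * b $ 2) *\<^sub>R lie_bracket (e 2) (e 3) p
    + (a $ 2 * b $ 4 - a $ 4 * b $ 2) *\<^sub>R lie_bracket (e 2) (e 4) p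
    + (a $ 3 * b $ 4 - a $ 4 * b $ 3) *\<^sub>R lie_bracket (e 3) (e 4) p"
    unfolding lie_bracket_def d
    by (simp add: lin_comb_def sum_4 linear_add[OF lin] linear_cmul[OF lin] algebra_simps)
  then show "lie_bracket (lin_comb e a) (lin_comb e b) p
      = lin_comb e (structure_map b12 b13 b14 b23 b24 b34 a b) p"
    using brackets
    by (simp add: has_brackets_def structure_map_def linear_add[OF linear_lin_comb]
        linear_cmul[OF linear_lin_comb])
qed

text \<open>The coordinates with respect to a pseudo-orthonormal frame are scalar products with the frame, so
  they are smooth, and the frame is linearly independent. By dimension it spans every tangent
  space.\<close>

lemma parallelization_lin_comb:
  fixes G :: "'a::euclidean_space monoid"
  assumes dim: "DIM('a) = 4" and G: "metric_lie_group G g \<epsilon> e" and \<epsilon>: "\<And>i. \<epsilon> $ i * \<epsilon> $ i = 1"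
    and brackets: "has_brackets e b12 b13 b14 b23 b24 b34"
  defines "\<theta> \<equiv> (\<lambda>p v. \<chi> i. \<epsilon> $ i * g p v (e i p))"
  shows "parallelization (\<lambda>p a. lin_comb e a p) \<theta> (structure_map b12 b13 b14 b23 b24 b34)"
    and "g = (\<lambda>p v w. diagonal_form \<epsilon> (\<theta> p v) (\<theta> p w))"
proof -
  have bil: "bilinear (g p)" and smooth_g: "smooth (\<lambda>p. g p v w)"
    and e: "smooth (e i)" and orth: "g p (e i p) (e j p) = (if i = j then \<epsilon> $ i else 0)"
    for p v w i j
    using G unfolding metric_lie_group_def pseudo_riemannian_def left_invariant_field_def
      pseudo_orthonormal_def by auto
  note g_simps = bilinear_ladd[OF bil] bilinear_lmul[OF bil] bilinear_radd[OF bil] bilinear_rmul[OF bil]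
  have linL: "linear (\<lambda>v. g p v w)" and linR: "linear (\<lambda>w. g p v w)" for p v w
    using bil unfolding bilinear_def by blast+
  have g_lin_comb: "g p (lin_comb e a p) (e i p) = a $ i * \<epsilon> $ i" for p a i
    unfolding lin_comb_def linear_sum[OF linL]
    by (simp add: g_simps orth if_distrib cong: if_cong)
  have \<theta>_E: "\<theta> p (lin_comb e a p) = a" for p a
    using \<epsilon> by (simp add: \<theta>_def g_lin_comb vec_eq_iff mult.left_commute)
  have "inj (\<lambda>a. lin_comb e a p)" for p
    by (rule inj_on_inverseI[of _ "\<theta> p"]) (rule \<theta>_E)
  then have "dim (range (\<lambda>a. lin_comb e a p)) = DIM('a)" for p
    using dim by (subst dim_image_eq[OF linear_lin_comb]) (simp_all add: inj_on_subset)
  then have "span (range (\<lambda>a. lin_comb e a p)) = UNIV" for p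
    by (simp only: dim_eq_full)
  then have surj: "range (\<lambda>a. lin_comb e a p) = UNIV" for p
    using span_eq_iff[THEN iffD2, OF linear_subspace_image[OF linear_lin_comb subspace_UNIV]]
    by metis
  have E_\<theta>: "lin_comb e (\<theta> p v) p = v" for p v
  proof -
    obtain a where "v = lin_comb e a p"
      using surj[of p] by blast
    then show ?thesis
      by (simp add: \<theta>_E)
  qed
  show "parallelization (\<lambda>p a. lin_comb e a p) \<theta> (structure_map b12 b13 b14 b23 b24 b34)"
  proof (rule parallelization.intro)
    show "linear (\<theta> p)" for p
      by (rule linearI) (simp_all add: \<theta>_def vec_eq_iff g_simps algebra_simps)
    have "smooth (\<lambda>p. g p v (e i p))" for v i
      by (rule smooth_linear_family[of "\<lambda>p. g p v", OF linR smooth_g e])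
    then show "smooth (\<lambda>p. \<theta> p v)" for v
      unfolding \<theta>_def smooth_vec_iff by (auto intro!: smooth_mult smooth_const)
    show "smooth (\<lambda>p. lin_comb e a p)" for a
      using smooth_lin_comb[OF e] by simp
    show "lie_bracket (\<lambda>p. lin_comb e a p) (\<lambda>p. lin_comb e b p)
        = (\<lambda>p. lin_comb e (structure_map b12 b13 b14 b23 b24 b34 a b) p)" for a b
      using lie_bracket_lin_comb[OF e brackets] by simp
  qed (rule linear_lin_comb E_\<theta> \<theta>_E)+
  show "g = (\<lambda>p v w. diagonal_form \<epsilon> (\<theta> p v) (\<theta> p w))"
  proof (intro ext)
    fix p v w
    have "g p v w = g p v (lin_comb e (\<theta> p w) p)"
      by (simp add: E_\<theta>)
    also have "\<dots> = (\<Sum>i\<in>UNIV. \<theta> p w $ i * g p v (e i p))"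
      unfolding lin_comb_def linear_sum[OF linR] by (simp add: g_simps)
    also have "\<dots> = (\<Sum>i\<in>UNIV. \<epsilon> $ i * (\<theta> p v $ i * \<theta> p w $ i))"
      by (intro sum.cong refl) (simp add: \<theta>_def \<epsilon> mult.assoc[symmetric])
    finally show "g p v w = diagonal_form \<epsilon> (\<theta> p v) (\<theta> p w)"
      by (simp add: diagonal_form_def)
  qed
qed

lemma left_translation_has_derivative:
  fixes G :: "'a::euclidean_space monoid"
  assumes "lie_group G"
  shows "((\<lambda>x. a \<otimes>\<^bsub>G\<^esub> x) has_derivative left_translation_deriv G a p) (at p)"
proof -
  have s: "smooth (\<lambda>z. (case z of (x, y) \<Rightarrow> x \<otimes>\<^bsub>G\<^esub> y))"
    using assms unfolding lie_group_def by blast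
  have "((\<lambda>x. (a, x)) has_derivative (\<lambda>v. (0, v))) (at p)"
    by (intro has_derivative_Pair has_derivative_const has_derivative_ident)
  from has_derivative_compose[OF this smooth_has_derivative[OF s]]
  have "(\<lambda>x. a \<otimes>\<^bsub>G\<^esub> x) differentiable (at p)"
    unfolding differentiable_def by auto
  then show ?thesis
    by (simp add: left_translation_deriv_def frechet_derivative_works)
qed

text \<open>The differential of a homomorphism \<open>l\<close> to \<open>\<real>\<close> is a left-invariant one-form, and \<open>l\<close> is its own
  differential.\<close>

lemma left_invariant_field_hom:
  fixes G :: "'a::euclidean_space monoid" and l :: "'a \<Rightarrow> real"
  assumes G: "lie_group G" and l: "linear l" and hom: "\<And>x y. l (x \<otimes>\<^bsub>G\<^esub> y) = l x + l y"
    and X: "left_invariant_field G X"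
  shows "l (X p) = l (X \<one>\<^bsub>G\<^esub>)"
proof -
  have grp: "group G" and carrier: "carrier G = UNIV"
    using G unfolding lie_group_def by blast+
  have bl: "bounded_linear l"
    using l by (simp add: linear_conv_bounded_linear)
  have "((\<lambda>x. l (p \<otimes>\<^bsub>G\<^esub> x)) has_derivative (\<lambda>v. l (left_translation_deriv G p \<one>\<^bsub>G\<^esub> v))) (at \<one>\<^bsub>G\<^esub>)"
    by (rule bounded_linear.has_derivative[OF bl left_translation_has_derivative[OF G]])
  moreover have "((\<lambda>x. l (p \<otimes>\<^bsub>G\<^esub> x)) has_derivative (\<lambda>v. 0 + l v)) (at \<one>\<^bsub>G\<^esub>)"
    unfolding hom by (intro has_derivative_add has_derivative_const bounded_linear_imp_has_derivative bl)
  ultimately have "(\<lambda>v. l (left_translation_deriv G p \<one>\<^bsub>G\<^esub> v)) = (\<lambda>v. 0 + l v)"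
    by (rule has_derivative_unique)
  then have "l (left_translation_deriv G p \<one>\<^bsub>G\<^esub> v) = l v" for v
    by (simp add: fun_eq_iff)
  moreover have "X (p \<otimes>\<^bsub>G\<^esub> \<one>\<^bsub>G\<^esub>) = left_translation_deriv G p \<one>\<^bsub>G\<^esub> (X \<one>\<^bsub>G\<^esub>)"
    using X unfolding left_invariant_field_def by blast
  moreover have "p \<otimes>\<^bsub>G\<^esub> \<one>\<^bsub>G\<^esub> = p"
    using group.is_monoid[OF grp] carrier by (simp add: monoid.r_one)
  ultimately show ?thesis
    by simp
qed

lemma left_invariant_lin_comb:
  fixes G :: "'a::euclidean_space monoid"
  assumes G: "lie_group G" and e: "\<And>i. left_invariant_field G (e i)"
  shows "left_invariant_field G (lin_comb e a)"
  unfolding left_invariant_field_def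
proof (intro conjI allI)
  show "smooth (lin_comb e a)"
    using e by (intro smooth_lin_comb) (simp add: left_invariant_field_def)
  fix x p
  have lin: "linear (left_translation_deriv G x p)"
    using left_translation_has_derivative[OF G, of x p] by (rule has_derivative_linear)
  show "lin_comb e a (x \<otimes>\<^bsub>G\<^esub> p) = left_translation_deriv G x p (lin_comb e a p)"
    using e by (simp add: lin_comb_def linear_sum[OF lin] linear_cmul[OF lin] left_invariant_field_def)
qed

lemma left_invariant_distribution_lin_comb:
  fixes G :: "'a::euclidean_space monoid"
  assumes "lie_group G" "\<And>i. left_invariant_field G (e i)"
  shows "left_invariant_distribution G (spanned_by (map (lin_comb e) as))"
  unfolding left_invariant_distribution_def
  using left_invariant_lin_comb[OF assms] by (intro exI[of _ "map (lin_comb e) as"]) auto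

lemma spanned_by_lin_comb: "spanned_by (map (lin_comb e) as) = (\<lambda>p. (\<lambda>a. lin_comb e a p) ` span (set as))"
  by (simp add: spanned_by_def linear_span_image[OF linear_lin_comb, symmetric] image_image)

text \<open>A linear function \<open>l\<close> that is constant on each field \<open>\<lambda>p. E p a\<close> kills the derivatives of these
  fields and therefore their brackets. If \<open>h\<close> is up to a factor the only covector with the latter
  property, then a multiple of \<open>l\<close> is a primitive of the one-form with constant coordinates \<open>h\<close>.\<close>

lemma (in parallelization) primitive_of_annihilator:
  assumes const: "\<And>p a. l (E p a) = l (E p0 a)" and l: "linear l" "range l \<noteq> {0}"
    and ann: "\<And>f::'v \<Rightarrow> real. linear f \<Longrightarrow> (\<And>a b. f (C a b) = 0) \<Longrightarrow> \<exists>c. \<forall>a. f a = c * h a"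
  obtains c :: real where "\<And>p a. frechet_derivative (\<lambda>q. c * l q) (at p) (E p a) = h a"
proof -
  define f where "f a = l (E p0 a)" for a
  have f: "linear f"
    unfolding f_def using linear_compose[OF linear_E l(1)] by (simp add: o_def)
  have bl: "bounded_linear l"
    using l(1) by (simp add: linear_conv_bounded_linear)
  have "f (C a b) = 0" for a b
  proof -
    have "l (frechet_derivative (\<lambda>q. E q c) (at p0) v) = 0" for c v
    proof -
      have "((\<lambda>q. l (E q c)) has_derivative (\<lambda>v. l (frechet_derivative (\<lambda>q. E q c) (at p0) v))) (at p0)"
        by (rule bounded_linear.has_derivative[OF bl smooth_has_derivative[OF smooth_E]])
      moreover have "(\<lambda>q. l (E q c)) = (\<lambda>q. l (E p0 c))"
        by (rule ext) (rule const)
      then have "((\<lambda>q. l (E q c)) has_derivative (\<lambda>v. 0)) (at p0)"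
        by (simp only: has_derivative_const)
      ultimately have "(\<lambda>v. l (frechet_derivative (\<lambda>q. E q c) (at p0) v)) = (\<lambda>v. 0)"
        by (rule has_derivative_unique)
      then show ?thesis
        by (rule fun_cong)
    qed
    then have "l (lie_bracket (\<lambda>p. E p a) (\<lambda>p. E p b) p0) = 0"
      by (simp add: lie_bracket_def linear_diff[OF l(1)])
    then show ?thesis
      by (simp add: bracket_E f_def)
  qed
  from ann[OF f this] obtain c where c: "\<And>a. f a = c * h a"
    by blast
  have "c \<noteq> 0"
  proof
    assume "c = 0"
    then have "f (\<theta> p0 v) = 0" for v
      using c by simp
    then have "l v = 0" for v
      by (simp add: f_def)
    then show False
      using l(2) by auto
  qed
  have "frechet_derivative (\<lambda>q. inverse c * l q) (at p) (E p a) = h a" for p a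
  proof -
    have "((\<lambda>q. inverse c * l q) has_derivative (\<lambda>v. inverse c * l v)) (at p)"
      by (intro has_derivative_mult_right bounded_linear_imp_has_derivative bl)
    then have "frechet_derivative (\<lambda>q. inverse c * l q) (at p) (E p a) = inverse c * l (E p a)"
      by (simp add: frechet_derivative_eqI)
    also have "l (E p a) = c * h a"
      using const[of p a] c[of a] by (simp only: f_def)
    finally show ?thesis
      using \<open>c \<noteq> 0\<close> by simp
  qed
  then show thesis
    by (rule that)
qed

section \<open>The metric Lie algebras\<close>

lemma vector_4 [simp]:
  "(vector [w, x, y, z] :: 'a::zero^4) $ 1 = w"
  "(vector [w, x, y, z] :: 'a::zero^4) $ 2 = x"
  "(vector [w, x, y, z] :: 'a::zero^4) $ 3 = y"
  "(vector [w, x, y, z] :: 'a::zero^4) $ 4 = z"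
  unfolding vector_def by simp_all

lemma axis_4:
  "axis 1 1 = (vector [1, 0, 0, 0] :: real^4)" "axis 2 1 = (vector [0, 1, 0, 0] :: real^4)"
  "axis 3 1 = (vector [0, 0, 1, 0] :: real^4)" "axis 4 1 = (vector [0, 0, 0, 1] :: real^4)"
  by (simp_all add: vec_eq_iff forall_4 axis_def)

lemma linear_functional_4: "linear f \<Longrightarrow>
    f a = a $ 1 * f (axis 1 1) + a $ 2 * f (axis 2 1) + a $ 3 * f (axis 3 1) + a $ 4 * f (axis 4 1)"
  for f :: "real^4 \<Rightarrow> real"
proof -
  assume f: "linear f"
  have "a = a $ 1 *\<^sub>R axis 1 1 + a $ 2 *\<^sub>R axis 2 1 + a $ 3 *\<^sub>R axis 3 1 + a $ 4 *\<^sub>R axis 4 1"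
    by (simp add: vec_eq_iff forall_4 axis_4)
  from arg_cong[OF this, of f] show ?thesis
    by (simp add: linear_add[OF f] linear_cmul[OF f])
qed

text \<open>The algebraic data behind one of the geometries: brackets of a pseudo-orthonormal basis, the
  Levi-Civita connection \<open>\<Gamma>\<close> and the Ricci operator \<open>Q\<close>. The vector \<open>n\<close> is orthogonal to the derived
  algebra and unique with this property up to a factor, and it is scaled such that a conformal factor
  with gradient \<open>n\<close> flattens the metric.\<close>

locale metric_lie_algebra =
  fixes \<epsilon> b12 b13 b14 b23 b24 b34 :: "real^4" and \<Gamma> :: "real^4 \<Rightarrow> real^4 \<Rightarrow> real^4"
    and n :: "real^4" and Q :: "real^4 \<Rightarrow> real^4"
  assumes signs: "\<epsilon> $ i * \<epsilon> $ i = 1"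
    and bilinear_\<Gamma>: "bilinear \<Gamma>"
    and torsion_free: "\<Gamma> a b - \<Gamma> b a = structure_map b12 b13 b14 b23 b24 b34 a b"
    and skew: "diagonal_form \<epsilon> (\<Gamma> a b) c + diagonal_form \<epsilon> b (\<Gamma> a c) = 0"
    and flat: "curvature_map (structure_map b12 b13 b14 b23 b24 b34)
      (conformal_change (diagonal_form \<epsilon>) \<Gamma> n) a b c = 0"
    and annihilator: "linear f \<Longrightarrow> (\<And>a b. f (structure_map b12 b13 b14 b23 b24 b34 a b) = 0) \<Longrightarrow>
      \<exists>c. \<forall>a. f a = c * diagonal_form \<epsilon> n a"
    and ricci: "ricci_form (diagonal_form \<epsilon>) (structure_map b12 b13 b14 b23 b24 b34) \<Gamma> (\<lambda>i. axis i 1) a b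
      = diagonal_form \<epsilon> (Q a) b"
    and not_parallel: "\<exists>a b c. diagonal_form \<epsilon> (Q (\<Gamma> a b)) c + diagonal_form \<epsilon> (Q b) (\<Gamma> a c) \<noteq> 0"

lemmas coordinates_4 = vec_eq_iff forall_4 sum_4 diagonal_form_def structure_map_def

lemma structure_map_axis:
  "structure_map b12 b13 b14 b23 b24 b34 (axis 1 1) (axis 2 1) = b12"
  "structure_map b12 b13 b14 b23 b24 b34 (axis 1 1) (axis 3 1) = b13"
  "structure_map b12 b13 b14 b23 b24 b34 (axis 1 1) (axis 4 1) = b14"
  "structure_map b12 b13 b14 b23 b24 b34 (axis 2 1) (axis 3 1) = b23"
  "structure_map b12 b13 b14 b23 b24 b34 (axis 2 1) (axis 4 1) = b24"
  "structure_map b12 b13 b14 b23 b24 b34 (axis 3 1) (axis 4 1) = b34"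
  by (simp_all add: structure_map_def axis_4)

text \<open>The Levi-Civita connection from Koszul's formula, for \<open>d = 1 / (2 c\<^sub>1)\<close>. Here and in the next
  families \<open>u\<close> and \<open>w\<close> are scalar products with the null vector that spans the orthogonal complement
  of the derived algebra.\<close>

definition \<Gamma>_1_12 :: "real \<Rightarrow> real \<Rightarrow> real \<Rightarrow> real \<Rightarrow> real^4 \<Rightarrow> real^4 \<Rightarrow> real^4" where
  "\<Gamma>_1_12 c1 c2 c3 d a b = (let u = a $ 2 - a $ 3; w = b $ 2 - b $ 3; k = c1 + d in vector
    [- (d * a $ 1 + c2 * u) * w,
     d * a $ 1 * b $ 1 - c1 * a $ 4 * b $ 4 + u * (c2 * b $ 1 + k * b $ 3 + c3 * b $ 4),
     d * a $ 1 * b $ 1 - c1 * a $ 4 * b $ 4 + u * (c2 * b $ 1 + k * b $ 2 + c3 * b $ 4),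
     (c3 * u - c1 * a $ 4) * w])"

lemma \<Gamma>_1_12_nth:
  "\<Gamma>_1_12 c1 c2 c3 d a b $ 1 = - (d * a $ 1 + c2 * (a $ 2 - a $ 3)) * (b $ 2 - b $ 3)"
  "\<Gamma>_1_12 c1 c2 c3 d a b $ 2 = d * a $ 1 * b $ 1 - c1 * a $ 4 * b $ 4 + (a $ 2 - a $ 3) * (c2 * b $ 1 + (c1 + d) * b $ 3 + c3 * b $ 4)"
  "\<Gamma>_1_12 c1 c2 c3 d a b $ 3 = d * a $ 1 * b $ 1 - c1 * a $ 4 * b $ 4 + (a $ 2 - a $ 3) * (c2 * b $ 1 + (c1 + d) * b $ 2 + c3 * b $ 4)"
  "\<Gamma>_1_12 c1 c2 c3 d a b $ 4 = (c3 * (a $ 2 - a $ 3) - c1 * a $ 4) * (b $ 2 - b $ 3)"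
  by (simp_all add: \<Gamma>_1_12_def Let_def)

lemma conformal_change_1_12:
  "conformal_change (diagonal_form neutral_signature) (\<Gamma>_1_12 c1 c2 c3 d) (vector [0, c1, c1, 0]) a b
  = (let u = a $ 2 - a $ 3; w = b $ 2 - b $ 3 in vector
    [(c1 - d) * a $ 1 * w + u * (c1 * b $ 1 - c2 * w),
     (d - c1) * a $ 1 * b $ 1 + u * (c2 * b $ 1 + c1 * b $ 2 + d * b $ 3 + c3 * b $ 4),
     (d - c1) * a $ 1 * b $ 1 + u * (c2 * b $ 1 + d * b $ 2 + c1 * b $ 3 + c3 * b $ 4),
     u * (c3 * w + c1 * b $ 4)])"
  by (simp add: conformal_change_def \<Gamma>_1_12_def neutral_signature_def coordinates_4 Let_def algebra_simps)

text \<open>A conformal factor with gradient \<open>f (e\<^sub>2 + e\<^sub>3)\<close> flattens the metric iff \<open>f\<close> is a root of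
  \<open>f\<^sup>2 - k f + 1/2 = (f - c\<^sub>1) (f - d)\<close>; the root \<open>c\<^sub>1\<close> is used. The covariant derivative of the Ricci
  tensor in the direction \<open>e\<^sub>2\<close> has a component \<open>2 k\<close>, and \<open>c\<^sub>1 k = c\<^sub>1\<^sup>2 + 1/2\<close> is positive.\<close>

lemma metric_lie_algebra_1_12:
  assumes d: "c1 * d = 1 / 2" and k: "k = c1 + d"
  shows "metric_lie_algebra neutral_signature
     (vector [- d, - c2, - c2, 0]) (vector [d, c2, c2, 0]) 0 (vector [0, k, k, 0])
     (vector [0, c3, c3, c1]) (vector [0, - c3, - c3, - c1])
     (\<Gamma>_1_12 c1 c2 c3 d) (vector [0, c1, c1, 0])
     (\<lambda>a. vector [0, a $ 2 - a $ 3, a $ 2 - a $ 3, 0])" (is "metric_lie_algebra ?\<epsilon> ?b12 ?b13 ?b14 ?b23 ?b24 ?b34 ?\<Gamma> ?n ?Q")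
proof
  have c1: "c1 \<noteq> 0" and k0: "k \<noteq> 0"
  proof -
    show "c1 \<noteq> 0"
      using d by auto
    have "c1 * k = c1 * c1 + 1 / 2"
      using d k by (simp add: algebra_simps)
    then have "c1 * k > 0"
      using zero_le_square[of c1] by linarith
    then show "k \<noteq> 0"
      by auto
  qed
  have d': "d * c1 = 1 / 2"
    using d by (simp only: mult.commute)
  have d2: "d * (c1 * x) = x / 2" "c1 * (d * x) = x / 2" for x
    by (simp_all only: mult.assoc[symmetric] d d')
  show "?\<epsilon> $ i * ?\<epsilon> $ i = 1" for i
    using exhaust_4[of i] by (auto simp: neutral_signature_def)
  show "bilinear ?\<Gamma>"
    unfolding bilinear_def
    by (intro conjI allI linearI) (simp_all add: \<Gamma>_1_12_def Let_def coordinates_4 algebra_simps)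
  show "?\<Gamma> a b - ?\<Gamma> b a = structure_map ?b12 ?b13 ?b14 ?b23 ?b24 ?b34 a b" for a b
    by (simp add: \<Gamma>_1_12_def Let_def coordinates_4 k algebra_simps)
  show "diagonal_form ?\<epsilon> (?\<Gamma> a b) c + diagonal_form ?\<epsilon> b (?\<Gamma> a c) = 0" for a b c
    by (simp add: \<Gamma>_1_12_def Let_def coordinates_4 neutral_signature_def algebra_simps)
  show "curvature_map (structure_map ?b12 ?b13 ?b14 ?b23 ?b24 ?b34)
      (conformal_change (diagonal_form ?\<epsilon>) ?\<Gamma> ?n) a b c = 0" for a b c
    unfolding curvature_map_def conformal_change_1_12 Let_def
    by (simp add: coordinates_4 k algebra_simps d d' d2 diff_divide_distrib add_divide_distrib)
  show "\<exists>c. \<forall>a. f a = c * diagonal_form ?\<epsilon> ?n a"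
    if f: "linear f" and f0: "\<And>a b. f (structure_map ?b12 ?b13 ?b14 ?b23 ?b24 ?b34 a b) = 0" for f
  proof -
    have "k * (f (axis 2 1) + f (axis 3 1)) = 0"
      using f0[of "axis 2 1" "axis 3 1"]
      by (simp add: structure_map_axis linear_functional_4[OF f, of ?b23] algebra_simps)
    then have v: "f (axis 2 1) + f (axis 3 1) = 0"
      using k0 by simp
    have "d * f (axis 1 1) + c2 * (f (axis 2 1) + f (axis 3 1)) = 0"
      using f0[of "axis 1 1" "axis 3 1"]
      by (simp add: structure_map_axis linear_functional_4[OF f, of ?b13] algebra_simps)
    then have 1: "f (axis 1 1) = 0"
      using v d by auto
    have "c1 * f (axis 4 1) + c3 * (f (axis 2 1) + f (axis 3 1)) = 0"
      using f0[of "axis 2 1" "axis 4 1"]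
      by (simp add: structure_map_axis linear_functional_4[OF f, of ?b24] algebra_simps)
    then have 4: "f (axis 4 1) = 0"
      using v c1 by auto
    have "f (axis 3 1) = - f (axis 2 1)"
      using v by simp
    then have "f a = f (axis 2 1) / c1 * diagonal_form ?\<epsilon> ?n a" for a
      using c1 by (subst linear_functional_4[OF f])
        (simp add: 1 4 diagonal_form_def sum_4 neutral_signature_def field_simps)
    then show ?thesis
      by blast
  qed
  show "ricci_form (diagonal_form ?\<epsilon>) (structure_map ?b12 ?b13 ?b14 ?b23 ?b24 ?b34) ?\<Gamma> (\<lambda>i. axis i 1) a b
      = diagonal_form ?\<epsilon> (?Q a) b" for a b
    unfolding ricci_form_def curvature_map_def
    by (simp add: \<Gamma>_1_12_nth sum_4 axis_4 diagonal_form_def structure_map_def neutral_signature_def k algebra_simps d d' d2 diff_divide_distrib add_divide_distrib)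
  have "diagonal_form ?\<epsilon> (?Q (?\<Gamma> (axis 2 1) (axis 2 1))) (axis 2 1)
      + diagonal_form ?\<epsilon> (?Q (axis 2 1)) (?\<Gamma> (axis 2 1) (axis 2 1)) = - 2 * k"
    by (simp add: \<Gamma>_1_12_def Let_def axis_4 diagonal_form_def sum_4 neutral_signature_def k)
  then show "\<exists>a b c. diagonal_form ?\<epsilon> (?Q (?\<Gamma> a b)) c + diagonal_form ?\<epsilon> (?Q b) (?\<Gamma> a c) \<noteq> 0"
    using k0 by (intro exI[of _ "axis 2 1"]) simp
qed

definition \<Gamma>_22 :: "real^4 \<Rightarrow> real^4 \<Rightarrow> real^4" where
  "\<Gamma>_22 a b = (let u = a $ 1 - a $ 3 in vector
    [3/2 * u * b $ 3 + 1/2 * a $ 2 * b $ 4 + 1/2 * a $ 4 * b $ 2 - a $ 4 * b $ 4,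
     3/4 * u * b $ 4 + a $ 2 * b $ 3 - 1/2 * a $ 4 * (b $ 1 + b $ 3),
     3/2 * u * b $ 1 + a $ 2 * b $ 2 - 1/2 * a $ 2 * b $ 4 - 1/2 * a $ 4 * b $ 2,
     3/4 * u * b $ 2 + 1/2 * a $ 2 * (b $ 1 + b $ 3) - a $ 4 * b $ 1])"

lemma \<Gamma>_22_nth:
  "\<Gamma>_22 a b $ 1 = 3/2 * (a $ 1 - a $ 3) * b $ 3 + 1/2 * a $ 2 * b $ 4 + 1/2 * a $ 4 * b $ 2 - a $ 4 * b $ 4"
  "\<Gamma>_22 a b $ 2 = 3/4 * (a $ 1 - a $ 3) * b $ 4 + a $ 2 * b $ 3 - 1/2 * a $ 4 * (b $ 1 + b $ 3)"
  "\<Gamma>_22 a b $ 3 = 3/2 * (a $ 1 - a $ 3) * b $ 1 + a $ 2 * b $ 2 - 1/2 * a $ 2 * b $ 4 - 1/2 * a $ 4 * b $ 2"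
  "\<Gamma>_22 a b $ 4 = 3/4 * (a $ 1 - a $ 3) * b $ 2 + 1/2 * a $ 2 * (b $ 1 + b $ 3) - a $ 4 * b $ 1"
  by (simp_all add: \<Gamma>_22_def Let_def)

lemma conformal_change_22:
  "conformal_change (diagonal_form neutral_signature) \<Gamma>_22 (vector [1/2, 0, 1/2, 0]) a b
  = (let u = a $ 1 - a $ 3; v = a $ 2 - a $ 4 in vector
    [u * (1/2 * b $ 1 + b $ 3) - 1/2 * v * (b $ 2 - b $ 4),
     u * (1/2 * b $ 2 + 3/4 * b $ 4) + 1/2 * v * (b $ 1 + b $ 3),
     u * (b $ 1 + 1/2 * b $ 3) + 1/2 * v * (b $ 2 - b $ 4),
     u * (3/4 * b $ 2 + 1/2 * b $ 4) + 1/2 * v * (b $ 1 + b $ 3)])"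
  by (simp add: conformal_change_def \<Gamma>_22_def neutral_signature_def coordinates_4 Let_def field_simps)

lemma metric_lie_algebra_22:
  "metric_lie_algebra neutral_signature
     (vector [0, 0, 0, 1/4]) (vector [3/2, 0, 3/2, 0]) (vector [0, 5/4, 0, 1])
     (vector [0, 1, 0, 5/4]) 0 (vector [0, - (1/4), 0, 0])
     \<Gamma>_22 (vector [1/2, 0, 1/2, 0])
     (\<lambda>a. vector [a $ 1 - a $ 3, a $ 2 - a $ 4, a $ 1 - a $ 3, a $ 2 - a $ 4])"
    (is "metric_lie_algebra ?\<epsilon> ?b12 ?b13 ?b14 ?b23 ?b24 ?b34 ?\<Gamma> ?n ?Q")
proof
  show "?\<epsilon> $ i * ?\<epsilon> $ i = 1" for i
    using exhaust_4[of i] by (auto simp: neutral_signature_def)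
  show "bilinear ?\<Gamma>"
    unfolding bilinear_def
    by (intro conjI allI linearI) (simp_all add: \<Gamma>_22_def Let_def coordinates_4 field_simps)
  show "?\<Gamma> a b - ?\<Gamma> b a = structure_map ?b12 ?b13 ?b14 ?b23 ?b24 ?b34 a b" for a b
    by (simp add: \<Gamma>_22_def Let_def coordinates_4 field_simps)
  show "diagonal_form ?\<epsilon> (?\<Gamma> a b) c + diagonal_form ?\<epsilon> b (?\<Gamma> a c) = 0" for a b c
    by (simp add: \<Gamma>_22_def Let_def coordinates_4 neutral_signature_def field_simps)
  show "curvature_map (structure_map ?b12 ?b13 ?b14 ?b23 ?b24 ?b34)
      (conformal_change (diagonal_form ?\<epsilon>) ?\<Gamma> ?n) a b c = 0" for a b c
    unfolding curvature_map_def conformal_change_22 Let_def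
    by (simp add: coordinates_4 field_simps)
  show "\<exists>c. \<forall>a. f a = c * diagonal_form ?\<epsilon> ?n a"
    if f: "linear f" and f0: "\<And>a b. f (structure_map ?b12 ?b13 ?b14 ?b23 ?b24 ?b34 a b) = 0" for f
  proof -
    have "f (axis 4 1) = 0"
      using f0[of "axis 1 1" "axis 2 1"]
      by (simp add: structure_map_axis linear_functional_4[OF f, of ?b12])
    moreover have "f (axis 2 1) = 0"
      using f0[of "axis 3 1" "axis 4 1"]
      by (simp add: structure_map_axis linear_functional_4[OF f, of ?b34])
    moreover have "f (axis 3 1) = - f (axis 1 1)"
      using f0[of "axis 1 1" "axis 3 1"]
      by (simp add: structure_map_axis linear_functional_4[OF f, of ?b13])
    ultimately have "f a = 2 * f (axis 1 1) * diagonal_form ?\<epsilon> ?n a" for a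
      by (subst linear_functional_4[OF f])
        (simp add: diagonal_form_def sum_4 neutral_signature_def field_simps)
    then show ?thesis
      by blast
  qed
  show "ricci_form (diagonal_form ?\<epsilon>) (structure_map ?b12 ?b13 ?b14 ?b23 ?b24 ?b34) ?\<Gamma> (\<lambda>i. axis i 1) a b
      = diagonal_form ?\<epsilon> (?Q a) b" for a b
    unfolding ricci_form_def curvature_map_def
    by (simp add: \<Gamma>_22_nth sum_4 axis_4 diagonal_form_def structure_map_def neutral_signature_def
        algebra_simps add_divide_distrib diff_divide_distrib)
  have "diagonal_form ?\<epsilon> (?Q (?\<Gamma> (axis 1 1) (axis 1 1))) (axis 1 1)
      + diagonal_form ?\<epsilon> (?Q (axis 1 1)) (?\<Gamma> (axis 1 1) (axis 1 1)) = - 3"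
    by (simp add: \<Gamma>_22_def Let_def axis_4 diagonal_form_def sum_4 neutral_signature_def)
  then show "\<exists>a b c. diagonal_form ?\<epsilon> (?Q (?\<Gamma> a b)) c + diagonal_form ?\<epsilon> (?Q b) (?\<Gamma> a c) \<noteq> 0"
    by (intro exI[of _ "axis 1 1"]) simp
qed

definition \<Gamma>_11_2 :: "real \<Rightarrow> real \<Rightarrow> real \<Rightarrow> real \<Rightarrow> real \<Rightarrow> real^4 \<Rightarrow> real^4 \<Rightarrow> real^4" where
  "\<Gamma>_11_2 c1 c2 c3 c4 d a b = (let u = a $ 3 - a $ 4; w = b $ 3 - b $ 4; k = c2 + d in vector
    [- (d * a $ 1 + c3 * u) * w,
     (c4 * u - c1 * a $ 1 - c2 * a $ 2) * w,
     d * a $ 1 * b $ 1 + c1 * a $ 1 * b $ 2 + c2 * a $ 2 * b $ 2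
       + u * (c3 * b $ 1 - c4 * b $ 2 + k * b $ 4),
     d * a $ 1 * b $ 1 + c1 * a $ 1 * b $ 2 + c2 * a $ 2 * b $ 2
       + u * (c3 * b $ 1 - c4 * b $ 2 + k * b $ 3)])"

lemma \<Gamma>_11_2_nth:
  "\<Gamma>_11_2 c1 c2 c3 c4 d a b $ 1 = - (d * a $ 1 + c3 * (a $ 3 - a $ 4)) * (b $ 3 - b $ 4)"
  "\<Gamma>_11_2 c1 c2 c3 c4 d a b $ 2 = (c4 * (a $ 3 - a $ 4) - c1 * a $ 1 - c2 * a $ 2) * (b $ 3 - b $ 4)"
  "\<Gamma>_11_2 c1 c2 c3 c4 d a b $ 3 = d * a $ 1 * b $ 1 + c1 * a $ 1 * b $ 2 + c2 * a $ 2 * b $ 2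
    + (a $ 3 - a $ 4) * (c3 * b $ 1 - c4 * b $ 2 + (c2 + d) * b $ 4)"
  "\<Gamma>_11_2 c1 c2 c3 c4 d a b $ 4 = d * a $ 1 * b $ 1 + c1 * a $ 1 * b $ 2 + c2 * a $ 2 * b $ 2
    + (a $ 3 - a $ 4) * (c3 * b $ 1 - c4 * b $ 2 + (c2 + d) * b $ 3)"
  by (simp_all add: \<Gamma>_11_2_def Let_def)

lemma conformal_change_11_2:
  "conformal_change (diagonal_form lorentzian_signature) (\<Gamma>_11_2 c1 c2 c3 c4 d) (vector [0, 0, c2, c2]) a b
  = (let u = a $ 3 - a $ 4; w = b $ 3 - b $ 4 in vector
    [(c2 - d) * a $ 1 * w + u * (c2 * b $ 1 - c3 * w),
     u * (c2 * b $ 2 + c4 * w) - c1 * a $ 1 * w,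
     (d - c2) * a $ 1 * b $ 1 + c1 * a $ 1 * b $ 2
       + u * (c3 * b $ 1 - c4 * b $ 2 + c2 * b $ 3 + d * b $ 4),
     (d - c2) * a $ 1 * b $ 1 + c1 * a $ 1 * b $ 2
       + u * (c3 * b $ 1 - c4 * b $ 2 + d * b $ 3 + c2 * b $ 4)])"
  by (simp add: conformal_change_def \<Gamma>_11_2_def lorentzian_signature_def coordinates_4 Let_def algebra_simps)

text \<open>As for \<open>metric_lie_algebra_1_12\<close>, with \<open>c\<^sub>2\<close> in place of \<open>c\<^sub>1\<close> and with the null vector \<open>e\<^sub>3 + e\<^sub>4\<close>.\<close>

lemma metric_lie_algebra_11_2:
  assumes d: "c2 * d = 1 / 2" and k: "k = c2 + d"
  shows "metric_lie_algebra lorentzian_signature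
     (vector [0, 0, c1, c1]) (vector [- d, - c1, - c3, - c3]) (vector [d, c1, c3, c3])
     (vector [0, - c2, c4, c4]) (vector [0, c2, - c4, - c4]) (vector [0, 0, k, k])
     (\<Gamma>_11_2 c1 c2 c3 c4 d) (vector [0, 0, c2, c2])
     (\<lambda>a. vector [0, 0, a $ 3 - a $ 4, a $ 3 - a $ 4])"
    (is "metric_lie_algebra ?\<epsilon> ?b12 ?b13 ?b14 ?b23 ?b24 ?b34 ?\<Gamma> ?n ?Q")
proof
  have c2: "c2 \<noteq> 0" and k0: "k \<noteq> 0"
  proof -
    show "c2 \<noteq> 0"
      using d by auto
    have "c2 * k = c2 * c2 + 1 / 2"
      using d k by (simp add: algebra_simps)
    then have "c2 * k > 0"
      using zero_le_square[of c2] by linarith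
    then show "k \<noteq> 0"
      by auto
  qed
  have d': "d * c2 = 1 / 2"
    using d by (simp only: mult.commute)
  have d2: "d * (c2 * x) = x / 2" "c2 * (d * x) = x / 2" for x
    by (simp_all only: mult.assoc[symmetric] d d')
  show "?\<epsilon> $ i * ?\<epsilon> $ i = 1" for i
    using exhaust_4[of i] by (auto simp: lorentzian_signature_def)
  show "bilinear ?\<Gamma>"
    unfolding bilinear_def
    by (intro conjI allI linearI) (simp_all add: \<Gamma>_11_2_def Let_def coordinates_4 algebra_simps)
  show "?\<Gamma> a b - ?\<Gamma> b a = structure_map ?b12 ?b13 ?b14 ?b23 ?b24 ?b34 a b" for a b
    by (simp add: \<Gamma>_11_2_def Let_def coordinates_4 k algebra_simps)
  show "diagonal_form ?\<epsilon> (?\<Gamma> a b) c + diagonal_form ?\<epsilon> b (?\<Gamma> a c) = 0" for a b c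
    by (simp add: \<Gamma>_11_2_def Let_def coordinates_4 lorentzian_signature_def algebra_simps)
  show "curvature_map (structure_map ?b12 ?b13 ?b14 ?b23 ?b24 ?b34)
      (conformal_change (diagonal_form ?\<epsilon>) ?\<Gamma> ?n) a b c = 0" for a b c
    unfolding curvature_map_def conformal_change_11_2 Let_def
    by (simp add: coordinates_4 k algebra_simps d d' d2 diff_divide_distrib add_divide_distrib)
  show "\<exists>c. \<forall>a. f a = c * diagonal_form ?\<epsilon> ?n a"
    if f: "linear f" and f0: "\<And>a b. f (structure_map ?b12 ?b13 ?b14 ?b23 ?b24 ?b34 a b) = 0" for f
  proof -
    have "k * (f (axis 3 1) + f (axis 4 1)) = 0"
      using f0[of "axis 3 1" "axis 4 1"]
      by (simp add: structure_map_axis linear_functional_4[OF f, of ?b34] algebra_simps)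
    then have v: "f (axis 3 1) + f (axis 4 1) = 0"
      using k0 by simp
    have "c2 * f (axis 2 1) - c4 * (f (axis 3 1) + f (axis 4 1)) = 0"
      using f0[of "axis 2 1" "axis 4 1"]
      by (simp add: structure_map_axis linear_functional_4[OF f, of ?b24] algebra_simps)
    then have 2: "f (axis 2 1) = 0"
      using v c2 by auto
    have "d * f (axis 1 1) + c1 * f (axis 2 1) + c3 * (f (axis 3 1) + f (axis 4 1)) = 0"
      using f0[of "axis 1 1" "axis 4 1"]
      by (simp add: structure_map_axis linear_functional_4[OF f, of ?b14] algebra_simps)
    then have 1: "f (axis 1 1) = 0"
      using v d 2 by auto
    have "f (axis 4 1) = - f (axis 3 1)"
      using v by simp
    then have "f a = f (axis 3 1) / c2 * diagonal_form ?\<epsilon> ?n a" for a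
      using c2 by (subst linear_functional_4[OF f])
        (simp add: 1 2 diagonal_form_def sum_4 lorentzian_signature_def field_simps)
    then show ?thesis
      by blast
  qed
  show "ricci_form (diagonal_form ?\<epsilon>) (structure_map ?b12 ?b13 ?b14 ?b23 ?b24 ?b34) ?\<Gamma> (\<lambda>i. axis i 1) a b
      = diagonal_form ?\<epsilon> (?Q a) b" for a b
    unfolding ricci_form_def curvature_map_def
    by (simp add: \<Gamma>_11_2_nth sum_4 axis_4 diagonal_form_def structure_map_def lorentzian_signature_def k algebra_simps d d' d2 diff_divide_distrib add_divide_distrib)
  have "diagonal_form ?\<epsilon> (?Q (?\<Gamma> (axis 3 1) (axis 3 1))) (axis 3 1)
      + diagonal_form ?\<epsilon> (?Q (axis 3 1)) (?\<Gamma> (axis 3 1) (axis 3 1)) = - 2 * k"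
    by (simp add: \<Gamma>_11_2_def Let_def axis_4 diagonal_form_def sum_4 lorentzian_signature_def k)
  then show "\<exists>a b c. diagonal_form ?\<epsilon> (?Q (?\<Gamma> a b)) c + diagonal_form ?\<epsilon> (?Q b) (?\<Gamma> a c) \<noteq> 0"
    using k0 by (intro exI[of _ "axis 3 1"]) simp
qed

section \<open>Geometry of the groups\<close>

text \<open>A Lie group with these brackets. The first coordinate, as a homomorphism to \<open>\<real>\<close>, supplies the
  conformal factor.\<close>

locale metric_lie_algebra_of_group = metric_lie_algebra +
  fixes G :: "r4 monoid" and g :: "r4 metric" and e :: "4 \<Rightarrow> r4 vfield"
  assumes fst_mult: "fst (x \<otimes>\<^bsub>G\<^esub> y) = fst x + fst y"
    and metric_lie_group: "metric_lie_group G g \<epsilon> e"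
    and brackets: "has_brackets e b12 b13 b14 b23 b24 b34"
begin

abbreviation "E \<equiv> (\<lambda>p a. lin_comb e a p)"

definition coordinates :: "r4 \<Rightarrow> r4 \<Rightarrow> real^4" where
  "coordinates p v = (\<chi> i. \<epsilon> $ i * g p v (e i p))"

lemma lie_group: "lie_group G" and left_invariant_frame: "left_invariant_field G (e i)"
  using metric_lie_group unfolding metric_lie_group_def by blast+

lemma dim_r4: "DIM(r4) = 4"
  by simp

sublocale frame: metric_parallelization E coordinates "structure_map b12 b13 b14 b23 b24 b34"
    "diagonal_form \<epsilon>" \<Gamma>
proof (rule metric_parallelization.intro)
  show "parallelization E coordinates (structure_map b12 b13 b14 b23 b24 b34)"
    using parallelization_lin_comb(1)[OF dim_r4 metric_lie_group signs brackets]
    unfolding coordinates_def[abs_def] .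
  have "\<epsilon> $ i \<noteq> 0" for i
    using signs[of i] by auto
  then show "metric_parallelization_axioms (structure_map b12 b13 b14 b23 b24 b34) (diagonal_form \<epsilon>) \<Gamma>"
    by (intro metric_parallelization_axioms.intro bilinear_diagonal_form diagonal_form_commute
        diagonal_form_nondegenerate bilinear_\<Gamma> torsion_free skew)
qed

lemma metric_eq: "frame.metric = g"
  using parallelization_lin_comb(2)[OF dim_r4 metric_lie_group signs brackets, symmetric]
  unfolding coordinates_def[abs_def] coordinate_metric_def .

lemma frame_eq: "(\<lambda>i p. lin_comb e (axis i 1) p) = e"
  by (intro ext) (simp only: lin_comb_axis)

lemma inner_lin_comb: "g p (lin_comb e a p) (lin_comb e b p) = diagonal_form \<epsilon> a b"
  using fun_cong[OF fun_cong[OF fun_cong[OF metric_eq, of p], of "lin_comb e a p"], of "lin_comb e b p"]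
  by (simp only: coordinate_metric_def frame.\<theta>_E)

lemma conformally_flat: "conformally_flat g"
proof -
  have const: "fst (lin_comb e a p) = fst (lin_comb e a \<one>\<^bsub>G\<^esub>)" for a p
    by (rule left_invariant_field_hom[OF lie_group linear_fst fst_mult
          left_invariant_lin_comb[OF lie_group left_invariant_frame]])
  have "range (fst :: r4 \<Rightarrow> real) \<noteq> {0}"
    by (metis fst_conv range_eqI singletonD zero_neq_one)
  from frame.primitive_of_annihilator[OF const linear_fst this annihilator]
  obtain c where c: "\<And>p a. frechet_derivative (\<lambda>q. c * fst q) (at p) (lin_comb e a p) = diagonal_form \<epsilon> n a"
    by blast
  show ?thesis
    by (rule frame.conformally_flat_metric[OF _ c flat, unfolded metric_eq])
      (intro smooth_mult smooth_const smooth_fst smooth_id)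
qed

lemma not_ricci_parallel: "\<not> ricci_parallel g e"
proof -
  obtain a b c where "diagonal_form \<epsilon> (Q (\<Gamma> a b)) c + diagonal_form \<epsilon> (Q b) (\<Gamma> a c) \<noteq> 0"
    using not_parallel by blast
  then show ?thesis
    using frame.not_ricci_parallel_metric[of "\<lambda>i. axis i 1" a b c, unfolded ricci metric_eq frame_eq]
    by blast
qed

lemma jordan_basis_ricci_operator:
  assumes "jordan_basis Q l cs"
  shows "jordan_basis (ricci_operator_at g e p) l (map (map (\<lambda>a. lin_comb e a p)) cs)"
proof -
  have "ricci_operator_at g e p = (\<lambda>v. lin_comb e (Q (coordinates p v)) p)"
    by (rule ext) (rule frame.ricci_operator_at_metric[OF ricci, unfolded metric_eq frame_eq])
  then show ?thesis
    using frame.jordan_basis_transport[OF assms] by simp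
qed

lemma parallel_null_distribution_spanned_by:
  assumes null: "\<And>a b. a \<in> set as \<Longrightarrow> b \<in> set as \<Longrightarrow> diagonal_form \<epsilon> a b = 0"
    and par: "\<And>a b. b \<in> set as \<Longrightarrow> \<Gamma> a b \<in> span (set as)"
    and indep: "independent (set as)" "card (set as) = r"
  shows "parallel_null_distribution g r (spanned_by (map (lin_comb e) as))"
    and "left_invariant_distribution G (spanned_by (map (lin_comb e) as))"
proof -
  show "left_invariant_distribution G (spanned_by (map (lin_comb e) as))"
    by (rule left_invariant_distribution_lin_comb[OF lie_group left_invariant_frame])
  have lin: "linear (\<lambda>a. diagonal_form \<epsilon> a b)" "linear (\<lambda>b. diagonal_form \<epsilon> a b)" "linear (\<lambda>b. \<Gamma> a b)"
    for a b
    using bilinear_diagonal_form[of \<epsilon>] bilinear_\<Gamma> unfolding bilinear_def by blast+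
  have 1: "diagonal_form \<epsilon> a b = 0" if "a \<in> set as" "b \<in> span (set as)" for a b
    using span_minimal[OF _ linear_subspace_kernel[OF lin(2)[of a]], of "set as"] null that by blast
  have 2: "diagonal_form \<epsilon> a b = 0" if "a \<in> span (set as)" "b \<in> span (set as)" for a b
    using span_minimal[OF _ linear_subspace_kernel[OF lin(1)[of b]], of "set as"] 1 that by blast
  have 3: "\<Gamma> a b \<in> span (set as)" if "b \<in> span (set as)" for a b
    using span_minimal[OF _ linear_subspace_vimage[OF lin(3)[of a] subspace_span], of "set as" "set as"]
      par that by blast
  show "parallel_null_distribution g r (spanned_by (map (lin_comb e) as))"
    unfolding spanned_by_lin_comb
    by (rule frame.parallel_null_distribution_metric[OF subspace_span _ 2 3, unfolded metric_eq])
      (simp add: dim_span dim_eq_card_independent[OF indep(1)] indep(2))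
qed

end

text \<open>Four vectors that span a space of dimension four are distinct and independent.\<close>

lemma jordan_basis_4:
  fixes Q :: "real^4 \<Rightarrow> real^4"
  assumes Q: "linear Q" and len: "length (concat cs) = 4"
    and span: "\<And>i. axis i 1 \<in> span (set (concat cs))"
    and chains: "\<And>c. c \<in> set cs \<Longrightarrow> c \<noteq> [] \<and> Q (hd c) = l *\<^sub>R hd c \<and>
      (\<forall>i. Suc i < length c \<longrightarrow> Q (c ! Suc i) = l *\<^sub>R (c ! Suc i) + c ! i)"
  shows "jordan_basis Q l cs"
proof -
  let ?S = "set (concat cs)"
  have "a \<in> span ?S" for a
  proof -
    have "a = (\<Sum>i\<in>UNIV. (a $ i) *\<^sub>R axis i 1)"
      using basis_expansion[of a] by (simp only: scalar_mult_eq_scaleR)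
    also have "\<dots> \<in> span ?S"
      by (intro span_sum span_scale span)
    finally show ?thesis .
  qed
  then have UNIV: "span ?S = UNIV"
    by blast
  have dim: "dim (UNIV :: (real^4) set) = 4"
    by simp
  have "card ?S \<le> 4"
    using card_length[of "concat cs"] len by simp
  moreover have "4 \<le> card ?S"
    using dim_le_card[of UNIV ?S] UNIV dim by simp
  ultimately have card: "card ?S = 4"
    by simp
  have "distinct (concat cs)"
    using card len by (intro card_distinct) simp
  moreover have "independent ?S"
    using card_le_dim_spanning[of ?S UNIV] UNIV dim card by simp
  ultimately show ?thesis
    using Q UNIV chains unfolding jordan_basis_def by blast
qed

section \<open>Solvability\<close>

text \<open>A homomorphism to an abelian group vanishes on commutators.\<close>

lemma (in group) derived_subset_kernel:
  fixes f :: "'a \<Rightarrow> 'c::ab_group_add"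
  assumes H: "subgroup H G" and f: "\<And>x y. x \<in> H \<Longrightarrow> y \<in> H \<Longrightarrow> f (x \<otimes> y) = f x + f y"
  shows "derived G H \<subseteq> {x \<in> H. f x = 0}" and "subgroup {x \<in> H. f x = 0} G"
proof -
  have closed: "x \<otimes> y \<in> H" "inv x \<in> H" "\<one> \<in> H" "x \<in> carrier G" if "x \<in> H" "y \<in> H" for x y
    using that subgroup.m_closed[OF H] subgroup.m_inv_closed[OF H] subgroup.one_closed[OF H]
      subgroup.mem_carrier[OF H] by auto
  have one: "f \<one> = 0"
    using f[of \<one> \<one>] subgroup.one_closed[OF H] by simp
  have inv: "f (inv x) = - f x" if "x \<in> H" for x
    using f[of "inv x" x] closed[OF that that] that one by (simp add: eq_neg_iff_add_eq_0)
  show sub: "subgroup {x \<in> H. f x = 0} G"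
    by (rule subgroup.intro) (auto simp: f inv one closed subgroup.one_closed[OF H])
  have "derived_set G H \<subseteq> {x \<in> H. f x = 0}"
    by (auto simp: f inv closed)
  then show "derived G H \<subseteq> {x \<in> H. f x = 0}"
    unfolding derived_def by (rule generate_subgroup_incl[OF _ sub])
qed

text \<open>The derived series of \<open>\<real> \<ltimes> N\<close> descends into \<open>N\<close>, then into the third coordinate axis of \<open>N\<close>, which
  is the centre of the Heisenberg group, and then to the identity. Each step is the kernel of a
  homomorphism to a vector space.\<close>

lemma semidirect_solvable:
  assumes N: "N = translation_group \<or> N = heisenberg_group"
    and semi: "is_semidirect_R N G" and G: "lie_group G"
  shows "solvable G"
proof -
  obtain \<phi> where \<phi>: "smooth_action N \<phi>" and G_eq: "G = semidirect_R N \<phi>"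
    using semi unfolding is_semidirect_R_def by blast
  have grp: "group G" and carrier: "carrier G = UNIV"
    using G unfolding lie_group_def by blast+
  interpret group G
    by (rule grp)
  have \<phi>0: "\<phi> 0 = id"
    using \<phi> by (simp add: smooth_action_def)
  have mult: "x \<otimes>\<^bsub>G\<^esub> y = (fst x + fst y, snd x \<otimes>\<^bsub>N\<^esub> \<phi> (fst x) (snd y))" for x y
    by (simp add: G_eq semidirect_R_def case_prod_unfold)
  have one: "\<one>\<^bsub>G\<^esub> = (0, 0)"
    using N by (auto simp: G_eq semidirect_R_def translation_group_def heisenberg_group_def)
  define H1 where "H1 = {x \<in> UNIV. fst (x :: r4) = 0}"
  define H2 where "H2 = {x \<in> H1. (snd x $ 1, snd x $ 2) = 0}"
  have 1: "derived G UNIV \<subseteq> H1" "subgroup H1 G"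
    using derived_subset_kernel[OF subgroup_self, of fst] unfolding carrier H1_def
    by (simp_all add: mult)
  have add2: "(snd (x \<otimes>\<^bsub>G\<^esub> y) $ 1, snd (x \<otimes>\<^bsub>G\<^esub> y) $ 2)
      = (snd x $ 1, snd x $ 2) + (snd y $ 1, snd y $ 2)" if "x \<in> H1" "y \<in> H1" for x y
    using N that by (auto simp: mult H1_def \<phi>0 translation_group_def heisenberg_group_def)
  have 2: "derived G H1 \<subseteq> H2" "subgroup H2 G"
    using derived_subset_kernel[OF 1(2), of "\<lambda>x. (snd x $ 1, snd x $ 2)"] add2
    unfolding H2_def by blast+
  have "derived G H2 \<subseteq> {x \<in> H2. snd x = 0}"
    using N
    by (intro derived_subset_kernel(1)[OF 2(2)])
      (auto simp: mult H1_def H2_def \<phi>0 translation_group_def heisenberg_group_def vec_eq_iff forall_3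
        zero_prod_def)
  then have 3: "derived G H2 \<subseteq> {\<one>\<^bsub>G\<^esub>}"
    by (auto simp: H1_def H2_def one)
  have "derived G (derived G (derived G UNIV)) \<subseteq> {\<one>\<^bsub>G\<^esub>}"
    using mono_derived[OF mono_derived[OF 1(1)]] mono_derived[OF 2(1)] 3 by blast
  then have "(derived G ^^ 3) (carrier G) \<subseteq> {\<one>\<^bsub>G\<^esub>}"
    by (simp add: carrier numeral_3_eq_3)
  moreover have "\<one>\<^bsub>G\<^esub> \<in> (derived G ^^ 3) (carrier G)"
    using exp_of_derived_is_subgroup[OF subgroup_self] by (rule subgroup.one_closed)
  ultimately show ?thesis
    unfolding solvable_iff_trivial_derived_seq by blast
qed

lemma fst_mult_semidirect:
  "is_semidirect_R N G \<Longrightarrow> fst (x \<otimes>\<^bsub>G\<^esub> y) = fst x + fst y"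
  by (auto simp: is_semidirect_R_def semidirect_R_def case_prod_unfold)

section \<open>Existence of the groups\<close>

lemma group_semidirect_R:
  fixes N :: "'n::euclidean_space monoid"
  assumes N: "group N" "carrier N = UNIV" and \<phi>: "smooth_action N \<phi>"
  shows "group (semidirect_R N \<phi>)"
    and "inv\<^bsub>semidirect_R N \<phi>\<^esub> (s, m) = (- s, \<phi> (- s) (inv\<^bsub>N\<^esub> m))"
proof -
  interpret N: group N
    by (rule N(1))
  have hom: "\<phi> s (m \<otimes>\<^bsub>N\<^esub> n) = \<phi> s m \<otimes>\<^bsub>N\<^esub> \<phi> s n" for s m n
    using \<phi> N(2) by (simp add: smooth_action_def hom_def)
  have act: "\<phi> s (\<phi> t n) = \<phi> (s + t) n" "\<phi> 0 n = n" for s t n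
    using \<phi> by (simp_all add: smooth_action_def)
  have one: "\<phi> s \<one>\<^bsub>N\<^esub> = \<one>\<^bsub>N\<^esub>" for s
  proof -
    have "group_hom N N (\<phi> s)"
      using \<phi> N(1) by (intro group_hom.intro group_hom_axioms.intro) (simp_all add: smooth_action_def)
    then show ?thesis
      by (rule group_hom.hom_one)
  qed
  have left_inv: "(- s, \<phi> (- s) (inv\<^bsub>N\<^esub> m)) \<otimes>\<^bsub>semidirect_R N \<phi>\<^esub> (s, m) = \<one>\<^bsub>semidirect_R N \<phi>\<^esub>" for s m
    using N(2) by (simp add: semidirect_R_def hom[symmetric] N.l_inv one)
  show grp: "group (semidirect_R N \<phi>)"
  proof (rule groupI)
    fix x y z
    show "x \<otimes>\<^bsub>semidirect_R N \<phi>\<^esub> y \<otimes>\<^bsub>semidirect_R N \<phi>\<^esub> z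
        = x \<otimes>\<^bsub>semidirect_R N \<phi>\<^esub> (y \<otimes>\<^bsub>semidirect_R N \<phi>\<^esub> z)"
      using N(2) by (simp add: semidirect_R_def case_prod_unfold hom act N.m_assoc add.assoc)
    show "\<exists>y\<in>carrier (semidirect_R N \<phi>). y \<otimes>\<^bsub>semidirect_R N \<phi>\<^esub> x = \<one>\<^bsub>semidirect_R N \<phi>\<^esub>"
      using left_inv[of "fst x" "snd x"]
      by (intro bexI[of _ "(- fst x, \<phi> (- fst x) (inv\<^bsub>N\<^esub> (snd x)))"])
        (simp_all, simp add: semidirect_R_def)
  qed (use N(2) in \<open>auto simp: semidirect_R_def act\<close>)
  show "inv\<^bsub>semidirect_R N \<phi>\<^esub> (s, m) = (- s, \<phi> (- s) (inv\<^bsub>N\<^esub> m))"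
    by (rule group.inv_equality[OF grp left_inv]) (simp_all add: semidirect_R_def)
qed

text \<open>The Heisenberg group for \<open>\<kappa> = 1\<close> and \<open>\<real>\<^sup>3\<close> for \<open>\<kappa> = 0\<close>.\<close>

definition nilpotent_group :: "real \<Rightarrow> (real^3) monoid" where
  "nilpotent_group \<kappa> = \<lparr>carrier = UNIV,
     mult = (\<lambda>x y. x + y + vector [0, 0, \<kappa> * (x $ 1 * y $ 2 - x $ 2 * y $ 1) / 2]), one = 0\<rparr>"

lemma nilpotent_group_0: "nilpotent_group 0 = translation_group"
proof -
  have "vector [0, 0, 0] = (0 :: real^3)"
    by (simp add: vec_eq_iff forall_3)
  then show ?thesis
    by (simp add: nilpotent_group_def translation_group_def)
qed

lemma nilpotent_group_1: "nilpotent_group 1 = heisenberg_group"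
  by (simp add: nilpotent_group_def heisenberg_group_def)

lemma group_nilpotent_group: "group (nilpotent_group \<kappa>)"
  and inv_nilpotent_group: "inv\<^bsub>nilpotent_group \<kappa>\<^esub> m = - m"
proof -
  have l_inv: "(- m) \<otimes>\<^bsub>nilpotent_group \<kappa>\<^esub> m = \<one>\<^bsub>nilpotent_group \<kappa>\<^esub>" for m
    by (simp add: nilpotent_group_def vec_eq_iff forall_3)
  show grp: "group (nilpotent_group \<kappa>)"
  proof (rule groupI)
    show "\<exists>y\<in>carrier (nilpotent_group \<kappa>). y \<otimes>\<^bsub>nilpotent_group \<kappa>\<^esub> x = \<one>\<^bsub>nilpotent_group \<kappa>\<^esub>" for x
      using l_inv[of x] by (intro bexI[of _ "- x"]) (simp, simp add: nilpotent_group_def)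
  qed (auto simp: nilpotent_group_def vec_eq_iff forall_3 field_simps)
  show "inv\<^bsub>nilpotent_group \<kappa>\<^esub> m = - m"
    by (rule group.inv_equality[OF grp l_inv]) (simp_all add: nilpotent_group_def)
qed

text \<open>The lower left entry of \<open>exp (s A)\<close> for the matrix \<open>A\<close> with rows \<open>(a, 0)\<close> and \<open>(c, b)\<close>.\<close>

definition shear :: "real \<Rightarrow> real \<Rightarrow> real \<Rightarrow> real \<Rightarrow> real" where
  "shear a b c s =
    (if a = b then c * s * exp (a * s) else c * (exp (a * s) - exp (b * s)) / (a - b))"

lemma shear_0 [simp]: "shear a b c 0 = 0"
  by (simp add: shear_def)

lemma shear_add: "shear a b c (s + t) = shear a b c s * exp (a * t) + exp (b * s) * shear a b c t"
proof (cases "a = b")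
  case True
  then show ?thesis
    by (simp add: shear_def exp_add distrib_left algebra_simps)
next
  case False
  then have "a - b \<noteq> 0"
    by simp
  then show ?thesis
    by (simp add: shear_def exp_add distrib_left divide_simps) (simp add: algebra_simps)
qed

lemma has_derivative_shear:
  "(shear a b c has_real_derivative (a * shear a b c s + c * exp (b * s))) (at s)"
proof (cases "a = b")
  case True
  then show ?thesis
    unfolding shear_def[abs_def] by (auto intro!: derivative_eq_intros simp: algebra_simps)
next
  case False
  then have "a - b \<noteq> 0"
    by simp
  then have "c * (A * a - B * b) / (a - b) = a * (c * (A - B) / (a - b)) + c * B" for A B
    by (simp add: divide_simps) (simp add: algebra_simps)
  moreover have "((\<lambda>s. c * (exp (a * s) - exp (b * s)) / (a - b)) has_real_derivative
      c * (exp (a * s) * a - exp (b * s) * b) / (a - b)) (at s)"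
    using \<open>a - b \<noteq> 0\<close> by (auto intro!: derivative_eq_intros)
  ultimately show ?thesis
    using False by (simp add: shear_def[abs_def])
qed

lemma smooth_shear [smooth_intros]:
  fixes f :: "'a::euclidean_space \<Rightarrow> real"
  assumes "smooth f"
  shows "smooth (\<lambda>p. shear a b c (f p))"
  unfolding shear_def using assms
  by (cases "a = b") (simp_all add: smooth_mult smooth_exp smooth_const smooth_diff smooth_divide_const)

lemma smooth_vector_3 [smooth_intros]:
  fixes f1 f2 f3 :: "'a::euclidean_space \<Rightarrow> real"
  shows "smooth f1 \<Longrightarrow> smooth f2 \<Longrightarrow> smooth f3 \<Longrightarrow> smooth (\<lambda>p. vector [f1 p, f2 p, f3 p] :: real^3)"
  by (simp add: smooth_vec_iff[of "\<lambda>p. vector [f1 p, f2 p, f3 p]"] forall_3)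

lemma smooth_vector_4 [smooth_intros]:
  fixes f1 f2 f3 f4 :: "'a::euclidean_space \<Rightarrow> real"
  shows "smooth f1 \<Longrightarrow> smooth f2 \<Longrightarrow> smooth f3 \<Longrightarrow> smooth f4 \<Longrightarrow>
    smooth (\<lambda>p. vector [f1 p, f2 p, f3 p, f4 p] :: real^4)"
  by (simp add: smooth_vec_iff[of "\<lambda>p. vector [f1 p, f2 p, f3 p, f4 p]"] forall_4)

lemma has_derivative_vector_3:
  assumes "(f1 has_derivative f1') F" "(f2 has_derivative f2') F" "(f3 has_derivative f3') F"
  shows "((\<lambda>p. vector [f1 p, f2 p, f3 p] :: real^3) has_derivative (\<lambda>v. vector [f1' v, f2' v, f3' v])) F"
proof -
  have vec: "(vector [x, y, z] :: real^3)
      = x *\<^sub>R vector [1, 0, 0] + y *\<^sub>R vector [0, 1, 0] + z *\<^sub>R vector [0, 0, 1]" for x y z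
    by (simp add: vec_eq_iff forall_3)
  show ?thesis
    unfolding vec[of "f1 _"] vec[of "f1' _"]
    by (intro has_derivative_add has_derivative_scaleR_left assms)
qed

text \<open>The group \<open>\<real> \<ltimes> N\<close> with the Lie algebra spanned by \<open>S, X\<^sub>1, X\<^sub>2, X\<^sub>3\<close> with \<open>[S, X\<^sub>1] = a X\<^sub>1 + c X\<^sub>2\<close>,
  \<open>[S, X\<^sub>2] = b X\<^sub>2\<close>, \<open>[S, X\<^sub>3] = (a + b) X\<^sub>3\<close> and \<open>[X\<^sub>1, X\<^sub>2] = \<kappa> X\<^sub>3\<close>.\<close>

locale extension_of_nilpotent =
  fixes \<kappa> a b c :: real
begin

definition action :: "real \<Rightarrow> real^3 \<Rightarrow> real^3" where
  "action s x = vector [exp (a * s) * x $ 1, shear a b c s * x $ 1 + exp (b * s) * x $ 2,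
     exp ((a + b) * s) * x $ 3]"

abbreviation N :: "(real^3) monoid" where
  "N \<equiv> nilpotent_group \<kappa>"

abbreviation G :: "r4 monoid" where
  "G \<equiv> semidirect_R N action"

lemma smooth_action: "smooth_action N action"
  unfolding smooth_action_def
proof (intro conjI allI)
  show "action s \<in> hom N N" for s
    by (auto simp: hom_def nilpotent_group_def action_def vec_eq_iff forall_3 exp_add distrib_left
        distrib_right algebra_simps add_divide_distrib diff_divide_distrib)
  show "action 0 = id"
    by (rule ext) (simp add: action_def vec_eq_iff forall_3)
  show "action (s + t) = action s \<circ> action t" for s t
    by (rule ext) (simp add: action_def vec_eq_iff forall_3 shear_add exp_add distrib_left
        distrib_right algebra_simps)
  show "smooth (\<lambda>(s, n). action s n)"
    unfolding action_def case_prod_unfold by (intro smooth_intros)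
qed

lemma mult_G: "x \<otimes>\<^bsub>G\<^esub> y = (fst x + fst y, snd x + action (fst x) (snd y)
    + vector [0, 0, \<kappa> * (snd x $ 1 * action (fst x) (snd y) $ 2
        - snd x $ 2 * action (fst x) (snd y) $ 1) / 2])"
  by (simp add: semidirect_R_def nilpotent_group_def case_prod_unfold)

lemma lie_group: "lie_group G"
  unfolding lie_group_def
proof (intro conjI)
  note semi = group_semidirect_R[OF group_nilpotent_group _ smooth_action]
  have UNIV: "carrier N = UNIV"
    by (simp add: nilpotent_group_def)
  show "group G"
    by (rule semi(1)[OF UNIV])
  show "carrier G = UNIV"
    by (simp add: semidirect_R_def)
  show "smooth (\<lambda>(x, y). x \<otimes>\<^bsub>G\<^esub> y)"
    unfolding mult_G action_def case_prod_unfold by (intro smooth_intros)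
  have "inv\<^bsub>G\<^esub> x = (- fst x, action (- fst x) (- snd x))" for x
    using semi(2)[OF UNIV, of "fst x" "snd x"] by (simp add: inv_nilpotent_group)
  then show "smooth (\<lambda>x. inv\<^bsub>G\<^esub> x)"
    unfolding action_def by (simp only:) (intro smooth_intros)
qed

text \<open>The left-invariant field through \<open>w\<close> at the identity; \<open>w\<close> are the coordinates with respect
  to \<open>S, X\<^sub>1, X\<^sub>2, X\<^sub>3\<close>.\<close>

definition E :: "r4 \<Rightarrow> real^4 \<Rightarrow> r4" where
  "E p w = (w $ 1, vector [exp (a * fst p) * w $ 2,
     shear a b c (fst p) * w $ 2 + exp (b * fst p) * w $ 3,
     exp ((a + b) * fst p) * w $ 4
     + \<kappa> / 2 * (snd p $ 1 * (shear a b c (fst p) * w $ 2 + exp (b * fst p) * w $ 3)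
        - snd p $ 2 * (exp (a * fst p) * w $ 2))])"

definition \<theta> :: "r4 \<Rightarrow> r4 \<Rightarrow> real^4" where
  "\<theta> p v = vector [fst v, exp (- (a * fst p)) * snd v $ 1,
     exp (- (b * fst p)) * (snd v $ 2 - shear a b c (fst p) * (exp (- (a * fst p)) * snd v $ 1)),
     exp (- ((a + b) * fst p)) * (snd v $ 3 - \<kappa> / 2 * (snd p $ 1 * snd v $ 2 - snd p $ 2 * snd v $ 1))]"

definition C :: "real^4 \<Rightarrow> real^4 \<Rightarrow> real^4" where
  "C v w = vector [0, a * (v $ 1 * w $ 2 - v $ 2 * w $ 1),
     b * (v $ 1 * w $ 3 - v $ 3 * w $ 1) + c * (v $ 1 * w $ 2 - v $ 2 * w $ 1),
     (a + b) * (v $ 1 * w $ 4 - v $ 4 * w $ 1) + \<kappa> * (v $ 2 * w $ 3 - v $ 3 * w $ 2)]"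

lemma frechet_derivative_E:
  "frechet_derivative (\<lambda>p. E p w) (at p) v = (0, vector [a * exp (a * fst p) * fst v * w $ 2,
     (a * shear a b c (fst p) + c * exp (b * fst p)) * fst v * w $ 2 + b * exp (b * fst p) * fst v * w $ 3,
     (a + b) * exp ((a + b) * fst p) * fst v * w $ 4
     + \<kappa> / 2 * (snd v $ 1 * (shear a b c (fst p) * w $ 2 + exp (b * fst p) * w $ 3)
        + snd p $ 1 * ((a * shear a b c (fst p) + c * exp (b * fst p)) * fst v * w $ 2
          + b * exp (b * fst p) * fst v * w $ 3)
        - snd v $ 2 * (exp (a * fst p) * w $ 2)
        - snd p $ 2 * (a * exp (a * fst p) * fst v * w $ 2))])" (is "_ = ?D v")
proof -
  have fst': "((\<lambda>p::r4. fst p) has_derivative (\<lambda>v. fst v)) (at p)"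
    by (rule has_derivative_fst[OF has_derivative_ident])
  have snd': "((\<lambda>p::r4. snd p $ i) has_derivative (\<lambda>v. snd v $ i)) (at p)" for i
    by (rule bounded_linear.has_derivative[OF bounded_linear_vec_nth has_derivative_snd[OF has_derivative_ident]])
  have exp': "((\<lambda>p::r4. exp (k * fst p)) has_derivative (\<lambda>v. k * exp (k * fst p) * fst v)) (at p)" for k
    using has_derivative_exp[OF has_derivative_mult_right[OF fst', of k]] by (simp add: ac_simps)
  have shear': "((\<lambda>p::r4. shear a b c (fst p)) has_derivative
      (\<lambda>v. (a * shear a b c (fst p) + c * exp (b * fst p)) * fst v)) (at p)"
    using has_derivative_compose[OF fst' has_derivative_shear[unfolded has_field_derivative_def]] .
  note D = fst' snd' exp' shear' has_derivative_add has_derivative_diff has_derivative_mult_right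
    has_derivative_mult_left has_derivative_mult
  have 1: "((\<lambda>p. exp (a * fst p) * w $ 2) has_derivative (\<lambda>v. a * exp (a * fst p) * fst v * w $ 2)) (at p)"
    by (rule D)+
  have 2: "((\<lambda>p. shear a b c (fst p) * w $ 2 + exp (b * fst p) * w $ 3) has_derivative
      (\<lambda>v. (a * shear a b c (fst p) + c * exp (b * fst p)) * fst v * w $ 2
        + b * exp (b * fst p) * fst v * w $ 3)) (at p)"
    by (rule D)+
  have 3: "((\<lambda>p. exp ((a + b) * fst p) * w $ 4
        + \<kappa> / 2 * (snd p $ 1 * (shear a b c (fst p) * w $ 2 + exp (b * fst p) * w $ 3)
          - snd p $ 2 * (exp (a * fst p) * w $ 2))) has_derivative
      (\<lambda>v. (a + b) * exp ((a + b) * fst p) * fst v * w $ 4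
        + \<kappa> / 2 * ((snd p $ 1 * ((a * shear a b c (fst p) + c * exp (b * fst p)) * fst v * w $ 2
              + b * exp (b * fst p) * fst v * w $ 3)
            + snd v $ 1 * (shear a b c (fst p) * w $ 2 + exp (b * fst p) * w $ 3))
          - (snd p $ 2 * (a * exp (a * fst p) * fst v * w $ 2)
            + snd v $ 2 * (exp (a * fst p) * w $ 2))))) (at p)"
    by (intro has_derivative_add has_derivative_diff has_derivative_mult_right
        has_derivative_mult_left[OF exp'] has_derivative_mult[OF snd' 2] has_derivative_mult[OF snd' 1])
  show ?thesis
    unfolding E_def
    by (rule trans[OF fun_cong[OF frechet_derivative_eqI[OF
            has_derivative_Pair[OF has_derivative_const has_derivative_vector_3[OF 1 2 3]]]]])
      (simp add: algebra_simps)
qed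

lemma parallelization: "parallelization E \<theta> C"
proof (rule parallelization.intro)
  show "linear (E p)" for p
    by (rule linearI) (auto simp: E_def vec_eq_iff forall_3 algebra_simps add_divide_distrib diff_divide_distrib)
  show "linear (\<theta> p)" for p
    by (rule linearI) (auto simp: \<theta>_def vec_eq_iff forall_4 algebra_simps add_divide_distrib diff_divide_distrib)
  have exp: "exp x * (exp (- x) * y) = y" "exp (- x) * (exp x * y) = y" for x y :: real
    by (simp_all add: mult.assoc[symmetric] exp_minus)
  show "E p (\<theta> p v) = v" for p v
    by (rule prod_eqI) (simp_all add: E_def \<theta>_def vec_eq_iff forall_3 exp)
  show "\<theta> p (E p w) = w" for p w
    by (simp add: E_def \<theta>_def vec_eq_iff forall_4 exp)
  show "smooth (\<lambda>p. E p w)" for w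
    unfolding E_def by (intro smooth_intros)
  show "smooth (\<lambda>p. \<theta> p v)" for v
    unfolding \<theta>_def by (intro smooth_intros)
  show "lie_bracket (\<lambda>p. E p v) (\<lambda>p. E p w) = (\<lambda>p. E p (C v w))" for v w
    by (rule ext) (simp add: lie_bracket_def frechet_derivative_E, simp add: E_def C_def vec_eq_iff forall_3
        exp_add distrib_right algebra_simps add_divide_distrib diff_divide_distrib)
qed

text \<open>Left translations are affine, and the linear part of the translation by \<open>x\<close> is \<open>E x\<close>.\<close>

lemma left_translation_deriv_E: "left_translation_deriv G x p (E p w) = E (x \<otimes>\<^bsub>G\<^esub> p) w"
proof -
  let ?L = "\<lambda>v. E x (vector [fst v, snd v $ 1, snd v $ 2, snd v $ 3])"
  have "linear ?L"
    by (rule linearI) (auto simp: E_def vec_eq_iff forall_3 algebra_simps add_divide_distrib diff_divide_distrib)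
  then have "((\<lambda>y. ?L y + x) has_derivative (\<lambda>v. ?L v + 0)) (at p)"
    by (intro has_derivative_add has_derivative_const linear_imp_has_derivative)
  moreover have "(\<lambda>y. x \<otimes>\<^bsub>G\<^esub> y) = (\<lambda>y. ?L y + x)"
    by (intro ext prod_eqI) (simp_all add: mult_G action_def E_def vec_eq_iff forall_3)
  moreover have "?L (E p w) = E (x \<otimes>\<^bsub>G\<^esub> p) w"
    by (simp add: mult_G action_def E_def vec_eq_iff forall_3 shear_add exp_add distrib_left
        distrib_right, simp add: algebra_simps add_divide_distrib diff_divide_distrib)
  ultimately show ?thesis
    unfolding left_translation_deriv_def by (simp add: frechet_derivative_eqI)
qed

text \<open>The linear map \<open>P\<close> takes coordinates with respect to the wanted pseudo-orthonormal basis to those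
  with respect to \<open>S, X\<^sub>1, X\<^sub>2, X\<^sub>3\<close>. Left translations do not change coordinates, so a metric with
  constant coefficients is left-invariant.\<close>

lemma metric_lie_group_exists:
  assumes P: "linear P" "linear R" "\<And>x. R (P x) = x" "\<And>w. P (R w) = w"
    and \<epsilon>: "\<And>i. \<epsilon> $ i \<noteq> 0"
    and brackets: "C (P (axis 1 1)) (P (axis 2 1)) = P b12" "C (P (axis 1 1)) (P (axis 3 1)) = P b13"
      "C (P (axis 1 1)) (P (axis 4 1)) = P b14" "C (P (axis 2 1)) (P (axis 3 1)) = P b23"
      "C (P (axis 2 1)) (P (axis 4 1)) = P b24" "C (P (axis 3 1)) (P (axis 4 1)) = P b34"
  shows "\<exists>G g e. is_semidirect_R N G \<and> metric_lie_group G g \<epsilon> e \<and> has_brackets e b12 b13 b14 b23 b24 b34"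
proof -
  interpret parallelization E \<theta> C
    by (rule parallelization)
  define e :: "4 \<Rightarrow> r4 vfield" where "e i p = E p (P (axis i 1))" for i p
  define B where "B v w = diagonal_form \<epsilon> (R v) (R w)" for v w
  define g :: "r4 metric" where "g = coordinate_metric B \<theta>"
  have lin_comb_e: "lin_comb e x = (\<lambda>p. E p (P x))" for x
  proof
    fix p
    have "P x = (\<Sum>i\<in>UNIV. (x $ i) *\<^sub>R P (axis i 1))"
      using arg_cong[OF basis_expansion[of x], of P]
      by (simp add: scalar_mult_eq_scaleR linear_sum[OF P(1)] linear_cmul[OF P(1)])
    then show "lin_comb e x p = E p (P x)"
      by (simp add: lin_comb_def e_def linear_sum[OF linear_E] linear_cmul[OF linear_E])
  qed
  have bilinear_B: "bilinear B"
    using bilinear_diagonal_form[of \<epsilon>] unfolding bilinear_def B_def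
    by (auto intro!: linear_compose[of R, unfolded o_def] P(2))
  have B_commute: "B v w = B w v" for v w
    by (simp add: B_def diagonal_form_commute)
  have B_nondegenerate: "v = 0" if "\<And>w. B v w = 0" for v
  proof -
    have "diagonal_form \<epsilon> (R v) x = 0" for x
      using that[of "P x"] by (simp add: B_def P(3))
    then have "R v = 0"
      by (rule diagonal_form_nondegenerate[OF \<epsilon>])
    then show ?thesis
      using P(4)[of v] linear_0[OF P(1)] by simp
  qed
  have "g = conformal_metric B (\<lambda>_. 0)"
    by (simp add: g_def coordinate_metric_def conformal_metric_def)
  then have "pseudo_riemannian g"
    using pseudo_riemannian_conformal_metric[OF bilinear_B B_commute B_nondegenerate smooth_const] by simp
  moreover have "left_invariant_metric G g"
    unfolding left_invariant_metric_def
  proof (intro allI)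
    fix x p v w
    have "left_translation_deriv G x p v = E (x \<otimes>\<^bsub>G\<^esub> p) (\<theta> p v)" for v
      using left_translation_deriv_E[of x p "\<theta> p v"] by simp
    then show "g (x \<otimes>\<^bsub>G\<^esub> p) (left_translation_deriv G x p v) (left_translation_deriv G x p w) = g p v w"
      by (simp add: g_def coordinate_metric_def)
  qed
  moreover have "left_invariant_field G (e i)" for i
    unfolding left_invariant_field_def using smooth_E[of "P (axis i 1)"]
    by (simp add: e_def[abs_def] left_translation_deriv_E)
  moreover have "pseudo_orthonormal g \<epsilon> e"
    unfolding pseudo_orthonormal_def
    by (auto simp: g_def coordinate_metric_def e_def B_def P(3) diagonal_form_axis) (auto simp: axis_def)
  ultimately have "metric_lie_group G g \<epsilon> e"
    using lie_group by (simp add: metric_lie_group_def)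
  moreover have "has_brackets e b12 b13 b14 b23 b24 b34"
  proof -
    have "e i = (\<lambda>p. E p (P (axis i 1)))" for i
      by (rule ext) (rule e_def)
    then show ?thesis
      unfolding has_brackets_def lin_comb_e by (simp only: bracket_E brackets simp_thms)
  qed
  moreover have "is_semidirect_R N G"
    using smooth_action unfolding is_semidirect_R_def by blast
  ultimately show ?thesis
    by blast
qed

end

section \<open>The three families\<close>

text \<open>The image of the Ricci operator is spanned by the null vector \<open>e\<^sub>2 + e\<^sub>3\<close>, which it annihilates; the
  pair of \<open>e\<^sub>2 + e\<^sub>3\<close> and \<open>e\<^sub>2\<close> is the nontrivial block. The other families are similar.\<close>

lemma jordan_basis_1_12:
  "jordan_basis (\<lambda>a. vector [0, a $ 2 - a $ 3, a $ 2 - a $ 3, 0]) 0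
    [[axis 1 1], [axis 4 1], [vector [0, 1, 1, 0], axis 2 1 :: real^4]]" (is "jordan_basis ?Q 0 ?cs")
proof (rule jordan_basis_4)
  let ?S = "set (concat ?cs)"
  have "axis 3 1 = vector [0, 1, 1, 0] - (axis 2 1 :: real^4)"
    by (simp add: vec_eq_iff forall_4 axis_4)
  then have "axis 3 1 \<in> span ?S"
    by (simp add: span_base span_diff)
  then show "axis i 1 \<in> span ?S" for i
    using exhaust_4[of i] by (auto intro: span_base)
qed (auto intro!: linearI simp: vec_eq_iff forall_4 axis_4 less_Suc_eq algebra_simps)

lemma jordan_basis_22:
  "jordan_basis (\<lambda>a. vector [a $ 1 - a $ 3, a $ 2 - a $ 4, a $ 1 - a $ 3, a $ 2 - a $ 4]) 0
    [[vector [1, 0, 1, 0], axis 1 1], [vector [0, 1, 0, 1], axis 2 1 :: real^4]]" (is "jordan_basis ?Q 0 ?cs")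
proof (rule jordan_basis_4)
  let ?S = "set (concat ?cs)"
  have "axis 3 1 = vector [1, 0, 1, 0] - (axis 1 1 :: real^4)"
    "axis 4 1 = vector [0, 1, 0, 1] - (axis 2 1 :: real^4)"
    by (simp_all add: vec_eq_iff forall_4 axis_4)
  then have "axis 3 1 \<in> span ?S" "axis 4 1 \<in> span ?S"
    by (simp_all add: span_base span_diff)
  then show "axis i 1 \<in> span ?S" for i
    using exhaust_4[of i] by (auto intro: span_base)
qed (auto intro!: linearI simp: vec_eq_iff forall_4 axis_4 less_Suc_eq algebra_simps)

lemma jordan_basis_11_2:
  "jordan_basis (\<lambda>a. vector [0, 0, a $ 3 - a $ 4, a $ 3 - a $ 4]) 0
    [[axis 1 1], [axis 2 1], [vector [0, 0, 1, 1], axis 3 1 :: real^4]]" (is "jordan_basis ?Q 0 ?cs")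
proof (rule jordan_basis_4)
  let ?S = "set (concat ?cs)"
  have "axis 4 1 = vector [0, 0, 1, 1] - (axis 3 1 :: real^4)"
    by (simp add: vec_eq_iff forall_4 axis_4)
  then have "axis 4 1 \<in> span ?S"
    by (simp add: span_base span_diff)
  then show "axis i 1 \<in> span ?S" for i
    using exhaust_4[of i] by (auto intro: span_base)
qed (auto intro!: linearI simp: vec_eq_iff forall_4 axis_4 less_Suc_eq algebra_simps)

lemma independent_pair:
  fixes x y :: "real^4"
  assumes "x $ i \<noteq> 0" "y $ i = 0" "y \<noteq> 0"
  shows "independent {x, y}"
proof -
  have "x \<notin> span {y}"
    using assms(1,2) by (auto simp: span_singleton)
  then show ?thesis
    using assms(3) by (simp add: independent_insert)
qed

lemma brackets_coefficients:
  fixes c :: real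
  assumes "c \<noteq> 0"
  shows "- 1 / (2 * c) = - (1 / (2 * c))"
    "(2 * c\<^sup>2 + 1) / (2 * c) = c + 1 / (2 * c)"
  using assms by (simp_all add: field_simps power2_eq_square)

lemma geometry_1_12:
  assumes c1: "c1 \<noteq> 0" and ex: "example_1_12 c1 c2 c3 G g e"
  shows "solvable G \<and> conformally_flat g \<and> \<not> ricci_parallel g e \<and>
           (\<forall>p. segre_1_12 (g p) (ricci_operator_at g e p)) \<and> walker_manifold g \<and>
           (let D = spanned_by [lin_comb e (vector [0, 1, 1, 0])];
                D' = spanned_by [lin_comb e (vector [0, 1, 1, 0]),
                                 lin_comb e (vector [1, 0, 0, -1])]
            in left_invariant_distribution G D \<and> parallel_null_distribution g 1 D \<and>
               left_invariant_distribution G D' \<and> parallel_null_distribution g 2 D')"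
proof -
  define d where "d = 1 / (2 * c1)"
  have semi: "is_semidirect_R translation_group G"
    and group: "metric_lie_group G g neutral_signature e"
    and brackets: "has_brackets e (vector [- d, - c2, - c2, 0]) (vector [d, c2, c2, 0]) 0
      (vector [0, c1 + d, c1 + d, 0]) (vector [0, c3, c3, c1]) (vector [0, - c3, - c3, - c1])"
    using ex unfolding example_1_12_def brackets_coefficients[OF c1] d_def by blast+
  interpret metric_lie_algebra_of_group neutral_signature "vector [- d, - c2, - c2, 0]"
    "vector [d, c2, c2, 0]" 0 "vector [0, c1 + d, c1 + d, 0]" "vector [0, c3, c3, c1]"
    "vector [0, - c3, - c3, - c1]" "\<Gamma>_1_12 c1 c2 c3 d" "vector [0, c1, c1, 0]"
    "\<lambda>a. vector [0, a $ 2 - a $ 3, a $ 2 - a $ 3, 0]" G g e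
    by (intro metric_lie_algebra_of_group.intro metric_lie_algebra_1_12 refl
        metric_lie_algebra_of_group_axioms.intro group brackets fst_mult_semidirect[OF semi])
      (use c1 in \<open>simp add: d_def\<close>)
  let ?n = "vector [0, 1, 1, 0] :: real^4" and ?m = "vector [1, 0, 0, -1] :: real^4"
  have n: "\<Gamma>_1_12 c1 c2 c3 d a ?n = ((a $ 2 - a $ 3) * (c1 + d)) *\<^sub>R ?n" for a
    by (simp add: vec_eq_iff forall_4 \<Gamma>_1_12_nth)
  have m: "\<Gamma>_1_12 c1 c2 c3 d a ?m = (d * a $ 1 + c1 * a $ 4 + (a $ 2 - a $ 3) * (c2 - c3)) *\<^sub>R ?n" for a
    by (simp add: vec_eq_iff forall_4 \<Gamma>_1_12_nth)
  have ne: "?n \<noteq> 0" "?m \<noteq> 0" "?n \<noteq> ?m"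
    by (simp_all add: vec_eq_iff forall_4)
  have "diagonal_form neutral_signature a b = 0" if "a \<in> set [?n]" "b \<in> set [?n]" for a b
    using that by (auto simp: diagonal_form_def sum_4 neutral_signature_def)
  moreover have "\<Gamma>_1_12 c1 c2 c3 d a b \<in> span (set [?n])" if "b \<in> set [?n]" for a b
    using that by (auto simp: n intro!: span_add span_scale intro: span_base)
  moreover have "independent (set [?n])" "card (set [?n]) = 1"
    using ne by simp_all
  ultimately have D: "parallel_null_distribution g 1 (spanned_by [lin_comb e ?n])"
    "left_invariant_distribution G (spanned_by [lin_comb e ?n])"
    using parallel_null_distribution_spanned_by[of "[?n]" 1] by simp_all
  have "diagonal_form neutral_signature a b = 0" if "a \<in> set [?n, ?m]" "b \<in> set [?n, ?m]" for a b
    using that by (auto simp: diagonal_form_def sum_4 neutral_signature_def)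
  moreover have "\<Gamma>_1_12 c1 c2 c3 d a b \<in> span (set [?n, ?m])" if "b \<in> set [?n, ?m]" for a b
    using that by (auto simp: n m intro!: span_add span_scale intro: span_base)
  moreover have "independent (set [?n, ?m])" "card (set [?n, ?m]) = 2"
    using ne independent_pair[of ?n 2 ?m] by simp_all
  ultimately have D': "parallel_null_distribution g 2 (spanned_by [lin_comb e ?n, lin_comb e ?m])"
    "left_invariant_distribution G (spanned_by [lin_comb e ?n, lin_comb e ?m])"
    using parallel_null_distribution_spanned_by[of "[?n, ?m]" 2] by simp_all
  have "segre_1_12 (g p) (ricci_operator_at g e p)" for p
    using jordan_basis_ricci_operator[OF jordan_basis_1_12, of p]
      inner_lin_comb[of p "axis 1 1" "axis 1 1"] inner_lin_comb[of p "axis 4 1" "axis 4 1"]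
    unfolding segre_1_12_def diagonal_form_axis
    by (intro exI conjI) (auto simp: neutral_signature_def axis_4)
  moreover have "walker_manifold g"
    using D(1) zero_less_one unfolding walker_manifold_def by blast
  moreover have "solvable G"
    using semidirect_solvable[OF _ semi lie_group] by simp
  ultimately show ?thesis
    unfolding Let_def using conformally_flat not_ricci_parallel D D' by blast
qed

lemma geometry_22:
  assumes ex: "example_22 G g e"
  shows "solvable G \<and> conformally_flat g \<and> \<not> ricci_parallel g e \<and>
           (\<forall>p. segre_22 (ricci_operator_at g e p)) \<and> walker_manifold g \<and>
           (let D' = spanned_by [lin_comb e (vector [1, 0, 1, 0]),
                                 lin_comb e (vector [0, 1, 0, 1])]
            in left_invariant_distribution G D' \<and> parallel_null_distribution g 2 D')"
proof -
  have semi: "is_semidirect_R heisenberg_group G"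
    and group: "metric_lie_group G g neutral_signature e"
    and brackets: "has_brackets e (vector [0, 0, 0, 1/4]) (vector [3/2, 0, 3/2, 0])
      (vector [0, 5/4, 0, 1]) (vector [0, 1, 0, 5/4]) 0 (vector [0, - (1/4), 0, 0])"
    using ex unfolding example_22_def by blast+
  interpret metric_lie_algebra_of_group neutral_signature "vector [0, 0, 0, 1/4]"
    "vector [3/2, 0, 3/2, 0]" "vector [0, 5/4, 0, 1]" "vector [0, 1, 0, 5/4]" 0
    "vector [0, - (1/4), 0, 0]" \<Gamma>_22 "vector [1/2, 0, 1/2, 0]"
    "\<lambda>a. vector [a $ 1 - a $ 3, a $ 2 - a $ 4, a $ 1 - a $ 3, a $ 2 - a $ 4]" G g e
    by (intro metric_lie_algebra_of_group.intro metric_lie_algebra_22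
        metric_lie_algebra_of_group_axioms.intro group brackets fst_mult_semidirect[OF semi])
  let ?n = "vector [1, 0, 1, 0] :: real^4" and ?m = "vector [0, 1, 0, 1] :: real^4"
  have n: "\<Gamma>_22 a ?n = (3/2 * (a $ 1 - a $ 3)) *\<^sub>R ?n + (a $ 2 - a $ 4) *\<^sub>R ?m" for a
    by (simp add: vec_eq_iff forall_4 \<Gamma>_22_nth)
  have m: "\<Gamma>_22 a ?m = (1/2 * (a $ 2 - a $ 4)) *\<^sub>R ?n + (3/4 * (a $ 1 - a $ 3)) *\<^sub>R ?m" for a
    by (simp add: vec_eq_iff forall_4 \<Gamma>_22_nth diff_divide_distrib)
  have ne: "?n \<noteq> 0" "?m \<noteq> 0" "?n \<noteq> ?m"
    by (simp_all add: vec_eq_iff forall_4)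
  have "diagonal_form neutral_signature a b = 0" if "a \<in> set [?n, ?m]" "b \<in> set [?n, ?m]" for a b
    using that by (auto simp: diagonal_form_def sum_4 neutral_signature_def)
  moreover have "\<Gamma>_22 a b \<in> span (set [?n, ?m])" if "b \<in> set [?n, ?m]" for a b
    using that by (auto simp: n m intro!: span_add span_scale intro: span_base)
  moreover have "independent (set [?n, ?m])" "card (set [?n, ?m]) = 2"
    using ne independent_pair[of ?n 1 ?m] by simp_all
  ultimately have D: "parallel_null_distribution g 2 (spanned_by [lin_comb e ?n, lin_comb e ?m])"
    "left_invariant_distribution G (spanned_by [lin_comb e ?n, lin_comb e ?m])"
    using parallel_null_distribution_spanned_by[of "[?n, ?m]" 2] by simp_all
  have "segre_22 (ricci_operator_at g e p)" for p
    using jordan_basis_ricci_operator[OF jordan_basis_22, of p] unfolding list.map segre_22_def by blast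
  moreover have "walker_manifold g"
    using D(1) zero_less_numeral unfolding walker_manifold_def by blast
  moreover have "solvable G"
    using semidirect_solvable[OF _ semi lie_group] by simp
  ultimately show ?thesis
    unfolding Let_def using conformally_flat not_ricci_parallel D by blast
qed

lemma geometry_11_2:
  assumes c2: "c2 \<noteq> 0" and ex: "example_11_2 c1 c2 c3 c4 G g e"
  shows "solvable G \<and> conformally_flat g \<and> \<not> ricci_parallel g e \<and>
           (\<forall>p. segre_11_2 (g p) (ricci_operator_at g e p)) \<and> walker_manifold g \<and>
           (let D = spanned_by [lin_comb e (vector [0, 0, 1, 1])]
            in left_invariant_distribution G D \<and> parallel_null_distribution g 1 D)"
proof -
  define d where "d = 1 / (2 * c2)"
  have semi: "is_semidirect_R (if c1 = 0 then translation_group else heisenberg_group) G"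
    and group: "metric_lie_group G g lorentzian_signature e"
    and brackets: "has_brackets e (vector [0, 0, c1, c1]) (vector [- d, - c1, - c3, - c3])
      (vector [d, c1, c3, c3]) (vector [0, - c2, c4, c4]) (vector [0, c2, - c4, - c4])
      (vector [0, 0, c2 + d, c2 + d])"
    using ex unfolding example_11_2_def brackets_coefficients[OF c2] d_def by blast+
  interpret metric_lie_algebra_of_group lorentzian_signature "vector [0, 0, c1, c1]"
    "vector [- d, - c1, - c3, - c3]" "vector [d, c1, c3, c3]" "vector [0, - c2, c4, c4]"
    "vector [0, c2, - c4, - c4]" "vector [0, 0, c2 + d, c2 + d]" "\<Gamma>_11_2 c1 c2 c3 c4 d"
    "vector [0, 0, c2, c2]" "\<lambda>a. vector [0, 0, a $ 3 - a $ 4, a $ 3 - a $ 4]" G g e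
    by (intro metric_lie_algebra_of_group.intro metric_lie_algebra_11_2 refl
        metric_lie_algebra_of_group_axioms.intro group brackets fst_mult_semidirect[OF semi])
      (use c2 in \<open>simp add: d_def\<close>)
  let ?n = "vector [0, 0, 1, 1] :: real^4"
  have n: "\<Gamma>_11_2 c1 c2 c3 c4 d a ?n = ((a $ 3 - a $ 4) * (c2 + d)) *\<^sub>R ?n" for a
    by (simp add: vec_eq_iff forall_4 \<Gamma>_11_2_nth)
  have ne: "?n \<noteq> 0"
    by (simp add: vec_eq_iff forall_4)
  have "diagonal_form lorentzian_signature a b = 0" if "a \<in> set [?n]" "b \<in> set [?n]" for a b
    using that by (auto simp: diagonal_form_def sum_4 lorentzian_signature_def)
  moreover have "\<Gamma>_11_2 c1 c2 c3 c4 d a b \<in> span (set [?n])" if "b \<in> set [?n]" for a b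
    using that by (auto simp: n intro!: span_add span_scale intro: span_base)
  moreover have "independent (set [?n])" "card (set [?n]) = 1"
    using ne by simp_all
  ultimately have D: "parallel_null_distribution g 1 (spanned_by [lin_comb e ?n])"
    "left_invariant_distribution G (spanned_by [lin_comb e ?n])"
    using parallel_null_distribution_spanned_by[of "[?n]" 1] by simp_all
  have "segre_11_2 (g p) (ricci_operator_at g e p)" for p
    using jordan_basis_ricci_operator[OF jordan_basis_11_2, of p]
      inner_lin_comb[of p "axis 1 1" "axis 1 1"] inner_lin_comb[of p "axis 2 1" "axis 2 1"]
    unfolding segre_11_2_def diagonal_form_axis
    by (intro exI conjI) (auto simp: lorentzian_signature_def axis_4)
  moreover have "walker_manifold g"
    using D(1) zero_less_one unfolding walker_manifold_def by blast
  moreover have "solvable G"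
    using semidirect_solvable[OF _ semi lie_group] by simp
  ultimately show ?thesis
    unfolding Let_def using conformally_flat not_ricci_parallel D by blast
qed

text \<open>With \<open>a = d\<close>, \<open>b = c\<^sub>1\<close> and \<open>c = 0\<close> take \<open>e\<^sub>2 = S\<close>, \<open>e\<^sub>3 = X\<^sub>3 - S\<close>, \<open>e\<^sub>1 = X\<^sub>1 + \<alpha> X\<^sub>3\<close> and
  \<open>e\<^sub>4 = X\<^sub>2 + \<beta> X\<^sub>3\<close>. The eigenvalue \<open>d + c\<^sub>1\<close> of \<open>X\<^sub>3\<close> exceeds those of \<open>X\<^sub>1\<close> and \<open>X\<^sub>2\<close> by \<open>c\<^sub>1\<close> and \<open>d\<close>, so
  \<open>\<alpha> = c\<^sub>2 / c\<^sub>1\<close> and \<open>\<beta> = c\<^sub>3 / d\<close> produce the brackets with \<open>c\<^sub>2\<close> and \<open>c\<^sub>3\<close>.\<close>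

lemma exists_1_12:
  assumes c1: "c1 \<noteq> 0"
  shows "\<exists>G g e. example_1_12 c1 c2 c3 G g e"
proof -
  define d where "d = 1 / (2 * c1)"
  have d: "d \<noteq> 0" "c1 * d = 1 / 2"
    using c1 by (simp_all add: d_def)
  let ?\<alpha> = "c2 / c1" and ?\<beta> = "c3 / d"
  let ?P = "\<lambda>x::real^4. vector [x $ 2 - x $ 3, x $ 1, x $ 4, ?\<alpha> * x $ 1 + x $ 3 + ?\<beta> * x $ 4] :: real^4"
  let ?R = "\<lambda>w::real^4. let z = w $ 4 - ?\<alpha> * w $ 2 - ?\<beta> * w $ 3 in vector [w $ 2, w $ 1 + z, z, w $ 3] :: real^4"
  have "\<exists>G g e. is_semidirect_R (nilpotent_group 0) G \<and> metric_lie_group G g neutral_signature e \<and>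
      has_brackets e (vector [- d, - c2, - c2, 0]) (vector [d, c2, c2, 0]) 0
        (vector [0, c1 + d, c1 + d, 0]) (vector [0, c3, c3, c1]) (vector [0, - c3, - c3, - c1])"
  proof (rule extension_of_nilpotent.metric_lie_group_exists[of ?P ?R neutral_signature 0 d c1 0])
    show "linear ?P" "linear ?R"
      by (rule linearI; simp add: vec_eq_iff forall_4 Let_def algebra_simps add_divide_distrib)+
    show "neutral_signature $ i \<noteq> 0" for i
      using exhaust_4[of i] by (auto simp: neutral_signature_def)
  qed (use c1 d in \<open>simp_all add: vec_eq_iff forall_4 Let_def extension_of_nilpotent.C_def axis_4
      field_simps\<close>)
  then show ?thesis
    unfolding example_1_12_def brackets_coefficients[OF c1] d_def nilpotent_group_0 .
qed

text \<open>With \<open>a = 3/2\<close>, \<open>b = - 1/4\<close> and \<open>c = 0\<close> take \<open>e\<^sub>1 = S\<close>, \<open>e\<^sub>3 = X\<^sub>1 - S\<close>, \<open>e\<^sub>2 = X\<^sub>2 - 1/6 X\<^sub>3\<close> and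
  \<open>e\<^sub>4 = - X\<^sub>3 - e\<^sub>2\<close>. The centre of the Heisenberg algebra is spanned by \<open>e\<^sub>2 + e\<^sub>4 = - X\<^sub>3\<close>.\<close>

lemma exists_22: "\<exists>G g e. example_22 G g e"
proof -
  let ?P = "\<lambda>x::real^4. vector [x $ 1 - x $ 3, x $ 3, x $ 2 - x $ 4, - (x $ 2 + 5 * x $ 4) / 6] :: real^4"
  let ?R = "\<lambda>w::real^4. let z = - w $ 4 - w $ 3 / 6 in vector [w $ 1 + w $ 2, z + w $ 3, w $ 2, z] :: real^4"
  have "\<exists>G g e. is_semidirect_R (nilpotent_group 1) G \<and> metric_lie_group G g neutral_signature e \<and>
      has_brackets e (vector [0, 0, 0, 1/4]) (vector [3/2, 0, 3/2, 0])
      (vector [0, 5/4, 0, 1]) (vector [0, 1, 0, 5/4]) 0 (vector [0, - (1/4), 0, 0])"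
  proof (rule extension_of_nilpotent.metric_lie_group_exists[of ?P ?R neutral_signature 1 "3/2" "- 1/4" 0])
    show "linear ?P" "linear ?R"
      by (rule linearI; simp add: vec_eq_iff forall_4 Let_def field_simps)+
    show "neutral_signature $ i \<noteq> 0" for i
      using exhaust_4[of i] by (auto simp: neutral_signature_def)
  qed (simp_all add: vec_eq_iff forall_4 Let_def extension_of_nilpotent.C_def axis_4 field_simps)
  then show ?thesis
    unfolding example_22_def nilpotent_group_1 .
qed

text \<open>With \<open>a = d\<close>, \<open>b = c\<^sub>2\<close> and \<open>c = c\<^sub>1\<close> let \<open>v = \<nu> X\<^sub>3\<close> and take \<open>e\<^sub>3 = S\<close>, \<open>e\<^sub>4 = v - S\<close>,
  \<open>e\<^sub>1 = X\<^sub>1 + \<alpha> v\<close> and \<open>e\<^sub>2 = X\<^sub>2 + \<beta> v\<close>. The scale \<open>\<nu>\<close> turns \<open>[X\<^sub>1, X\<^sub>2] = \<kappa> X\<^sub>3\<close> into \<open>c\<^sub>1 v\<close>. The entry \<open>c\<^sub>1\<close>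
  of the matrix cannot be removed by a change of basis if the eigenvalues \<open>d\<close> and \<open>c\<^sub>2\<close> coincide.\<close>

lemma exists_11_2:
  assumes c2: "c2 \<noteq> 0"
  shows "\<exists>G g e. example_11_2 c1 c2 c3 c4 G g e"
proof -
  define d where "d = 1 / (2 * c2)"
  have d: "d \<noteq> 0" "c2 * d = 1 / 2"
    using c2 by (simp_all add: d_def)
  define \<kappa> \<nu> :: real where "\<kappa> = (if c1 = 0 then 0 else 1)" and "\<nu> = (if c1 = 0 then 1 else 1 / c1)"
  have \<nu>: "\<nu> \<noteq> 0" "\<kappa> = c1 * \<nu>"
    by (simp_all add: \<kappa>_def \<nu>_def)
  define \<beta> where "\<beta> = - c4 / d"
  define \<alpha> where "\<alpha> = (c3 + c1 * \<beta>) / c2"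
  have \<beta>: "d * \<beta> = - c4" and \<alpha>: "c2 * \<alpha> = c3 + c1 * \<beta>"
    using c2 d by (simp_all add: \<alpha>_def \<beta>_def)
  let ?P = "\<lambda>x::real^4. vector [x $ 3 - x $ 4, x $ 1, x $ 2, \<nu> * (\<alpha> * x $ 1 + \<beta> * x $ 2 + x $ 4)] :: real^4"
  let ?R = "\<lambda>w::real^4. let z = w $ 4 / \<nu> - \<alpha> * w $ 2 - \<beta> * w $ 3 in vector [w $ 2, w $ 3, w $ 1 + z, z] :: real^4"
  have "\<exists>G g e. is_semidirect_R (nilpotent_group \<kappa>) G \<and> metric_lie_group G g lorentzian_signature e \<and>
      has_brackets e (vector [0, 0, c1, c1]) (vector [- d, - c1, - c3, - c3])
      (vector [d, c1, c3, c3]) (vector [0, - c2, c4, c4]) (vector [0, c2, - c4, - c4])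
      (vector [0, 0, c2 + d, c2 + d])"
  proof (rule extension_of_nilpotent.metric_lie_group_exists[of ?P ?R lorentzian_signature \<kappa> d c2 c1])
    show "linear ?P" "linear ?R"
      by (rule linearI; simp add: vec_eq_iff forall_4 Let_def algebra_simps add_divide_distrib)+
    show "?R (?P x) = x" "?P (?R x) = x" for x
      using \<nu>(1) by (simp_all add: vec_eq_iff forall_4 Let_def field_simps)
    show "lorentzian_signature $ i \<noteq> 0" for i
      using exhaust_4[of i] by (auto simp: lorentzian_signature_def)
  qed (simp_all add: vec_eq_iff forall_4 extension_of_nilpotent.C_def axis_4 \<nu>(2),
      (use \<alpha> \<beta> in algebra)+)
  moreover have N: "nilpotent_group \<kappa> = (if c1 = 0 then translation_group else heisenberg_group)"
    by (simp add: \<kappa>_def nilpotent_group_0 nilpotent_group_1)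
  ultimately show ?thesis
    unfolding example_11_2_def brackets_coefficients[OF c2] d_def N by blast
qed

theorem theorem4p2:
  shows
    "(\<forall>c1 c2 c3. c1 \<noteq> 0 \<longrightarrow>
        (\<exists>G g e. example_1_12 c1 c2 c3 G g e) \<and>
        (\<forall>G g e. example_1_12 c1 c2 c3 G g e \<longrightarrow>
           solvable G \<and> conformally_flat g \<and> \<not> ricci_parallel g e \<and>
           (\<forall>p. segre_1_12 (g p) (ricci_operator_at g e p)) \<and> walker_manifold g \<and>
           (let D = spanned_by [lin_comb e (vector [0, 1, 1, 0])];
                D' = spanned_by [lin_comb e (vector [0, 1, 1, 0]),
                                 lin_comb e (vector [1, 0, 0, -1])]
            in left_invariant_distribution G D \<and> parallel_null_distribution g 1 D \<and>
               left_invariant_distribution G D' \<and> parallel_null_distribution g 2 D'))) \<and>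
     (\<forall>c1::real. c1 \<noteq> 0 \<longrightarrow>
        (\<exists>G g e. example_22 G g e) \<and>
        (\<forall>G g e. example_22 G g e \<longrightarrow>
           solvable G \<and> conformally_flat g \<and> \<not> ricci_parallel g e \<and>
           (\<forall>p. segre_22 (ricci_operator_at g e p)) \<and> walker_manifold g \<and>
           (let D' = spanned_by [lin_comb e (vector [1, 0, 1, 0]),
                                 lin_comb e (vector [0, 1, 0, 1])]
            in left_invariant_distribution G D' \<and> parallel_null_distribution g 2 D'))) \<and>
     (\<forall>c1 c2 c3 c4. c2 \<noteq> 0 \<longrightarrow>
        (\<exists>G g e. example_11_2 c1 c2 c3 c4 G g e) \<and>
        (\<forall>G g e. example_11_2 c1 c2 c3 c4 G g e \<longrightarrow>
           solvable G \<and> conformally_flat g \<and> \<not> ricci_parallel g e \<and>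
           (\<forall>p. segre_11_2 (g p) (ricci_operator_at g e p)) \<and> walker_manifold g \<and>
           (let D = spanned_by [lin_comb e (vector [0, 0, 1, 1])]
            in left_invariant_distribution G D \<and> parallel_null_distribution g 1 D)))"
proof (intro conjI, goal_cases)
  case 1
  show ?case
    by (intro allI impI, rule conjI, erule exists_1_12, intro allI impI, rule geometry_1_12, assumption+)
next
  case 2
  show ?case
    by (intro allI impI, rule conjI, rule exists_22, intro allI impI, rule geometry_22, assumption)
next
  case 3
  show ?case
    by (intro allI impI, rule conjI, erule exists_11_2, intro allI impI, rule geometry_11_2, assumption+)
qed

end
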